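(* (In $\mathsf{ZF}+\mathsf{AD}+\mathsf{DC}$.) For the additive group of the reals, $\mathbb{R}\to(\omega)^{\cdot+\cdot}_{\omega}$. That is, for every colouring $c:\mathbb{R}\to\omega$ there exists a set $X\subseteq\mathbb{R}$ with $|X|=\omega$ such that $X+X$ is $c$-monochromatic.
   Context: The base theory is $\mathsf{ZF}$ together with the Axiom of Determinacy $\mathsf{AD}$ (every two-player game of perfect information of length $\omega$ with moves in $\omega$ is determined) and the Axiom of Dependent Choice $\mathsf{DC}$; the full Axiom of Choice is not assumed. $X+X=\{a+b : a,b\in X\}$ (the case $a=b$ is included). A set is $c$-monochromatic if $c$ is constant on it. *)

theory Defs
  imports "HOL-Algebra.Ring"
begin

text \<open>
  HOL proves the axiom of choice, so AD is refutable about HOL's own sets and functions.  The base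
  theory is therefore treated as a first-order theory, and a theorem of ZF + AD + DC is a statement
  true in each of its models.  A model is an arbitrary type \<open>'a\<close> with an arbitrary binary relation
  \<open>\<epsilon>\<close>; it need be neither well-founded nor an \<open>\<omega>\<close>-model.  All sets, functions, games, strategies,
  colourings and real numbers below are elements of the model, and every condition imposed on the
  model is first order: no quantifier ranges over HOL sets or functions, except those over formulas
  and parameter assignments which express the two axiom schemes.
\<close>

text \<open>First-order formulas of set theory, with de Bruijn indices for variables.\<close>

datatype fm = Mem nat nat | Eq nat nat | Neg fm | Conj fm fm | Forall fm

primrec sat :: "('a \<Rightarrow> 'a \<Rightarrow> bool) \<Rightarrow> (nat \<Rightarrow> 'a) \<Rightarrow> fm \<Rightarrow> bool" where
  "sat E \<rho> (Mem i j) \<longleftrightarrow> E (\<rho> i) (\<rho> j)"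
| "sat E \<rho> (Eq i j) \<longleftrightarrow> \<rho> i = \<rho> j"
| "sat E \<rho> (Neg \<phi>) \<longleftrightarrow> \<not> sat E \<rho> \<phi>"
| "sat E \<rho> (Conj \<phi> \<psi>) \<longleftrightarrow> sat E \<rho> \<phi> \<and> sat E \<rho> \<psi>"
| "sat E \<rho> (Forall \<phi>) \<longleftrightarrow> (\<forall>x. sat E (case_nat x \<rho>) \<phi>)"

locale ordered_field = field F for F (structure) +
  fixes less :: "'b \<Rightarrow> 'b \<Rightarrow> bool" (infix "\<prec>" 50)
  assumes less_irrefl: "x \<in> carrier F \<Longrightarrow> \<not> x \<prec> x"
    and less_trans: "\<lbrakk>x \<in> carrier F; y \<in> carrier F; z \<in> carrier F; x \<prec> y; y \<prec> z\<rbrakk> \<Longrightarrow> x \<prec> z"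
    and less_total: "\<lbrakk>x \<in> carrier F; y \<in> carrier F\<rbrakk> \<Longrightarrow> x \<prec> y \<or> x = y \<or> y \<prec> x"
    and less_add: "\<lbrakk>x \<in> carrier F; y \<in> carrier F; z \<in> carrier F; x \<prec> y\<rbrakk> \<Longrightarrow> x \<oplus> z \<prec> y \<oplus> z"
    and less_mult: "\<lbrakk>x \<in> carrier F; y \<in> carrier F; \<zero> \<prec> x; \<zero> \<prec> y\<rbrakk> \<Longrightarrow> \<zero> \<prec> x \<otimes> y"

text \<open>No axiom is attached to this locale: it only fixes the membership relation.\<close>

locale set_structure =
  fixes mem :: "'a \<Rightarrow> 'a \<Rightarrow> bool" (infix "\<epsilon>" 50)
begin

definition subset :: "'a \<Rightarrow> 'a \<Rightarrow> bool" where
  "subset x y \<longleftrightarrow> (\<forall>z. z \<epsilon> x \<longrightarrow> z \<epsilon> y)"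

definition ZF :: bool where
  "ZF \<longleftrightarrow>
    \<comment> \<open>Extensionality\<close>
    (\<forall>x y. (\<forall>z. z \<epsilon> x \<longleftrightarrow> z \<epsilon> y) \<longrightarrow> x = y) \<and>
    \<comment> \<open>Foundation\<close>
    (\<forall>x. (\<exists>y. y \<epsilon> x) \<longrightarrow> (\<exists>y. y \<epsilon> x \<and> \<not> (\<exists>z. z \<epsilon> x \<and> z \<epsilon> y))) \<and>
    \<comment> \<open>Pairing\<close>
    (\<forall>a b. \<exists>p. \<forall>z. z \<epsilon> p \<longleftrightarrow> z = a \<or> z = b) \<and>
    \<comment> \<open>Union\<close>
    (\<forall>a. \<exists>u. \<forall>z. z \<epsilon> u \<longleftrightarrow> (\<exists>y. y \<epsilon> a \<and> z \<epsilon> y)) \<and>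
    \<comment> \<open>Power set\<close>
    (\<forall>a. \<exists>p. \<forall>z. z \<epsilon> p \<longleftrightarrow> subset z a) \<and>
    \<comment> \<open>Infinity\<close>
    (\<exists>w. (\<exists>z. z \<epsilon> w \<and> (\<forall>y. \<not> y \<epsilon> z)) \<and>
         (\<forall>x. x \<epsilon> w \<longrightarrow> (\<exists>s. s \<epsilon> w \<and> (\<forall>z. z \<epsilon> s \<longleftrightarrow> z \<epsilon> x \<or> z = x)))) \<and>
    \<comment> \<open>Separation scheme\<close>
    (\<forall>\<phi> \<rho> a. \<exists>b. \<forall>x. x \<epsilon> b \<longleftrightarrow> x \<epsilon> a \<and> sat mem (case_nat x \<rho>) \<phi>) \<and>
    \<comment> \<open>Replacement scheme\<close>
    (\<forall>\<phi> \<rho> a.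
      (\<forall>x y z. x \<epsilon> a \<and> sat mem (case_nat x (case_nat y \<rho>)) \<phi>
                   \<and> sat mem (case_nat x (case_nat z \<rho>)) \<phi> \<longrightarrow> y = z) \<longrightarrow>
      (\<exists>b. \<forall>y. y \<epsilon> b \<longleftrightarrow> (\<exists>x. x \<epsilon> a \<and> sat mem (case_nat x (case_nat y \<rho>)) \<phi>)))"

text \<open>
  \<open>coll P\<close> is the element of the model whose members are exactly the \<open>z\<close> with \<open>P z\<close>.  It is
  meaningful only if such an element exists; in each use below ZF proves that it does (and that it
  is unique).  Likewise \<open>app f x\<close> is only used for \<open>x\<close> in the domain of a function \<open>f\<close>.
\<close>

definition coll :: "('a \<Rightarrow> bool) \<Rightarrow> 'a" where
  "coll P = (THE y. \<forall>z. z \<epsilon> y \<longleftrightarrow> P z)"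

definition empty :: 'a where
  "empty = coll (\<lambda>z. False)"

definition upair :: "'a \<Rightarrow> 'a \<Rightarrow> 'a" where
  "upair a b = coll (\<lambda>z. z = a \<or> z = b)"

definition pair :: "'a \<Rightarrow> 'a \<Rightarrow> 'a" where
  "pair a b = upair (upair a a) (upair a b)"

definition cart :: "'a \<Rightarrow> 'a \<Rightarrow> 'a" where
  "cart A B = coll (\<lambda>p. \<exists>x y. x \<epsilon> A \<and> y \<epsilon> B \<and> p = pair x y)"

definition func :: "'a \<Rightarrow> 'a \<Rightarrow> 'a \<Rightarrow> bool" where
  "func f A B \<longleftrightarrow> subset f (cart A B) \<and> (\<forall>x. x \<epsilon> A \<longrightarrow> (\<exists>!y. pair x y \<epsilon> f))"

definition app :: "'a \<Rightarrow> 'a \<Rightarrow> 'a" where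
  "app f x = (THE y. pair x y \<epsilon> f)"

definition app2 :: "'a \<Rightarrow> 'a \<Rightarrow> 'a \<Rightarrow> 'a" where
  "app2 f x y = app f (pair x y)"

definition restrict :: "'a \<Rightarrow> 'a \<Rightarrow> 'a" where
  "restrict f A = coll (\<lambda>p. p \<epsilon> f \<and> (\<exists>x y. x \<epsilon> A \<and> p = pair x y))"

definition equipotent :: "'a \<Rightarrow> 'a \<Rightarrow> bool" where
  "equipotent A B \<longleftrightarrow> (\<exists>f. func f A B \<and> (\<forall>y. y \<epsilon> B \<longrightarrow> (\<exists>!x. x \<epsilon> A \<and> app f x = y)))"

definition succ :: "'a \<Rightarrow> 'a" where
  "succ x = coll (\<lambda>z. z \<epsilon> x \<or> z = x)"

definition is_inductive :: "'a \<Rightarrow> bool" where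
  "is_inductive w \<longleftrightarrow> empty \<epsilon> w \<and> (\<forall>x. x \<epsilon> w \<longrightarrow> succ x \<epsilon> w)"

definition omega :: 'a where
  "omega = coll (\<lambda>n. \<forall>w. is_inductive w \<longrightarrow> n \<epsilon> w)"

definition DC :: bool where
  "DC \<longleftrightarrow> (\<forall>A r. (\<exists>a. a \<epsilon> A) \<and> (\<forall>x. x \<epsilon> A \<longrightarrow> (\<exists>y. y \<epsilon> A \<and> pair x y \<epsilon> r)) \<longrightarrow>
     (\<exists>f. func f omega A \<and> (\<forall>n. n \<epsilon> omega \<longrightarrow> pair (app f n) (app f (succ n)) \<epsilon> r)))"

text \<open>
  Games on \<open>\<omega>\<close>.  A position is a finite sequence, i.e. a function from some \<open>n \<epsilon> \<omega>\<close> to \<open>\<omega>\<close>; a run is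
  a function \<open>x\<close> from \<open>\<omega>\<close> to \<open>\<omega>\<close>.  Player I moves at even stages, player II at odd stages, and
  player I wins the run \<open>x\<close> iff \<open>x\<close> lies in the payoff set.  A strategy of either player
  assigns a move to every position; only its values at that player's turns matter.
\<close>

definition even_stage :: "'a \<Rightarrow> bool" where
  "even_stage n \<longleftrightarrow> n \<epsilon> omega \<and>
     (\<exists>e. empty \<epsilon> e \<and> (\<forall>m. m \<epsilon> omega \<longrightarrow> (succ m \<epsilon> e \<longleftrightarrow> \<not> m \<epsilon> e)) \<and> n \<epsilon> e)"

definition odd_stage :: "'a \<Rightarrow> bool" where
  "odd_stage n \<longleftrightarrow> n \<epsilon> omega \<and> \<not> even_stage n"

definition positions :: 'a where
  "positions = coll (\<lambda>s. \<exists>n. n \<epsilon> omega \<and> func s n omega)"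

definition strategy :: "'a \<Rightarrow> bool" where
  "strategy \<sigma> \<longleftrightarrow> func \<sigma> positions omega"

definition wins_I :: "'a \<Rightarrow> 'a \<Rightarrow> bool" where
  "wins_I \<sigma> A \<longleftrightarrow>
     (\<forall>x. func x omega omega \<and> (\<forall>n. even_stage n \<longrightarrow> app x n = app \<sigma> (restrict x n)) \<longrightarrow> x \<epsilon> A)"

definition wins_II :: "'a \<Rightarrow> 'a \<Rightarrow> bool" where
  "wins_II \<tau> A \<longleftrightarrow>
     (\<forall>x. func x omega omega \<and> (\<forall>n. odd_stage n \<longrightarrow> app x n = app \<tau> (restrict x n)) \<longrightarrow> \<not> x \<epsilon> A)"

definition AD :: bool where
  "AD \<longleftrightarrow> (\<forall>A. (\<forall>x. x \<epsilon> A \<longrightarrow> func x omega omega) \<longrightarrow>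
     (\<exists>\<sigma>. strategy \<sigma> \<and> wins_I \<sigma> A) \<or> (\<exists>\<tau>. strategy \<tau> \<and> wins_II \<tau> A))"

text \<open>
  Inside the model the reals are, up to a unique isomorphism, the complete ordered field.  Field and
  order axioms do not depend on whether they are read inside or outside the model; completeness does,
  and it concerns only those subsets of \<open>R\<close> that are elements of the model.
\<close>

definition complete_ordered_field :: "'a \<Rightarrow> 'a \<Rightarrow> 'a \<Rightarrow> 'a \<Rightarrow> bool" where
  "complete_ordered_field R plusR timesR ltR \<longleftrightarrow>
     func plusR (cart R R) R \<and> func timesR (cart R R) R \<and> subset ltR (cart R R) \<and>
     (\<exists>zer on. ordered_field
        \<lparr>carrier = {x. x \<epsilon> R}, monoid.mult = app2 timesR, one = on, zero = zer, add = app2 plusR\<rparr>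
        (\<lambda>x y. pair x y \<epsilon> ltR)) \<and>
     (let le = (\<lambda>x y. pair x y \<epsilon> ltR \<or> x = y);
          upper = (\<lambda>S b. b \<epsilon> R \<and> (\<forall>x. x \<epsilon> S \<longrightarrow> le x b))
      in \<forall>S. subset S R \<and> (\<exists>x. x \<epsilon> S) \<and> (\<exists>b. upper S b) \<longrightarrow>
           (\<exists>s. upper S s \<and> (\<forall>b. upper S b \<longrightarrow> le s b)))"

definition sumset :: "'a \<Rightarrow> 'a \<Rightarrow> 'a" where
  "sumset opn X = coll (\<lambda>z. \<exists>a b. a \<epsilon> X \<and> b \<epsilon> X \<and> z = app2 opn a b)"

definition monochromatic :: "'a \<Rightarrow> 'a \<Rightarrow> bool" where
  "monochromatic c Y \<longleftrightarrow> (\<forall>y z. y \<epsilon> Y \<and> z \<epsilon> Y \<longrightarrow> app c y = app c z)"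

text \<open>\<open>sum_arrow G opn \<kappa> \<theta>\<close> renders \<open>G \<rightarrow> (\<kappa>)\<close> with superscript \<open>\<cdot>+\<cdot>\<close> and subscript \<open>\<theta>\<close>.\<close>

definition sum_arrow :: "'a \<Rightarrow> 'a \<Rightarrow> 'a \<Rightarrow> 'a \<Rightarrow> bool" where
  "sum_arrow G opn \<kappa> \<theta> \<longleftrightarrow>
     (\<forall>c. func c G \<theta> \<longrightarrow>
        (\<exists>X. subset X G \<and> equipotent \<kappa> X \<and> monochromatic c (sumset opn X)))"

end

end

theory Submission
  imports Defs
begin

text \<open>
  The statement is a consequence of the Baire category theorem.  Under determinacy every set of reals
  has the Baire property, so one of the countably many colour classes is comeagre in some
  interval \<open>(p,q)\<close>.  Choose distinct positive reals \<open>f 0, f 1, \<dots>\<close> close to \<open>0\<close>.  All but a meagre set of \<open>y\<close>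
  near the left end of \<open>(p,q)\<close> are such that \<open>y + f i + f j\<close> belongs to this class for all \<open>i\<close> and \<open>j\<close>, because
  an intersection of countably many comeagre sets is comeagre.  Then \<open>X = {y/2 + f i | i \<in> \<omega>}\<close> is as
  required.

  The proof below works with the Banach-Mazur game in place of category.  Player I declares a colour \<open>k\<close>;
  then the players alternately choose nested intervals from a countable base, and player I wins if all
  points of the intersection have colour \<open>k\<close>.  Determinacy is applied once, to this game.  Everything rests
  on one lemma, \<open>generic_point\<close>: against a fixed strategy of either player, countably many plays can be
  carried on at the same time such that they converge to prescribed translates of one point \<open>y\<close>.  If the
  strategy belongs to player II, the plays with declared colours \<open>0, 1, 2, \<dots>\<close>, all converging to \<open>y\<close>,
  include the one in which the colour of \<open>y\<close> was declared; so no strategy of player II wins.  If a winning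
  strategy belongs to player I, plays converging to the points \<open>y + f i + f j\<close> show that all of these
  have the declared colour.

  The argument has to be carried out inside an arbitrary model of the axioms, which may have nonstandard
  natural numbers.  Induction, recursion and the construction of \<open>y\<close> therefore refer to \<open>\<omega>\<close> and to functions
  of the model.  The simultaneous plays are organised as one sequence of dependent choices, each made
  from a set in the model, and Separation is applied to predicates that are recognised as definable by
  the rules \<open>dfn_rules\<close>.
\<close>

section \<open>Definable predicates and terms\<close>

named_theorems dfn_rules

primrec ren :: "(nat \<Rightarrow> nat) \<Rightarrow> fm \<Rightarrow> fm" where
  "ren g (Mem i j) = Mem (g i) (g j)"
| "ren g (Eq i j) = Eq (g i) (g j)"
| "ren g (Neg \<phi>) = Neg (ren g \<phi>)"
| "ren g (Conj \<phi> \<psi>) = Conj (ren g \<phi>) (ren g \<psi>)"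
| "ren g (Forall \<phi>) = Forall (ren (case_nat 0 (\<lambda>n. Suc (g n))) \<phi>)"

lemma sat_ren: "sat E \<rho> (ren g \<phi>) = sat E (\<lambda>n. \<rho> (g n)) \<phi>"
proof (induction \<phi> arbitrary: g \<rho>)
  case (Forall \<phi>)
  have "(\<lambda>n. case_nat x \<rho> (case_nat 0 (\<lambda>n. Suc (g n)) n)) = case_nat x (\<lambda>n. \<rho> (g n))" for x
    by (rule ext) (simp split: nat.split)
  then show ?case by (simp add: Forall)
qed simp_all

text \<open>
  Separation is available only for predicates given by a formula.  \<open>dfn P\<close> says that the predicate \<open>P\<close>
  on assignments is given by one, with elements of the model as parameters; \<open>dfnt t\<close> says the same of
  the graph of a function \<open>t\<close> of the assignment.  The closure rules collected in \<open>dfn_rules\<close> turn the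
  check that a concrete predicate is definable into a syntax-directed proof search, so that formulas
  never have to be written down.  Each variable of a formula stands either for an entry of the
  assignment (\<open>Inl\<close>) or for a parameter (\<open>Inr\<close>); under a quantifier the bound variable becomes entry \<open>0\<close>
  and the others move up by one.
\<close>

context set_structure
begin

definition dfn :: "((nat \<Rightarrow> 'a) \<Rightarrow> bool) \<Rightarrow> bool" where
  "dfn P \<longleftrightarrow> (\<exists>\<phi> f. \<forall>e. P e = sat mem (\<lambda>n. case_sum e id (f n)) \<phi>)"

definition dfnt :: "((nat \<Rightarrow> 'a) \<Rightarrow> 'a) \<Rightarrow> bool" where
  "dfnt t \<longleftrightarrow> dfn (\<lambda>e. e 0 = t (\<lambda>n. e (Suc n)))"

text \<open>
  A definite description that fails to denote has an unspecified value, which need not be definable.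
  The default value makes every description definable.
\<close>

definition the_or :: "('a \<Rightarrow> bool) \<Rightarrow> 'a" where
  "the_or P = (if \<exists>!y. P y then THE y. P y else empty)"

lemma dfnI: "(\<And>e. P e = sat mem (\<lambda>n. case_sum e id (f n)) \<phi>) \<Longrightarrow> dfn P"
  unfolding dfn_def by (intro exI[of _ \<phi>] exI[of _ f] allI)

lemma dfnE:
  assumes "dfn P"
  obtains \<phi> f where "\<And>e. P e = sat mem (\<lambda>n. case_sum e id (f n)) \<phi>"
  using assms unfolding dfn_def by (elim exE) (rule that, erule spec)

lemma dfn_neg: "dfn P \<Longrightarrow> dfn (\<lambda>e. \<not> P e)"
proof -
  assume "dfn P"
  then obtain \<phi> f where 1: "\<And>e. P e = sat mem (\<lambda>n. case_sum e id (f n)) \<phi>"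
    by (elim dfnE) (rule that)
  have "(\<not> P e) = sat mem (\<lambda>n. case_sum e id (f n)) (Neg \<phi>)" for e by (simp add: 1)
  then show ?thesis by (rule dfnI)
qed

lemma dfn_conj:
  assumes "dfn P" "dfn Q" shows "dfn (\<lambda>e. P e \<and> Q e)"
proof -
  from assms obtain \<phi> f \<psi> g where
    1: "\<And>e. P e = sat mem (\<lambda>n. case_sum e id (f n)) \<phi>" and
    2: "\<And>e. Q e = sat mem (\<lambda>n. case_sum e id (g n)) \<psi>"
    by (elim dfnE) (rule that)
  \<comment> \<open>The variables of the two formulas are interleaved, which keeps their parameters apart.\<close>
  define h where "h n = (if even n then f (n div 2) else g (n div 2))" for n
  have "(P e \<and> Q e) = sat mem (\<lambda>n. case_sum e id (h n))
      (Conj (ren (\<lambda>n. 2 * n) \<phi>) (ren (\<lambda>n. Suc (2 * n)) \<psi>))" for e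
    by (simp add: sat_ren 1 2 h_def)
  then show ?thesis by (rule dfnI)
qed

lemma dfn_all:
  assumes "dfn (\<lambda>e. P (e 0) (\<lambda>n. e (Suc n)))" shows "dfn (\<lambda>e. \<forall>x. P x e)"
proof -
  from assms obtain \<phi> f where
    1: "\<And>e. P (e 0) (\<lambda>n. e (Suc n)) = sat mem (\<lambda>n. case_sum e id (f n)) \<phi>"
    by (elim dfnE) (rule that)
  define g where "g n = (case f n of Inl 0 \<Rightarrow> 0 | _ \<Rightarrow> Suc n)" for n
  define h where "h n = (case f n of Inl 0 \<Rightarrow> Inl 0 | Inl (Suc i) \<Rightarrow> Inl i | Inr a \<Rightarrow> Inr a)" for n
  have 2: "(\<lambda>n. case_nat x (\<lambda>n. case_sum e id (h n)) (g n))
      = (\<lambda>n. case_sum (case_nat x e) id (f n))" for x e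
    by (rule ext) (simp add: g_def h_def split: sum.split nat.split)
  have "P x e = sat mem (\<lambda>n. case_sum (case_nat x e) id (f n)) \<phi>" for x e
    using 1[of "case_nat x e"] by simp
  then have "(\<forall>x. P x e) = sat mem (\<lambda>n. case_sum e id (h n)) (Forall (ren g \<phi>))" for e
    by (simp add: sat_ren 2)
  then show ?thesis by (rule dfnI)
qed

lemma dfn_ren:
  assumes "dfn P" shows "dfn (\<lambda>e. P (\<lambda>n. e (g n)))"
proof -
  from assms obtain \<phi> f where
    1: "\<And>e. P e = sat mem (\<lambda>n. case_sum e id (f n)) \<phi>" by (elim dfnE) (rule that)
  define h where "h n = (case f n of Inl i \<Rightarrow> Inl (g i) | Inr a \<Rightarrow> Inr a)" for n
  have 2: "(\<lambda>n. case_sum (\<lambda>n. e (g n)) id (f n)) = (\<lambda>n. case_sum e id (h n))" for e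
    by (rule ext) (simp add: h_def split: sum.split)
  have "P (\<lambda>n. e (g n)) = sat mem (\<lambda>n. case_sum e id (h n)) \<phi>" for e
    using 1 2 by simp
  then show ?thesis by (rule dfnI)
qed

lemma dfn_const: "dfn (\<lambda>e. b)"
proof -
  have T: "dfn (\<lambda>e. True)" unfolding dfn_def
    by (rule exI[of _ "Eq 0 0"], rule exI[of _ "\<lambda>n. Inl n"]) simp
  show ?thesis
  proof (cases b)
    case True with T show ?thesis by simp
  next
    case False with dfn_neg[OF T] show ?thesis by simp
  qed
qed

lemma dfn_disj: "dfn P \<Longrightarrow> dfn Q \<Longrightarrow> dfn (\<lambda>e. P e \<or> Q e)"
  using dfn_neg[OF dfn_conj[OF dfn_neg dfn_neg], of P Q] by simp

lemma dfn_imp: "dfn P \<Longrightarrow> dfn Q \<Longrightarrow> dfn (\<lambda>e. P e \<longrightarrow> Q e)"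
  unfolding imp_conv_disj by (intro dfn_disj dfn_neg)

lemma dfn_iff: "dfn P \<Longrightarrow> dfn Q \<Longrightarrow> dfn (\<lambda>e. P e = Q e)"
  unfolding iff_conv_conj_imp by (intro dfn_conj dfn_imp)

lemma dfn_ex:
  assumes "dfn (\<lambda>e. P (e 0) (\<lambda>n. e (Suc n)))" shows "dfn (\<lambda>e. \<exists>x. P x e)"
  using dfn_neg[OF dfn_all[of "\<lambda>x e. \<not> P x e", OF dfn_neg[OF assms]]] by simp

lemma dfnt_var: "dfnt (\<lambda>e. e i)"
proof -
  define f :: "nat \<Rightarrow> nat + 'a" where "f n = Inl (if n = 0 then 0 else Suc i)" for n
  have "(e 0 = e (Suc i)) = sat mem (\<lambda>n. case_sum e id (f n)) (Eq 0 1)" for e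
    by (simp add: f_def)
  then show ?thesis unfolding dfnt_def by (rule dfnI)
qed

lemma dfnt_const: "dfnt (\<lambda>e. a)"
proof -
  define f :: "nat \<Rightarrow> nat + 'a" where "f n = (if n = 0 then Inl 0 else Inr a)" for n
  have "(e 0 = a) = sat mem (\<lambda>n. case_sum e id (f n)) (Eq 0 1)" for e
    by (simp add: f_def)
  then show ?thesis unfolding dfnt_def by (rule dfnI)
qed

lemma dfnt_shift: "dfnt t \<Longrightarrow> dfnt (\<lambda>e. t (\<lambda>n. e (Suc n)))"
  unfolding dfnt_def
  by (drule dfn_ren[where g = "case_nat 0 (\<lambda>n. Suc (Suc n))"]) simp

lemma dfn_subst:
  assumes "dfnt t" "dfn (\<lambda>e. P (e 0) (\<lambda>n. e (Suc n)))" shows "dfn (\<lambda>e. P (t e) e)"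
proof -
  have "dfn (\<lambda>e. \<exists>x. x = t e \<and> P x e)"
    by (rule dfn_ex, rule dfn_conj) (use assms in \<open>simp_all add: dfnt_def\<close>)
  then show ?thesis by simp
qed

text \<open>
  A defined notion is shown to be definable once, applied to variables; the lifting lemmas then
  substitute arbitrary definable terms for its arguments.
\<close>

lemma dfn_lift1: "dfn (\<lambda>e. Q (e 0)) \<Longrightarrow> dfnt s \<Longrightarrow> dfn (\<lambda>e. Q (s e))"
  by (rule dfn_subst)

lemma dfn_lift2:
  assumes "dfn (\<lambda>e. Q (e 0) (e (Suc 0)))" "dfnt s" "dfnt t"
  shows "dfn (\<lambda>e. Q (s e) (t e))"
proof -
  have 1: "dfn (\<lambda>e. Q (e (Suc 0)) (e 0))"
    using dfn_ren[OF assms(1), of "\<lambda>n. if n = 0 then Suc 0 else 0"] by simp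
  have 2: "dfn (\<lambda>e. Q (e 0) (t (\<lambda>n. e (Suc n))))"
    by (rule dfn_subst[where P = "\<lambda>y e. Q (e 0) y"]) (use 1 assms dfnt_shift in auto)
  show ?thesis
    by (rule dfn_subst[where P = "\<lambda>x e. Q x (t e)"]) (use 2 assms in auto)
qed

lemma dfn_lift3:
  assumes "dfn (\<lambda>e. Q (e 0) (e (Suc 0)) (e (Suc (Suc 0))))" "dfnt s" "dfnt t" "dfnt u"
  shows "dfn (\<lambda>e. Q (s e) (t e) (u e))"
proof -
  have 1: "dfn (\<lambda>e. Q (e (Suc 0)) (e (Suc (Suc 0))) (e 0))"
    using dfn_ren[OF assms(1), of "\<lambda>n. if n = 0 then Suc 0 else if n = Suc 0 then Suc (Suc 0) else 0"]
    by simp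
  have 2: "dfn (\<lambda>e. Q (e 0) (e (Suc 0)) (u (\<lambda>n. e (Suc (Suc n)))))"
    by (rule dfn_subst[where P = "\<lambda>y e. Q (e 0) (e (Suc 0)) y"]) 
       (use 1 dfnt_shift[OF dfnt_shift[OF assms(4)]] in auto)
  have 2: "dfn (\<lambda>e. Q (e (Suc 0)) (e 0) (u (\<lambda>n. e (Suc (Suc n)))))"
    using dfn_ren[OF 2, of "case_nat (Suc 0) (case_nat 0 (\<lambda>n. Suc (Suc n)))"] by simp
  have 3: "dfn (\<lambda>e. Q (e 0) (t (\<lambda>n. e (Suc n))) (u (\<lambda>n. e (Suc n))))"
    by (rule dfn_subst[where P = "\<lambda>y e. Q (e 0) y (u (\<lambda>n. e (Suc n)))"])
       (use 2 dfnt_shift[OF assms(3)] in auto)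
  show ?thesis
    by (rule dfn_subst[where P = "\<lambda>x e. Q x (t e) (u e)"]) (use 3 assms in auto)
qed

lemma dfn_mem: "dfnt s \<Longrightarrow> dfnt t \<Longrightarrow> dfn (\<lambda>e. s e \<epsilon> t e)"
proof (rule dfn_lift2)
  define f :: "nat \<Rightarrow> nat + 'a" where "f n = Inl n" for n
  have "(e 0 \<epsilon> e (Suc 0)) = sat mem (\<lambda>n. case_sum e id (f n)) (Mem 0 1)" for e
    by (simp add: f_def)
  then show "dfn (\<lambda>e. e 0 \<epsilon> e (Suc 0))" by (rule dfnI)
qed

lemma dfn_eq: "dfnt s \<Longrightarrow> dfnt t \<Longrightarrow> dfn (\<lambda>e. s e = t e)"
proof (rule dfn_lift2)
  show "dfn (\<lambda>e. e 0 = e (Suc 0))" using dfnt_var[of 0] by (simp add: dfnt_def)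
qed

lemma dfnt_lift1: "dfnt (\<lambda>e. F (e 0)) \<Longrightarrow> dfnt s \<Longrightarrow> dfnt (\<lambda>e. F (s e))"
  unfolding dfnt_def[of "\<lambda>e. F (e 0)"] dfnt_def[of "\<lambda>e. F (s e)"]
  by (rule dfn_lift2[where Q = "\<lambda>z x. z = F x"]) (simp_all add: dfnt_var dfnt_shift)

lemma dfnt_lift2:
  "dfnt (\<lambda>e. F (e 0) (e (Suc 0))) \<Longrightarrow> dfnt s \<Longrightarrow> dfnt t \<Longrightarrow> dfnt (\<lambda>e. F (s e) (t e))"
  unfolding dfnt_def[of "\<lambda>e. F (e 0) (e (Suc 0))"] dfnt_def[of "\<lambda>e. F (s e) (t e)"]
  by (rule dfn_lift3[where Q = "\<lambda>z x y. z = F x y"]) (simp_all add: dfnt_var dfnt_shift)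

lemma dfn_ex1:
  assumes "dfn (\<lambda>e. P (e 0) (\<lambda>n. e (Suc n)))" shows "dfn (\<lambda>e. \<exists>!y. P y e)"
proof -
  have 1: "dfn (\<lambda>e. P (e 0) (\<lambda>n. e (Suc (Suc n))))"
    using dfn_ren[OF assms, of "case_nat 0 (\<lambda>n. Suc (Suc n))"] by simp
  have 2: "dfn (\<lambda>e. \<forall>z. P z (\<lambda>n. e (Suc n)) \<longrightarrow> z = e 0)"
    by (rule dfn_all, rule dfn_imp, rule 1, rule dfn_eq) (rule dfnt_var)+
  show ?thesis
    unfolding Ex1_def by (rule dfn_ex, rule dfn_conj, rule assms, rule 2)
qed

lemma the_or_eq:
  assumes "P y" "\<And>z. P z \<Longrightarrow> z = y" shows "the_or P = y"
proof -
  have "\<exists>!y. P y" using assms by (rule ex1I)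
  with the_equality[of P y, OF assms] show ?thesis by (simp add: the_or_def)
qed

lemma dfnt_the_or:
  assumes "dfn (\<lambda>e. P (e 0) (\<lambda>n. e (Suc n)))" shows "dfnt (\<lambda>e. the_or (\<lambda>y. P y e))"
proof -
  note U = dfn_ex1[OF assms]
  have 3: "dfn (\<lambda>e. (\<exists>!y. P y (\<lambda>n. e (Suc n))) \<and> P (e 0) (\<lambda>n. e (Suc n)) \<or>
      \<not> (\<exists>!y. P y (\<lambda>n. e (Suc n))) \<and> e 0 = empty)"
    by (rule dfn_disj, rule dfn_conj, rule dfn_ren[OF U], rule assms, rule dfn_conj, rule dfn_neg,
        rule dfn_ren[OF U], rule dfn_eq, rule dfnt_var, rule dfnt_const)
  have 4: "((\<exists>!y. Q y) \<and> Q z \<or> \<not> (\<exists>!y. Q y) \<and> z = empty) = (z = the_or Q)" for Q z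
  proof (cases "\<exists>!y. Q y")
    case True
    then have "the_or Q = (THE y. Q y)" by (simp add: the_or_def)
    with theI'[OF True] the1_equality[OF True] True show ?thesis by metis
  next
    case False
    then show ?thesis by (simp add: the_or_def)
  qed
  have "(\<lambda>e. (\<exists>!y. P y (\<lambda>n. e (Suc n))) \<and> P (e 0) (\<lambda>n. e (Suc n)) \<or>
      \<not> (\<exists>!y. P y (\<lambda>n. e (Suc n))) \<and> e 0 = empty)
    = (\<lambda>e. e 0 = the_or (\<lambda>y. P y (\<lambda>n. e (Suc n))))"
    by (rule ext) (rule 4)
  with 3 show ?thesis unfolding dfnt_def by (rule subst[rotated])
qed

lemmas [dfn_rules] = dfn_neg dfn_conj dfn_disj dfn_imp dfn_iff dfn_all dfn_ex dfn_ex1 dfn_mem dfn_eq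
  dfnt_var dfnt_const dfn_const dfnt_the_or

end

section \<open>Sets and functions inside a model of ZF\<close>

locale zf_model = set_structure mem for mem :: "'a \<Rightarrow> 'a \<Rightarrow> bool" (infix "\<epsilon>" 50) +
  assumes ZF: ZF
begin

definition is_set :: "('a \<Rightarrow> bool) \<Rightarrow> bool" where
  "is_set P \<longleftrightarrow> (\<exists>y. \<forall>z. z \<epsilon> y \<longleftrightarrow> P z)"

lemma ext: assumes "\<And>z. z \<epsilon> x \<longleftrightarrow> z \<epsilon> y" shows "x = y"
proof -
  have "\<forall>x y. (\<forall>z. z \<epsilon> x \<longleftrightarrow> z \<epsilon> y) \<longrightarrow> x = y" using ZF unfolding ZF_def by (elim conjE)
  with assms show ?thesis by simp
qed

lemma coll_eqI: assumes "\<And>z. z \<epsilon> y \<longleftrightarrow> P z" shows "coll P = y"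
  unfolding coll_def using assms by (intro the_equality ext) auto

lemma mem_coll: assumes "is_set P" shows "z \<epsilon> coll P \<longleftrightarrow> P z"
proof -
  obtain y where "\<And>z. z \<epsilon> y \<longleftrightarrow> P z" using assms unfolding is_set_def by blast
  with coll_eqI[OF this] show ?thesis by simp
qed

text \<open>
  The graph of a comprehension term is definable because \<open>x = coll P\<close> amounts to
  \<open>\<forall>z. z \<epsilon> x \<longleftrightarrow> P z\<close>, provided that the comprehension denotes a set.
\<close>

lemma dfnt_coll:
  assumes "\<And>e. is_set (\<lambda>z. P z e)" "dfn (\<lambda>e. P (e 0) (\<lambda>n. e (Suc n)))"
  shows "dfnt (\<lambda>e. coll (\<lambda>z. P z e))"
proof -
  have 1: "(x = coll (\<lambda>z. P z e)) = (\<forall>z. z \<epsilon> x \<longleftrightarrow> P z e)" for x e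
    using mem_coll[OF assms(1)] coll_eqI by metis
  have 2: "dfn (\<lambda>e. P (e 0) (\<lambda>n. e (Suc (Suc n))))"
    using dfn_ren[OF assms(2), of "case_nat 0 (\<lambda>n. Suc (Suc n))"] by simp
  show ?thesis unfolding dfnt_def 1
    by (rule dfn_all, rule dfn_iff, rule dfn_mem, (rule dfnt_var)+, rule 2)
qed

lemma is_set_sep:
  assumes "dfn (\<lambda>e. P (e 0))" "\<And>z. P z \<Longrightarrow> z \<epsilon> a"
  shows "is_set P"
proof -
  obtain \<phi> and f :: "nat \<Rightarrow> nat + 'a" where 1: "\<forall>e. P (e 0) = sat mem (\<lambda>n. case_sum e id (f n)) \<phi>"
    using assms(1) unfolding dfn_def by (elim exE) (rule that)
  define g where "g n = (case f n of Inl _ \<Rightarrow> 0 | Inr _ \<Rightarrow> Suc n)" for n :: nat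
  define \<rho> where "\<rho> n = (case f n of Inl _ \<Rightarrow> a | Inr b \<Rightarrow> b)" for n :: nat
  \<comment> \<open>Only entry \<open>0\<close> of the assignment matters, so all entries may be identified with the variable
      that ranges over the members of \<open>a\<close>.\<close>
  have "(\<lambda>n. case_nat x \<rho> (g n)) = (\<lambda>n. case_sum (\<lambda>_. x) id (f n))" for x
    by (rule HOL.ext) (simp add: g_def \<rho>_def split: sum.split)
  then have 2: "P x = sat mem (case_nat x \<rho>) (ren g \<phi>)" for x
    using spec[OF 1, of "\<lambda>_. x"] by (simp add: sat_ren)
  have "\<forall>\<phi> \<rho> a. \<exists>b. \<forall>x. x \<epsilon> b \<longleftrightarrow> x \<epsilon> a \<and> sat mem (case_nat x \<rho>) \<phi>"
    using ZF unfolding ZF_def by (elim conjE)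
  then have "\<exists>b. \<forall>x. x \<epsilon> b \<longleftrightarrow> x \<epsilon> a \<and> P x" unfolding 2 by (elim allE)
  then have "\<exists>b. \<forall>x. x \<epsilon> b \<longleftrightarrow> P x" using assms(2) by metis
  then show ?thesis unfolding is_set_def .
qed

definition Sep :: "'a \<Rightarrow> ('a \<Rightarrow> bool) \<Rightarrow> 'a" where "Sep a P = coll (\<lambda>x. x \<epsilon> a \<and> P x)"

lemma mem_Sep: assumes "dfn (\<lambda>e. P (e 0))" shows "z \<epsilon> Sep a P \<longleftrightarrow> z \<epsilon> a \<and> P z"
  unfolding Sep_def
  by (rule mem_coll, rule is_set_sep[where a = a]) (rule dfn_rules assms | simp)+

lemma is_set_upair: "is_set (\<lambda>z. z = a \<or> z = b)"
proof -
  have "\<forall>a b. \<exists>p. \<forall>z. z \<epsilon> p \<longleftrightarrow> z = a \<or> z = b" using ZF unfolding ZF_def by (elim conjE)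
  then show ?thesis unfolding is_set_def by simp
qed
lemma is_set_Union: "is_set (\<lambda>z. \<exists>y. y \<epsilon> a \<and> z \<epsilon> y)"
proof -
  have "\<forall>a. \<exists>u. \<forall>z. z \<epsilon> u \<longleftrightarrow> (\<exists>y. y \<epsilon> a \<and> z \<epsilon> y)" using ZF unfolding ZF_def by (elim conjE)
  then show ?thesis unfolding is_set_def by simp
qed
lemma is_set_Pow: "is_set (\<lambda>z. subset z a)"
proof -
  have "\<forall>a. \<exists>p. \<forall>z. z \<epsilon> p \<longleftrightarrow> subset z a" using ZF unfolding ZF_def by (elim conjE)
  then show ?thesis unfolding is_set_def by simp
qed
lemma is_set_empty: "is_set (\<lambda>z. False)"
  by (rule is_set_sep) (rule dfn_rules | simp)+

definition Union :: "'a \<Rightarrow> 'a" where "Union a = coll (\<lambda>z. \<exists>y. y \<epsilon> a \<and> z \<epsilon> y)"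
definition Pow :: "'a \<Rightarrow> 'a" where "Pow a = coll (\<lambda>z. subset z a)"
definition un :: "'a \<Rightarrow> 'a \<Rightarrow> 'a" where "un a b = coll (\<lambda>z. z \<epsilon> a \<or> z \<epsilon> b)"

lemma mem_empty [simp]: "\<not> z \<epsilon> empty"
  unfolding empty_def mem_coll[OF is_set_empty] by simp
lemma mem_upair [simp]: "z \<epsilon> upair a b \<longleftrightarrow> z = a \<or> z = b"
  unfolding upair_def by (rule mem_coll[OF is_set_upair])
lemma mem_Union: "z \<epsilon> Union a \<longleftrightarrow> (\<exists>y. y \<epsilon> a \<and> z \<epsilon> y)"
  unfolding Union_def by (rule mem_coll[OF is_set_Union])
lemma mem_Pow: "z \<epsilon> Pow a \<longleftrightarrow> subset z a"
  unfolding Pow_def by (rule mem_coll[OF is_set_Pow])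

lemma is_set_un: "is_set (\<lambda>z. z \<epsilon> a \<or> z \<epsilon> b)"
proof -
  have "z \<epsilon> a \<or> z \<epsilon> b \<longleftrightarrow> z \<epsilon> Union (upair a b)" for z by (auto simp: mem_Union)
  then show ?thesis unfolding is_set_def by blast
qed

lemma mem_un [simp]: "z \<epsilon> un a b \<longleftrightarrow> z \<epsilon> a \<or> z \<epsilon> b"
  unfolding un_def by (rule mem_coll[OF is_set_un])

lemma is_set_succ: "is_set (\<lambda>z. z \<epsilon> x \<or> z = x)"
  using is_set_un[of x "upair x x"] by simp

lemma mem_succ [simp]: "z \<epsilon> succ x \<longleftrightarrow> z \<epsilon> x \<or> z = x"
  unfolding succ_def by (rule mem_coll[OF is_set_succ])

lemma dfnt_upair [dfn_rules]: "dfnt s \<Longrightarrow> dfnt t \<Longrightarrow> dfnt (\<lambda>e. upair (s e) (t e))"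
  by (rule dfnt_lift2[where F = upair], unfold upair_def, rule dfnt_coll[OF is_set_upair])
     ((rule dfn_rules)+ | assumption)+

lemma dfnt_un [dfn_rules]: "dfnt s \<Longrightarrow> dfnt t \<Longrightarrow> dfnt (\<lambda>e. un (s e) (t e))"
  by (rule dfnt_lift2[where F = un], unfold un_def, rule dfnt_coll[OF is_set_un])
     ((rule dfn_rules)+ | assumption)+

lemma dfnt_succ [dfn_rules]: "dfnt s \<Longrightarrow> dfnt (\<lambda>e. succ (s e))"
  by (rule dfnt_lift1[where F = succ], unfold succ_def, rule dfnt_coll[OF is_set_succ])
     ((rule dfn_rules)+ | assumption)+

lemma dfn_subset [dfn_rules]: "dfnt s \<Longrightarrow> dfnt t \<Longrightarrow> dfn (\<lambda>e. subset (s e) (t e))"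
  by (rule dfn_lift2[where Q = subset], unfold subset_def) ((rule dfn_rules)+ | assumption)+

lemma dfnt_pair [dfn_rules]: "dfnt s \<Longrightarrow> dfnt t \<Longrightarrow> dfnt (\<lambda>e. pair (s e) (t e))"
  unfolding pair_def by ((rule dfn_rules)+ | assumption)+

lemma pair_inj [simp]: "pair a b = pair c d \<longleftrightarrow> a = c \<and> b = d"
proof
  assume e: "pair a b = pair c d"
  have 1: "z \<epsilon> pair x y \<longleftrightarrow> z = upair x x \<or> z = upair x y" for x y z
    by (simp add: pair_def)
  have 2: "upair x y = upair u v \<longleftrightarrow> x = u \<and> y = v \<or> x = v \<and> y = u" for x y u v
  proof
    assume "upair x y = upair u v"
    then have "\<And>z. z = x \<or> z = y \<longleftrightarrow> z = u \<or> z = v" by (metis mem_upair)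
    then show "x = u \<and> y = v \<or> x = v \<and> y = u" by metis
  next
    assume "x = u \<and> y = v \<or> x = v \<and> y = u"
    then show "upair x y = upair u v" by (intro ext) auto
  qed
  show "a = c \<and> b = d" using e unfolding pair_def 2 by auto
qed simp

lemma is_set_cart: "is_set (\<lambda>p. \<exists>x y. x \<epsilon> A \<and> y \<epsilon> B \<and> p = pair x y)"
proof (rule is_set_sep)
  show "dfn (\<lambda>e. \<exists>x y. x \<epsilon> A \<and> y \<epsilon> B \<and> e 0 = pair x y)" by (rule dfn_rules)+
  show "\<And>p. \<exists>x y. x \<epsilon> A \<and> y \<epsilon> B \<and> p = pair x y \<Longrightarrow> p \<epsilon> Pow (Pow (un A B))"
    by (auto simp: mem_Pow pair_def subset_def)
qed

lemma mem_cart: "p \<epsilon> cart A B \<longleftrightarrow> (\<exists>x y. x \<epsilon> A \<and> y \<epsilon> B \<and> p = pair x y)"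
  unfolding cart_def by (rule mem_coll[OF is_set_cart])

lemma pair_mem_cart [simp]: "pair x y \<epsilon> cart A B \<longleftrightarrow> x \<epsilon> A \<and> y \<epsilon> B"
  by (auto simp: mem_cart)

lemma dfnt_cart [dfn_rules]: "dfnt s \<Longrightarrow> dfnt t \<Longrightarrow> dfnt (\<lambda>e. cart (s e) (t e))"
  by (rule dfnt_lift2[where F = cart], unfold cart_def, rule dfnt_coll[OF is_set_cart])
     ((rule dfn_rules)+ | assumption)+

lemma dfn_func [dfn_rules]: "dfnt s \<Longrightarrow> dfnt t \<Longrightarrow> dfnt u \<Longrightarrow> dfn (\<lambda>e. func (s e) (t e) (u e))"
  by (rule dfn_lift3[where Q = func], unfold func_def) ((rule dfn_rules)+ | assumption)+

section \<open>Natural numbers of the model\<close>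

lemma dfn_is_inductive [dfn_rules]: "dfnt s \<Longrightarrow> dfn (\<lambda>e. is_inductive (s e))"
  by (rule dfn_lift1[where Q = is_inductive], unfold is_inductive_def) ((rule dfn_rules)+ | assumption)+

lemma is_set_omega: "is_set (\<lambda>n. \<forall>w. is_inductive w \<longrightarrow> n \<epsilon> w)"
proof -
  have "\<exists>w. (\<exists>z. z \<epsilon> w \<and> (\<forall>y. \<not> y \<epsilon> z)) \<and>
         (\<forall>x. x \<epsilon> w \<longrightarrow> (\<exists>s. s \<epsilon> w \<and> (\<forall>z. z \<epsilon> s \<longleftrightarrow> z \<epsilon> x \<or> z = x)))"
    using ZF unfolding ZF_def by (elim conjE)
  then obtain w where w: "\<exists>z. z \<epsilon> w \<and> (\<forall>y. \<not> y \<epsilon> z)"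
    "\<And>x. x \<epsilon> w \<Longrightarrow> \<exists>s. s \<epsilon> w \<and> (\<forall>z. z \<epsilon> s \<longleftrightarrow> z \<epsilon> x \<or> z = x)"
    by blast
  have "empty \<epsilon> w" using w(1) ext[of _ empty] by (metis mem_empty)
  moreover have "succ x \<epsilon> w" if x: "x \<epsilon> w" for x
    using w(2)[OF x] ext[of _ "succ x"] by (metis mem_succ)
  ultimately have "is_inductive w" by (simp add: is_inductive_def)
  then show ?thesis
    by (intro is_set_sep[where a = w]) ((rule dfn_rules)+, blast)
qed

lemma mem_omega: "n \<epsilon> omega \<longleftrightarrow> (\<forall>w. is_inductive w \<longrightarrow> n \<epsilon> w)"
  unfolding omega_def by (rule mem_coll[OF is_set_omega])

lemma empty_omega [simp]: "empty \<epsilon> omega"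
  by (simp add: mem_omega is_inductive_def)

lemma succ_omega [simp]: "n \<epsilon> omega \<Longrightarrow> succ n \<epsilon> omega"
  by (simp add: mem_omega is_inductive_def)

lemma omega_induct [consumes 1, case_names dfn zero succ]:
  assumes n: "n \<epsilon> omega" and P: "dfn (\<lambda>e. P (e 0))"
    and 0: "P empty" and S: "\<And>n. n \<epsilon> omega \<Longrightarrow> P n \<Longrightarrow> P (succ n)"
  shows "P n"
proof -
  have "is_inductive (Sep omega P)"
    unfolding is_inductive_def mem_Sep[OF P] using 0 S by simp
  with n have "n \<epsilon> Sep omega P" by (simp add: mem_omega)
  then show ?thesis by (simp add: mem_Sep[OF P])
qed

lemma omega_trans: assumes "m \<epsilon> n" "n \<epsilon> omega" shows "m \<epsilon> omega"
proof -
  have "\<forall>m. m \<epsilon> n \<longrightarrow> m \<epsilon> omega" using assms(2)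
    by (induction rule: omega_induct) ((rule dfn_rules)+, auto)
  with assms show ?thesis by blast
qed

lemma less_trans_omega: assumes "k \<epsilon> m" "m \<epsilon> n" "n \<epsilon> omega" shows "k \<epsilon> n"
proof -
  have "\<forall>k m. k \<epsilon> m \<and> m \<epsilon> n \<longrightarrow> k \<epsilon> n" using assms(3)
    by (induction rule: omega_induct) ((rule dfn_rules)+, auto)
  with assms show ?thesis by blast
qed

lemma mem_irrefl [simp]: "\<not> x \<epsilon> x"
proof -
  have "\<forall>x. (\<exists>y. y \<epsilon> x) \<longrightarrow> (\<exists>y. y \<epsilon> x \<and> \<not> (\<exists>z. z \<epsilon> x \<and> z \<epsilon> y))"
    using ZF unfolding ZF_def by (elim conjE)
  from spec[OF this, of "upair x x"] show ?thesis by auto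
qed

lemma omega_cases:
  assumes "n \<epsilon> omega"
  obtains "n = empty" | k where "k \<epsilon> omega" "n = succ k"
proof -
  have "n = empty \<or> (\<exists>k. k \<epsilon> omega \<and> n = succ k)" using assms
    by (induction rule: omega_induct) ((rule dfn_rules)+, auto)
  with that show thesis by blast
qed

lemma empty_less_succ [simp]: assumes "n \<epsilon> omega" shows "empty \<epsilon> succ n"
  using assms by (induction rule: omega_induct) ((rule dfn_rules)+, auto)

lemma succ_mem_succ:
  assumes "n \<epsilon> omega" "m \<epsilon> n" shows "succ m \<epsilon> succ n"
proof -
  have "\<forall>m. m \<epsilon> n \<longrightarrow> succ m \<epsilon> succ n" using assms(1)
    by (induction rule: omega_induct) ((rule dfn_rules)+, auto)
  with assms show ?thesis by blast
qed

lemma omega_linear: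
  assumes "n \<epsilon> omega" "m \<epsilon> omega" shows "m \<epsilon> n \<or> m = n \<or> n \<epsilon> m"
proof -
  have "\<forall>m. m \<epsilon> omega \<longrightarrow> m \<epsilon> n \<or> m = n \<or> n \<epsilon> m" using assms(1)
  proof (induction rule: omega_induct)
    case dfn show ?case by (rule dfn_rules)+
  next
    case zero show ?case
      using empty_less_succ by (metis omega_cases)
  next
    case (succ n) 
    show ?case
    proof (intro allI impI)
      fix m assume m: "m \<epsilon> omega"
      then consider "m \<epsilon> n" | "m = n" | "n \<epsilon> m" using succ by blast
      then show "m \<epsilon> succ n \<or> m = succ n \<or> succ n \<epsilon> m"
        using succ_mem_succ[OF m] by cases auto
    qed
  qed
  with assms show ?thesis by blast
qed

lemma succ_inj: "m \<epsilon> omega \<Longrightarrow> n \<epsilon> omega \<Longrightarrow> succ m = succ n \<longleftrightarrow> m = n"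
  by (metis mem_succ less_trans_omega mem_irrefl)

lemma dfnt_if [dfn_rules]:
  assumes "dfn P" "dfnt s" "dfnt t" shows "dfnt (\<lambda>e. if P e then s e else t e)"
proof -
  have "dfn (\<lambda>e. P (\<lambda>n. e (Suc n)) \<and> e 0 = s (\<lambda>n. e (Suc n)) \<or>
      \<not> P (\<lambda>n. e (Suc n)) \<and> e 0 = t (\<lambda>n. e (Suc n)))"
    by (intro dfn_disj dfn_conj dfn_neg dfn_ren[OF assms(1)] assms(2,3)[unfolded dfnt_def])
  moreover have "(P (\<lambda>n. e (Suc n)) \<and> e 0 = s (\<lambda>n. e (Suc n)) \<or>
      \<not> P (\<lambda>n. e (Suc n)) \<and> e 0 = t (\<lambda>n. e (Suc n))) 
    = (e 0 = (if P (\<lambda>n. e (Suc n)) then s (\<lambda>n. e (Suc n)) else t (\<lambda>n. e (Suc n))))" for e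
    by simp
  ultimately show ?thesis unfolding dfnt_def by simp
qed

text \<open>
  Functions of the model are handled through \<open>ap\<close>, the total and hence definable version of \<open>app\<close>;
  the two agree on the domain of a function.
\<close>

definition ap :: "'a \<Rightarrow> 'a \<Rightarrow> 'a" where "ap f x = the_or (\<lambda>y. pair x y \<epsilon> f)"
definition pfst :: "'a \<Rightarrow> 'a" where "pfst p = the_or (\<lambda>x. \<exists>y. p = pair x y)"
definition psnd :: "'a \<Rightarrow> 'a" where "psnd p = the_or (\<lambda>y. \<exists>x. p = pair x y)"
definition dom :: "'a \<Rightarrow> 'a" where "dom s = coll (\<lambda>x. \<exists>y. pair x y \<epsilon> s)"

lemma dfnt_ap [dfn_rules]: "dfnt s \<Longrightarrow> dfnt t \<Longrightarrow> dfnt (\<lambda>e. ap (s e) (t e))"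
  by (rule dfnt_lift2[where F = ap], unfold ap_def) ((rule dfn_rules)+ | assumption)+
lemma dfnt_pfst [dfn_rules]: "dfnt s \<Longrightarrow> dfnt (\<lambda>e. pfst (s e))"
  by (rule dfnt_lift1[where F = pfst], unfold pfst_def) ((rule dfn_rules)+ | assumption)+
lemma dfnt_psnd [dfn_rules]: "dfnt s \<Longrightarrow> dfnt (\<lambda>e. psnd (s e))"
  by (rule dfnt_lift1[where F = psnd], unfold psnd_def) ((rule dfn_rules)+ | assumption)+

lemma pfst_pair [simp]: "pfst (pair x y) = x" and psnd_pair [simp]: "psnd (pair x y) = y"
  unfolding pfst_def psnd_def by (rule the_or_eq; simp)+

lemma is_set_dom: "is_set (\<lambda>x. \<exists>y. pair x y \<epsilon> s)"
proof (rule is_set_sep)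
  show "dfn (\<lambda>e. \<exists>y. pair (e 0) y \<epsilon> s)" by (rule dfn_rules)+
  fix x assume "\<exists>y. pair x y \<epsilon> s"
  then obtain y where 1: "pair x y \<epsilon> s" ..
  have "upair x x \<epsilon> pair x y" by (simp add: pair_def)
  with 1 have "upair x x \<epsilon> Union s" unfolding mem_Union by blast
  moreover have "x \<epsilon> upair x x" by simp
  ultimately show "x \<epsilon> Union (Union s)" unfolding mem_Union[of x] by blast
qed

lemma mem_dom: "x \<epsilon> dom s \<longleftrightarrow> (\<exists>y. pair x y \<epsilon> s)"
  unfolding dom_def by (rule mem_coll[OF is_set_dom])

lemma dfnt_dom [dfn_rules]: "dfnt s \<Longrightarrow> dfnt (\<lambda>e. dom (s e))"
  by (rule dfnt_lift1[where F = dom], unfold dom_def, rule dfnt_coll[OF is_set_dom])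
     ((rule dfn_rules)+ | assumption)+

lemma func_pair_iff: "func f A B \<Longrightarrow> pair x y \<epsilon> f \<longleftrightarrow> x \<epsilon> A \<and> y = ap f x"
proof -
  assume f: "func f A B"
  have 1: "x \<epsilon> A" if "pair x y \<epsilon> f" for y
    using that f unfolding func_def subset_def by (metis pair_mem_cart)
  show ?thesis
  proof (cases "x \<epsilon> A")
    case True
    then have "\<exists>!y. pair x y \<epsilon> f" using f unfolding func_def by blast
    then obtain v where v: "pair x v \<epsilon> f" "\<And>z. pair x z \<epsilon> f \<Longrightarrow> z = v" by (elim ex1E) metis
    have "ap f x = v" unfolding ap_def by (rule the_or_eq) (fact v)+
    with v True show ?thesis by metis
  next
    case False with 1 show ?thesis by blast
  qed
qed

lemma ap_mem: "func f A B \<Longrightarrow> x \<epsilon> A \<Longrightarrow> ap f x \<epsilon> B"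
  using func_pair_iff[of f A B x "ap f x"] unfolding func_def subset_def by (metis pair_mem_cart)

lemma app_eq_ap: "func f A B \<Longrightarrow> x \<epsilon> A \<Longrightarrow> app f x = ap f x"
  unfolding app_def by (rule the_equality) (simp_all add: func_pair_iff)

lemma func_mem: "func f A B \<Longrightarrow> p \<epsilon> f \<Longrightarrow> \<exists>x. x \<epsilon> A \<and> p = pair x (ap f x)"
  using func_pair_iff[of f A B] unfolding func_def subset_def mem_cart by metis

lemma dom_func: "func f A B \<Longrightarrow> dom f = A"
  by (rule ext) (simp add: mem_dom func_pair_iff)

lemma funcI:
  assumes "\<And>p. p \<epsilon> f \<Longrightarrow> \<exists>x y. p = pair x y \<and> x \<epsilon> A \<and> y \<epsilon> B"
    and "\<And>x. x \<epsilon> A \<Longrightarrow> \<exists>y. pair x y \<epsilon> f"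
    and "\<And>x y z. pair x y \<epsilon> f \<Longrightarrow> pair x z \<epsilon> f \<Longrightarrow> y = z"
  shows "func f A B"
  unfolding func_def subset_def mem_cart using assms by metis

lemma func_ext:
  assumes "func f A B" "func g A C" "\<And>x. x \<epsilon> A \<Longrightarrow> ap f x = ap g x" shows "f = g"
proof (rule ext)
  have "pair x y \<epsilon> f \<longleftrightarrow> pair x y \<epsilon> g" for x y
    unfolding func_pair_iff[OF assms(1)] func_pair_iff[OF assms(2)] using assms(3) by auto
  then show "z \<epsilon> f \<longleftrightarrow> z \<epsilon> g" for z
    using func_mem[OF assms(1), of z] func_mem[OF assms(2), of z] by auto
qed

lemma func_exists:
  assumes P: "dfn (\<lambda>e. P (e 0) (e (Suc 0)))"
    and ex: "\<And>x. x \<epsilon> A \<Longrightarrow> \<exists>y. y \<epsilon> B \<and> P x y"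
    and un: "\<And>x y z. x \<epsilon> A \<Longrightarrow> y \<epsilon> B \<Longrightarrow> z \<epsilon> B \<Longrightarrow> P x y \<Longrightarrow> P x z \<Longrightarrow> y = z"
  shows "\<exists>f. func f A B \<and> (\<forall>x. x \<epsilon> A \<longrightarrow> P x (ap f x))"
proof -
  define f where "f = Sep (cart A B) (\<lambda>p. \<exists>x y. p = pair x y \<and> P x y)"
  have d: "dfn (\<lambda>e. P (e (Suc 0)) (e 0))"
    by (rule dfn_ren[OF P, of "\<lambda>n. if n = 0 then Suc 0 else 0", simplified])
  have f: "p \<epsilon> f \<longleftrightarrow> p \<epsilon> cart A B \<and> (\<exists>x y. p = pair x y \<and> P x y)" for p
    unfolding f_def by (rule mem_Sep) (rule d dfn_rules)+
  have "func f A B" by (rule funcI) (use ex un in \<open>auto simp: f mem_cart\<close>)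
  moreover have "P x (ap f x)" if "x \<epsilon> A" for x
    using func_pair_iff[OF \<open>func f A B\<close>, of x "ap f x"] that by (simp add: f)
  ultimately show ?thesis by blast
qed

definition lam :: "'a \<Rightarrow> 'a \<Rightarrow> ('a \<Rightarrow> 'a) \<Rightarrow> 'a" where
  "lam A B F = Sep (cart A B) (\<lambda>p. \<exists>x. p = pair x (F x))"

lemma lam:
  assumes "dfnt (\<lambda>e. F (e 0))" "\<And>x. x \<epsilon> A \<Longrightarrow> F x \<epsilon> B"
  shows func_lam: "func (lam A B F) A B" and ap_lam: "x \<epsilon> A \<Longrightarrow> ap (lam A B F) x = F x"
proof -
  have f: "p \<epsilon> lam A B F \<longleftrightarrow> p \<epsilon> cart A B \<and> (\<exists>x. p = pair x (F x))" for p
    unfolding lam_def by (rule mem_Sep) (rule assms(1) dfn_rules)+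
  show 1: "func (lam A B F) A B" by (rule funcI) (use assms in \<open>auto simp: f mem_cart\<close>)
  show "x \<epsilon> A \<Longrightarrow> ap (lam A B F) x = F x"
    using func_pair_iff[OF 1, of x "F x"] assms(2)[of x] by (simp add: f)
qed

definition funs :: "'a \<Rightarrow> 'a \<Rightarrow> 'a" where "funs A B = Sep (Pow (cart A B)) (\<lambda>f. func f A B)"

lemma mem_funs [simp]: "f \<epsilon> funs A B \<longleftrightarrow> func f A B"
proof -
  have "f \<epsilon> funs A B \<longleftrightarrow> f \<epsilon> Pow (cart A B) \<and> func f A B"
    unfolding funs_def by (rule mem_Sep) (rule dfn_rules)+
  then show ?thesis by (auto simp: mem_Pow func_def)
qed

section \<open>Finite sequences and dependent choices\<close>

definition seqs :: "'a \<Rightarrow> 'a" where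
  "seqs B = Sep (Pow (cart omega B)) (\<lambda>s. \<exists>n. n \<epsilon> omega \<and> func s n B)"

text \<open>
  \<open>dom s\<close> is the length of the finite sequence \<open>s\<close>, and so the index of the entry to be appended.
\<close>

definition snoc :: "'a \<Rightarrow> 'a \<Rightarrow> 'a" where
  "snoc s m = un s (upair (pair (dom s) m) (pair (dom s) m))"

lemma dfnt_snoc [dfn_rules]: "dfnt s \<Longrightarrow> dfnt t \<Longrightarrow> dfnt (\<lambda>e. snoc (s e) (t e))"
  unfolding snoc_def by ((rule dfn_rules)+ | assumption)+

lemma mem_seqs: "s \<epsilon> seqs B \<longleftrightarrow> dom s \<epsilon> omega \<and> func s (dom s) B"
proof -
  have 1: "s \<epsilon> seqs B \<longleftrightarrow> s \<epsilon> Pow (cart omega B) \<and> (\<exists>n. n \<epsilon> omega \<and> func s n B)"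
    unfolding seqs_def by (rule mem_Sep) (rule dfn_rules)+
  have "s \<epsilon> Pow (cart omega B)" if n: "n \<epsilon> omega" and s: "func s n B" for n
    unfolding mem_Pow subset_def
  proof (intro allI impI)
    fix p assume "p \<epsilon> s"
    then obtain x where "x \<epsilon> n" "p = pair x (ap s x)" using func_mem[OF s] by blast
    with ap_mem[OF s] omega_trans[OF _ n] show "p \<epsilon> cart omega B" by simp
  qed
  with 1 dom_func show ?thesis by metis
qed

lemma seqsI: "n \<epsilon> omega \<Longrightarrow> func s n B \<Longrightarrow> s \<epsilon> seqs B"
  by (simp add: mem_seqs dom_func)

lemma positions_eq: "positions = seqs omega"
  unfolding positions_def by (rule coll_eqI) (metis mem_seqs dom_func)

lemma snoc:
  assumes n: "n \<epsilon> omega" and s: "func s n B" and m: "m \<epsilon> B"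
  shows func_snoc: "func (snoc s m) (succ n) B"
    and ap_snoc_last: "ap (snoc s m) n = m"
    and ap_snoc: "k \<epsilon> n \<Longrightarrow> ap (snoc s m) k = ap s k"
    and subset_snoc: "subset s (snoc s m)"
proof -
  have e: "p \<epsilon> snoc s m \<longleftrightarrow> p \<epsilon> s \<or> p = pair n m" for p
    by (simp add: snoc_def dom_func[OF s])
  show 1: "func (snoc s m) (succ n) B"
  proof (rule funcI)
    fix p assume "p \<epsilon> snoc s m"
    then show "\<exists>x y. p = pair x y \<and> x \<epsilon> succ n \<and> y \<epsilon> B"
      using func_mem[OF s, of p] ap_mem[OF s] m unfolding e by auto
  qed (auto simp: e func_pair_iff[OF s])
  show "ap (snoc s m) n = m" using func_pair_iff[OF 1, of n m] by (simp add: e)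
  show "k \<epsilon> n \<Longrightarrow> ap (snoc s m) k = ap s k"
    using func_pair_iff[OF 1, of k "ap s k"] by (simp add: e func_pair_iff[OF s])
  show "subset s (snoc s m)" by (simp add: subset_def e)
qed

lemma subset_funcD:
  assumes "subset s x" "func s A B" "func x C D" "k \<epsilon> A"
  shows "k \<epsilon> C" "ap x k = ap s k"
  using assms func_pair_iff[OF assms(2), of k "ap s k"] func_pair_iff[OF assms(3), of k "ap s k"]
  unfolding subset_def by auto

lemma mem_restrict: "p \<epsilon> restrict f A \<longleftrightarrow> p \<epsilon> f \<and> (\<exists>x y. x \<epsilon> A \<and> p = pair x y)"
  unfolding restrict_def
  by (rule mem_coll, rule is_set_sep[where a = f]) ((rule dfn_rules)+, simp)

lemma is_set_restrict: "is_set (\<lambda>p. p \<epsilon> f \<and> (\<exists>x y. x \<epsilon> A \<and> p = pair x y))"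
  using mem_restrict unfolding is_set_def by blast

lemma dfnt_restrict [dfn_rules]: "dfnt s \<Longrightarrow> dfnt t \<Longrightarrow> dfnt (\<lambda>e. restrict (s e) (t e))"
  by (rule dfnt_lift2[where F = restrict], unfold restrict_def, rule dfnt_coll[OF is_set_restrict])
     ((rule dfn_rules)+ | assumption)+

lemma restrict_subset:
  assumes "subset s x" "func s A B" "func x C D" "subset n A" shows "restrict x n = restrict s n"
proof (rule ext)
  fix p
  have "k \<epsilon> A \<and> pair k y \<epsilon> x \<longleftrightarrow> pair k y \<epsilon> s" for k y
    using func_pair_iff[OF assms(2), of k y] func_pair_iff[OF assms(3), of k y]
      subset_funcD[OF assms(1-3), of k] by metis
  then show "p \<epsilon> restrict x n \<longleftrightarrow> p \<epsilon> restrict s n"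
    unfolding mem_restrict using assms(4) unfolding subset_def by metis
qed

lemma restrict_self: "func s A B \<Longrightarrow> restrict s A = s"
  by (rule ext) (metis mem_restrict func_mem)

lemma proper_extension_longer:
  assumes "s \<epsilon> seqs B" "s' \<epsilon> seqs B" "subset s s'" "s \<noteq> s'" shows "dom s \<epsilon> dom s'"
proof -
  let ?n = "dom s" let ?n' = "dom s'"
  have s: "?n \<epsilon> omega" "func s ?n B" and s': "?n' \<epsilon> omega" "func s' ?n' B"
    using assms(1,2) unfolding mem_seqs by blast+
  note sub = subset_funcD[OF assms(3) s(2) s'(2)]
  have "?n' \<noteq> ?n" using assms(4) func_ext[OF s(2), of s' B] s'(2) sub(2) by metis
  moreover have "\<not> ?n' \<epsilon> ?n" using sub(1) by fastforce
  ultimately show ?thesis using omega_linear[OF s(1) s'(1)] by blast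
qed

end

locale zf_dc = zf_model +
  assumes DC: DC
begin

text \<open>
  A tree of finite sequences in which every sequence is properly extended by another has an infinite
  branch: dependent choice gives a strictly increasing chain, whose \<open>n\<close>-th member has length at least \<open>n\<close>,
  and the union of the chain is a function on \<open>\<omega>\<close>.
\<close>

lemma run_through_tree:
  assumes T: "\<And>s. s \<epsilon> T \<Longrightarrow> s \<epsilon> seqs B" and t0: "t0 \<epsilon> T"
    and ext: "\<And>s. s \<epsilon> T \<Longrightarrow> \<exists>s'. s' \<epsilon> T \<and> subset s s' \<and> s \<noteq> s'"
  shows "\<exists>x. func x omega B \<and> (\<forall>n. n \<epsilon> omega \<longrightarrow> (\<exists>s. s \<epsilon> T \<and> subset s x \<and> n \<epsilon> dom s))"
proof -
  define r where "r = Sep (cart T T) (\<lambda>p. \<exists>s s'. p = pair s s' \<and> subset s s' \<and> s \<noteq> s')"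
  have r: "p \<epsilon> r \<longleftrightarrow> p \<epsilon> cart T T \<and> (\<exists>s s'. p = pair s s' \<and> subset s s' \<and> s \<noteq> s')" for p
    unfolding r_def by (rule mem_Sep) (rule dfn_rules)+
  have "(\<exists>a. a \<epsilon> T) \<and> (\<forall>x. x \<epsilon> T \<longrightarrow> (\<exists>y. y \<epsilon> T \<and> pair x y \<epsilon> r))"
    using t0 ext by (auto simp: r)
  then obtain f where f: "func f omega T"
    and f': "\<And>n. n \<epsilon> omega \<Longrightarrow> pair (app f n) (app f (succ n)) \<epsilon> r"
    using DC unfolding DC_def by blast
  have st: "subset (ap f n) (ap f (succ n))" "ap f n \<noteq> ap f (succ n)" if "n \<epsilon> omega" for n
    using f'[OF that] that by (auto simp: r app_eq_ap[OF f])
  have fT: "ap f n \<epsilon> T" if "n \<epsilon> omega" for n using ap_mem[OF f that] .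
  have mono: "subset (ap f m) (ap f n)" if "n \<epsilon> omega" "m \<epsilon> n" for m n
  proof -
    have "\<forall>m. m \<epsilon> n \<longrightarrow> subset (ap f m) (ap f n)" using that(1)
    proof (induction rule: omega_induct)
      case dfn show ?case by (rule dfn_rules)+
    next
      case (succ n) then show ?case using st(1)[of n] unfolding subset_def by auto
    qed simp
    with that show ?thesis by blast
  qed
  have cmp: "subset (ap f m) (ap f n) \<or> subset (ap f n) (ap f m)" if "n \<epsilon> omega" "m \<epsilon> omega" for m n
    using omega_linear[OF that] mono that unfolding subset_def by blast
  have longer: "dom (ap f n) \<epsilon> dom (ap f (succ n))" if "n \<epsilon> omega" for n
    using proper_extension_longer[of "ap f n" B "ap f (succ n)"] st[OF that] fT T that by simp
  have domo: "dom (ap f n) \<epsilon> omega" if "n \<epsilon> omega" for n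
    using T[OF fT[OF that]] unfolding mem_seqs by blast
  have grow: "n \<epsilon> dom (ap f (succ n))" if "n \<epsilon> omega" for n
    using that
  proof (induction rule: omega_induct)
    case dfn show ?case by (rule dfn_rules)+
  next
    case zero
    show ?case using longer[of empty] domo[of "succ empty"]
      by (metis domo empty_less_succ empty_omega less_trans_omega mem_succ succ_omega omega_cases)
  next
    case (succ n)
    have "succ n \<epsilon> succ (dom (ap f (succ n)))"
      using succ_mem_succ[OF domo succ.IH] succ.hyps by simp
    then show ?case using longer[of "succ n"] domo[of "succ (succ n)"] succ.hyps
      by (metis less_trans_omega mem_succ succ_omega)
  qed
  define x where "x = Sep (cart omega B) (\<lambda>p. \<exists>n. n \<epsilon> omega \<and> p \<epsilon> ap f n)"
  have x0: "p \<epsilon> x \<longleftrightarrow> p \<epsilon> cart omega B \<and> (\<exists>n. n \<epsilon> omega \<and> p \<epsilon> ap f n)" for p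
    unfolding x_def by (rule mem_Sep) (rule dfn_rules)+
  have fn: "func (ap f n) (dom (ap f n)) B" if "n \<epsilon> omega" for n
    using T[OF fT[OF that]] unfolding mem_seqs by blast
  have "p \<epsilon> cart omega B" if "n \<epsilon> omega" "p \<epsilon> ap f n" for p n
    using func_mem[OF fn[OF that(1)] that(2)] ap_mem[OF fn[OF that(1)]] omega_trans domo that(1)
    by (metis pair_mem_cart)
  then have x: "p \<epsilon> x \<longleftrightarrow> (\<exists>n. n \<epsilon> omega \<and> p \<epsilon> ap f n)" for p
    using x0 by blast
  have "func x omega B"
  proof (rule funcI)
    show "\<exists>k y. p = pair k y \<and> k \<epsilon> omega \<and> y \<epsilon> B" if "p \<epsilon> x" for p
      using that unfolding x0 mem_cart by blast
    show "\<exists>y. pair n y \<epsilon> x" if "n \<epsilon> omega" for n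
      using grow[OF that] that unfolding x mem_dom by (metis succ_omega)
    show "y = z" if "pair k y \<epsilon> x" "pair k z \<epsilon> x" for k y z
    proof -
      obtain m n where mn: "m \<epsilon> omega" "n \<epsilon> omega" "pair k y \<epsilon> ap f m" "pair k z \<epsilon> ap f n"
        using \<open>pair k y \<epsilon> x\<close> \<open>pair k z \<epsilon> x\<close> unfolding x by blast
      then show ?thesis using cmp[OF mn(1,2)] fn[of m] fn[of n] func_pair_iff unfolding subset_def
        by metis
    qed
  qed
  moreover have "\<exists>s. s \<epsilon> T \<and> subset s x \<and> n \<epsilon> dom s" if "n \<epsilon> omega" for n
    using grow[OF that] fT[of "succ n"] that x unfolding subset_def by (metis succ_omega)
  ultimately show ?thesis by blast
qed

text \<open>
  The axiom DC controls neither the first value of the sequence nor the dependence of a step on its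
  number.  Both are recovered by applying it to the tree of finite approximations, which record their
  own starting point and length.  With a functional \<open>P\<close> this is definition by recursion on \<open>\<omega>\<close>.
\<close>

lemma dependent_choice_from:
  assumes P: "dfn (\<lambda>e. P (e 0) (e (Suc 0)) (e (Suc (Suc 0))))"
    and a0: "a0 \<epsilon> A"
    and step: "\<And>n x. n \<epsilon> omega \<Longrightarrow> x \<epsilon> A \<Longrightarrow> \<exists>y. y \<epsilon> A \<and> P n x y"
  shows "\<exists>f. func f omega A \<and> ap f empty = a0 \<and> (\<forall>n. n \<epsilon> omega \<longrightarrow> P n (ap f n) (ap f (succ n)))"
proof -
  define Q where "Q s \<longleftrightarrow> (empty \<epsilon> dom s \<longrightarrow> ap s empty = a0) \<and>
    (\<forall>k. succ k \<epsilon> dom s \<longrightarrow> P k (ap s k) (ap s (succ k)))" for s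
  note P' = dfn_lift3[OF P]
  define T where "T = Sep (seqs A) Q"
  have T: "s \<epsilon> T \<longleftrightarrow> s \<epsilon> seqs A \<and> Q s" for s
    unfolding T_def by (rule mem_Sep, unfold Q_def) (rule dfn_rules P')+
  have e: "func empty empty A" by (rule funcI) auto
  have 1: "empty \<epsilon> T" unfolding T Q_def using seqsI[OF _ e] dom_func[OF e] by simp
  have 2: "\<exists>s'. s' \<epsilon> T \<and> subset s s' \<and> s \<noteq> s'" if "s \<epsilon> T" for s
  proof -
    define n where "n = dom s"
    have s: "n \<epsilon> omega" "func s n A" and Q: "Q s"
      using that unfolding T mem_seqs n_def by blast+
    obtain a where a: "a \<epsilon> A" "n = empty \<Longrightarrow> a = a0"
      "\<And>k. n = succ k \<Longrightarrow> k \<epsilon> omega \<Longrightarrow> P k (ap s k) a"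
    proof (rule omega_cases[OF s(1)])
      assume "n = empty"
      then show thesis using that[of a0] a0 by (metis mem_empty mem_succ)
    next
      fix k assume k: "k \<epsilon> omega" "n = succ k"
      then obtain a where "a \<epsilon> A" "P k (ap s k) a" using step[of k "ap s k"] ap_mem[OF s(2)] by auto
      with k that[of a] show thesis by (metis succ_inj mem_empty mem_succ)
    qed
    note sn = snoc[OF s a(1)]
    have d: "dom (snoc s a) = succ n" by (rule dom_func[OF sn(1)])
    have "Q (snoc s a)" unfolding Q_def d
    proof (intro conjI impI allI)
      assume "empty \<epsilon> succ n"
      then show "ap (snoc s a) empty = a0"
        using Q sn(2) sn(3)[of empty] a(2) unfolding Q_def n_def[symmetric] by auto
    next
      fix k assume k: "succ k \<epsilon> succ n"
      have ko: "k \<epsilon> omega" using k s(1) omega_trans[of k "succ k"] omega_trans[of "succ k" "succ n"]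
        by simp
      have kn: "k \<epsilon> n" using k s(1) less_trans_omega[of k "succ k" n] by auto
      show "P k (ap (snoc s a) k) (ap (snoc s a) (succ k))"
      proof (cases "succ k = n")
        case True with a(3)[OF _ ko] sn(2) sn(3)[OF kn] show ?thesis by auto
      next
        case False
        with k have "succ k \<epsilon> n" by simp
        with Q sn(3)[OF this] sn(3)[OF kn] show ?thesis unfolding Q_def n_def[symmetric] by simp
      qed
    qed
    then have "snoc s a \<epsilon> T" unfolding T using seqsI[OF _ sn(1)] s(1) by simp
    moreover have "s \<noteq> snoc s a" using d unfolding n_def by (metis mem_succ mem_irrefl)
    ultimately show ?thesis using sn(4) by blast
  qed
  obtain x where x: "func x omega A" "\<And>n. n \<epsilon> omega \<Longrightarrow> \<exists>s. s \<epsilon> T \<and> subset s x \<and> n \<epsilon> dom s"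
    using run_through_tree[OF _ 1 2, of A] T by blast
  have app: "ap x k = ap s k" if "s \<epsilon> T" "subset s x" "k \<epsilon> dom s" for s k
    using that subset_funcD(2)[of s x "dom s" A omega A k] x(1) unfolding T mem_seqs by blast
  have "ap x empty = a0" using x(2)[of empty] app unfolding T Q_def by (metis empty_omega)
  moreover have "P n (ap x n) (ap x (succ n))" if n: "n \<epsilon> omega" for n
  proof -
    obtain s where s: "s \<epsilon> T" "subset s x" "succ n \<epsilon> dom s" using x(2)[of "succ n"] n by auto
    then have "n \<epsilon> dom s" using less_trans_omega[of n "succ n" "dom s"] unfolding T mem_seqs by simp
    with s app[OF s(1,2)] show ?thesis unfolding T Q_def by metis
  qed
  ultimately show ?thesis using x(1) by blast
qed

end

section \<open>Ordered fields\<close>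

context ordered_field
begin

lemma less_add_iff:
  assumes "x \<in> carrier F" "y \<in> carrier F" "z \<in> carrier F"
  shows "x \<oplus> z \<prec> y \<oplus> z \<longleftrightarrow> x \<prec> y"
proof
  assume "x \<oplus> z \<prec> y \<oplus> z"
  from less_add[OF _ _ _ this, of "\<ominus> z"] assms have "(x \<oplus> z) \<oplus> \<ominus> z \<prec> (y \<oplus> z) \<oplus> \<ominus> z" by simp
  moreover have "(x \<oplus> z) \<oplus> \<ominus> z = x" "(y \<oplus> z) \<oplus> \<ominus> z = y"
    using assms by (simp_all add: a_assoc r_neg)
  ultimately show "x \<prec> y" by simp
qed (use assms less_add in blast)

lemma difference:
  assumes "x \<in> carrier F" "y \<in> carrier F"
  shows "\<exists>d. d \<in> carrier F \<and> x \<oplus> d = y"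
proof (intro exI conjI)
  show "x \<oplus> (\<ominus> x \<oplus> y) = y" using assms by (simp add: r_neg2)
qed (use assms in simp)

lemma less_mult_iff:
  assumes "x \<in> carrier F" "y \<in> carrier F" "z \<in> carrier F" "\<zero> \<prec> z"
  shows "x \<otimes> z \<prec> y \<otimes> z \<longleftrightarrow> x \<prec> y"
proof -
  have 1: "x \<otimes> z \<prec> y \<otimes> z" if xy: "x \<prec> y" "x \<in> carrier F" "y \<in> carrier F" for x y
  proof -
    obtain d where d: "d \<in> carrier F" "x \<oplus> d = y" using difference xy by blast
    have "\<zero> \<prec> d" using less_add_iff[of \<zero> d x] d xy by (simp add: a_comm)
    then have "\<zero> \<prec> d \<otimes> z" using less_mult d assms by blast
    then have "\<zero> \<oplus> x \<otimes> z \<prec> d \<otimes> z \<oplus> x \<otimes> z" using d assms xy by (subst less_add_iff) auto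
    moreover have "d \<otimes> z \<oplus> x \<otimes> z = y \<otimes> z"
      using d assms xy by (metis a_comm l_distr)
    ultimately show ?thesis using assms xy by simp
  qed
  show ?thesis
  proof
    assume "x \<otimes> z \<prec> y \<otimes> z"
    then show "x \<prec> y"
      using 1[of y x] less_total[of x y] less_irrefl less_trans[of "x \<otimes> z" "y \<otimes> z" "x \<otimes> z"] assms
      by (metis m_closed)
  qed (use 1 assms in blast)
qed

lemma one_pos: "\<zero> \<prec> \<one>"
proof (rule ccontr)
  assume "\<not> \<zero> \<prec> \<one>"
  then have "\<one> \<prec> \<zero>" using less_total[of \<one> \<zero>] by auto
  from less_add[OF _ _ _ this, of "\<ominus> \<one>"] have "\<one> \<oplus> \<ominus> \<one> \<prec> \<zero> \<oplus> \<ominus> \<one>" by simp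
  then have "\<zero> \<prec> \<ominus> \<one>" by (simp add: r_neg)
  from less_mult[OF _ _ this this] have "\<zero> \<prec> \<ominus> \<one> \<otimes> \<ominus> \<one>" by simp
  then have "\<zero> \<prec> \<one>" by (simp add: l_minus r_minus)
  with \<open>\<not> \<zero> \<prec> \<one>\<close> show False ..
qed

lemma quotient:
  assumes "y \<in> carrier F" "z \<in> carrier F" "\<zero> \<prec> z"
  shows "\<exists>w. w \<in> carrier F \<and> w \<otimes> z = y"
proof -
  have "z \<noteq> \<zero>" using assms less_irrefl by auto
  then have z: "z \<in> Units F" using assms field_Units by simp
  have "(y \<otimes> inv z) \<otimes> z = y"
    using z assms Units_l_inv Units_inv_closed by (simp add: m_assoc)
  then show ?thesis using assms(1) Units_inv_closed[OF z] m_closed by blast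
qed

lemma halving:
  assumes "y \<in> carrier F" shows "\<exists>h. h \<in> carrier F \<and> h \<oplus> h = y"
proof -
  from less_add[OF _ _ _ one_pos, of \<one>] have "\<zero> \<oplus> \<one> \<prec> \<one> \<oplus> \<one>" by simp
  then have "\<zero> \<prec> \<one> \<oplus> \<one>" using one_pos less_trans by (metis l_zero one_closed zero_closed a_closed)
  with quotient[OF assms, of "\<one> \<oplus> \<one>"] obtain h where "h \<in> carrier F" "h \<otimes> (\<one> \<oplus> \<one>) = y" by auto
  then show ?thesis by (metis r_distr r_one one_closed)
qed

lemma between:
  assumes "x \<in> carrier F" "y \<in> carrier F" "x \<prec> y"
  shows "\<exists>z. z \<in> carrier F \<and> x \<prec> z \<and> z \<prec> y"
proof -
  obtain h where h: "h \<in> carrier F" "h \<oplus> h = x \<oplus> y" using halving assms by (metis a_closed)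
  have "x \<prec> h"
  proof (rule ccontr)
    assume n: "\<not> x \<prec> h"
    have "h \<oplus> h \<prec> x \<oplus> y"
    proof (cases "h = x")
      case True with assms show ?thesis by (metis less_add_iff a_comm)
    next
      case False
      then have "h \<prec> x" using n less_total assms h by blast
      then have "h \<oplus> h \<prec> x \<oplus> x" using less_add_iff assms h a_comm less_trans by (metis a_closed)
      moreover have "x \<oplus> x \<prec> x \<oplus> y" using assms by (metis less_add_iff a_comm)
      ultimately show ?thesis using less_trans assms h by (metis a_closed)
    qed
    with h assms less_irrefl show False by (metis a_closed)
  qed
  moreover have "h \<prec> y"
  proof (rule ccontr)
    assume n: "\<not> h \<prec> y"
    have "x \<oplus> y \<prec> h \<oplus> h"
    proof (cases "h = y")
      case True with assms show ?thesis by (metis less_add_iff)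
    next
      case False
      then have "y \<prec> h" using n less_total assms h by blast
      then have "y \<oplus> x \<prec> h \<oplus> x" using less_add assms h by blast
      moreover have "x \<oplus> h \<prec> h \<oplus> h" using \<open>x \<prec> h\<close> less_add assms h by blast
      ultimately show ?thesis using less_trans[of "x \<oplus> y" "x \<oplus> h" "h \<oplus> h"] assms h a_comm
        by (metis a_closed)
    qed
    with h assms less_irrefl show False by (metis a_closed)
  qed
  ultimately show ?thesis using h by blast
qed

lemma margin:
  assumes "x \<in> carrier F" "y \<in> carrier F" "x \<prec> y"
  shows "\<exists>b e. b \<in> carrier F \<and> e \<in> carrier F \<and> x \<prec> b \<and> \<zero> \<prec> e \<and> b \<oplus> (e \<oplus> e) = y"
proof -
  obtain b where b: "b \<in> carrier F" "x \<prec> b" "b \<prec> y" using between assms by blast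
  obtain d where d: "d \<in> carrier F" "b \<oplus> d = y" using difference b assms by blast
  obtain e where e: "e \<in> carrier F" "e \<oplus> e = d" using halving d by blast
  have "\<zero> \<prec> d" using less_add_iff[of \<zero> d b] d b by (simp add: a_comm)
  have "\<zero> \<prec> e"
  proof (rule ccontr)
    assume n: "\<not> \<zero> \<prec> e"
    show False
    proof (cases "e = \<zero>")
      case True with e \<open>\<zero> \<prec> d\<close> less_irrefl show False by auto
    next
      case False
      then have "e \<prec> \<zero>" using n less_total e by blast
      then have "e \<oplus> e \<prec> \<zero> \<oplus> e" using less_add e by blast
      then have "d \<prec> \<zero>" using \<open>e \<prec> \<zero>\<close> e d less_trans[of d e \<zero>] by simp
      with \<open>\<zero> \<prec> d\<close> d less_trans less_irrefl show False by blast
    qed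
  qed
  with b d e show ?thesis by blast
qed

end

section \<open>Enumerating pairs of natural numbers\<close>

context zf_dc
begin

text \<open>
  The walk \<open>(0,0), (1,0), (1,1), (2,0), (2,1), (2,2), \<dots>\<close> through the triangle \<open>y \<le> s\<close> is defined by
  recursion without any arithmetic.  Its second component takes every value infinitely often, which is
  what a bookkeeping argument requires.
\<close>

lemma pair_enumeration:
  "\<exists>g. func g omega (cart omega omega)
     \<and> (\<forall>n. n \<epsilon> omega \<longrightarrow> psnd (ap g n) \<epsilon> succ (pfst (ap g n)))
     \<and> (\<forall>s y. s \<epsilon> omega \<and> y \<epsilon> succ s \<longrightarrow> (\<exists>n. n \<epsilon> omega \<and> ap g n = pair s y))
     \<and> (\<forall>m y. m \<epsilon> omega \<and> y \<epsilon> omega \<longrightarrow> (\<exists>n. n \<epsilon> omega \<and> m \<epsilon> n \<and> psnd (ap g n) = y))"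
proof -
  define st where "st p = (if psnd p \<epsilon> pfst p then pair (pfst p) (succ (psnd p))
      else pair (succ (pfst p)) empty)" for p
  have "\<exists>g. func g omega (cart omega omega) \<and> ap g empty = pair empty empty
      \<and> (\<forall>n. n \<epsilon> omega \<longrightarrow> ap g (succ n) = st (ap g n))"
  proof (rule dependent_choice_from[where P = "\<lambda>n x y. y = st x"])
    show "dfn (\<lambda>e. e (Suc (Suc 0)) = st (e (Suc 0)))" unfolding st_def by (rule dfn_rules)+
  qed (auto simp: mem_cart st_def)
  then obtain g where g: "func g omega (cart omega omega)" "ap g empty = pair empty empty"
    "\<And>n. n \<epsilon> omega \<Longrightarrow> ap g (succ n) = st (ap g n)" by blast
  have gp: "pfst (ap g n) \<epsilon> omega" "psnd (ap g n) \<epsilon> omega" 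
    "ap g n = pair (pfst (ap g n)) (psnd (ap g n))" if "n \<epsilon> omega" for n
    using ap_mem[OF g(1) that] by (auto simp: mem_cart)
  have inv: "psnd (ap g n) \<epsilon> succ (pfst (ap g n))" if "n \<epsilon> omega" for n
    using that
  proof (induction rule: omega_induct)
    case dfn show ?case by (rule dfn_rules)+
  next
    case zero show ?case by (simp add: g)
  next
    case (succ n)
    then show ?case
      using succ_mem_succ[OF gp(1), of n "psnd (ap g n)"] gp(1)[of n] empty_less_succ[of "pfst (ap g n)"] empty_less_succ[of n]
      by (auto simp: g(3) st_def)
  qed
  \<comment> \<open>A row with a large number is reached late, so \<open>y\<close> is attained beyond \<open>m\<close> in a row numbered above \<open>m\<close>.\<close>
  have bound: "pfst (ap g n) \<epsilon> succ n" if "n \<epsilon> omega" for n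
    using that
  proof (induction rule: omega_induct)
    case dfn show ?case by (rule dfn_rules)+
  next
    case zero show ?case by (simp add: g)
  next
    case (succ n)
    then show ?case
      using succ_mem_succ[of "succ n" "pfst (ap g n)"] by (auto simp: g(3) st_def)
  qed
  have all: "\<exists>n. n \<epsilon> omega \<and> ap g n = pair s y" if "s \<epsilon> omega" "y \<epsilon> succ s" for s y
  proof -
    have row: "\<exists>n. n \<epsilon> omega \<and> ap g n = pair s y"
      if s: "s \<epsilon> omega" and s0: "\<exists>n. n \<epsilon> omega \<and> ap g n = pair s empty"
        and y: "y \<epsilon> succ s" for s y
    proof -
      have "y \<epsilon> omega" using y s omega_trans succ_omega by blast
      then have "y \<epsilon> succ s \<longrightarrow> (\<exists>n. n \<epsilon> omega \<and> ap g n = pair s y)"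
      proof (induction rule: omega_induct)
        case dfn show ?case by (rule dfn_rules)+
      next
        case (succ y)
        show ?case
        proof
          assume sy: "succ y \<epsilon> succ s"
          then have ys: "y \<epsilon> s" using s less_trans_omega[of y "succ y" s] by auto
          then obtain n where n: "n \<epsilon> omega" "ap g n = pair s y" using succ by auto
          then have "ap g (succ n) = pair s (succ y)" using ys by (simp add: g(3) st_def)
          with n show "\<exists>n. n \<epsilon> omega \<and> ap g n = pair s (succ y)" using succ_omega by blast
        qed
      qed (use s0 in blast)
      with y show ?thesis by blast
    qed
    have "\<exists>n. n \<epsilon> omega \<and> ap g n = pair s empty" using that(1)
    proof (induction rule: omega_induct)
      case dfn show ?case by (rule dfn_rules)+
    next
      case zero show ?case using g(2) empty_omega by blast
    next
      case (succ s)
      obtain n where n: "n \<epsilon> omega" "ap g n = pair s s" using row[OF succ, of s] by auto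
      then have "ap g (succ n) = pair (succ s) empty" by (simp add: g(3) st_def)
      with n show ?case using succ_omega by blast
    qed
    with row that show ?thesis by blast
  qed
  have io: "\<exists>n. n \<epsilon> omega \<and> m \<epsilon> n \<and> psnd (ap g n) = y" if my: "m \<epsilon> omega" "y \<epsilon> omega" for m y
  proof -
    obtain s where s: "s \<epsilon> omega" "m \<epsilon> s" "y \<epsilon> succ s"
    proof (cases "y \<epsilon> succ m")
      case True then show thesis using that[of "succ m"] my by simp
    next
      case False
      then have "m \<epsilon> y" using omega_linear[OF my] by auto
      then show thesis using that[of y] my by simp
    qed
    then obtain n where n: "n \<epsilon> omega" "ap g n = pair s y" using all by blast
    then have "s \<epsilon> succ n" using bound[of n] by simp
    with s n have "m \<epsilon> n" using less_trans_omega[of m s n] by auto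
    with n show ?thesis by auto
  qed
  show ?thesis using g(1) inv all io by blast
qed

end

section \<open>The reals of the model and a countable base\<close>

locale zf_reals = zf_dc +
  fixes R plusR timesR ltR zer on :: 'a
  assumes plus_func: "func plusR (cart R R) R"
    and times_func: "func timesR (cart R R) R"
    and field: "ordered_field
        \<lparr>carrier = {x. x \<epsilon> R}, monoid.mult = app2 timesR, one = on, zero = zer, add = app2 plusR\<rparr>
        (\<lambda>x y. pair x y \<epsilon> ltR)"
    and complete: "\<lbrakk>subset S R; x \<epsilon> S; b \<epsilon> R; \<And>x. x \<epsilon> S \<Longrightarrow> pair x b \<epsilon> ltR \<or> x = b\<rbrakk> \<Longrightarrow>
      \<exists>s. s \<epsilon> R \<and> (\<forall>x. x \<epsilon> S \<longrightarrow> pair x s \<epsilon> ltR \<or> x = s) \<and>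
        (\<forall>b. b \<epsilon> R \<and> (\<forall>x. x \<epsilon> S \<longrightarrow> pair x b \<epsilon> ltR \<or> x = b) \<longrightarrow> pair s b \<epsilon> ltR \<or> s = b)"
begin

definition add :: "'a \<Rightarrow> 'a \<Rightarrow> 'a" where "add x y = ap plusR (pair x y)"
definition mul :: "'a \<Rightarrow> 'a \<Rightarrow> 'a" where "mul x y = ap timesR (pair x y)"
definition lt :: "'a \<Rightarrow> 'a \<Rightarrow> bool" where "lt x y \<longleftrightarrow> pair x y \<epsilon> ltR"
definition le :: "'a \<Rightarrow> 'a \<Rightarrow> bool" where "le x y \<longleftrightarrow> lt x y \<or> x = y"

lemma dfnt_add [dfn_rules]: "dfnt s \<Longrightarrow> dfnt t \<Longrightarrow> dfnt (\<lambda>e. add (s e) (t e))"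
  unfolding add_def by ((rule dfn_rules)+ | assumption)+
lemma dfnt_mul [dfn_rules]: "dfnt s \<Longrightarrow> dfnt t \<Longrightarrow> dfnt (\<lambda>e. mul (s e) (t e))"
  unfolding mul_def by ((rule dfn_rules)+ | assumption)+
lemma dfn_lt [dfn_rules]: "dfnt s \<Longrightarrow> dfnt t \<Longrightarrow> dfn (\<lambda>e. lt (s e) (t e))"
  unfolding lt_def by ((rule dfn_rules)+ | assumption)+
lemma dfn_le [dfn_rules]: "dfnt s \<Longrightarrow> dfnt t \<Longrightarrow> dfn (\<lambda>e. le (s e) (t e))"
  unfolding le_def by ((rule dfn_rules)+ | assumption)+

lemma app2_plus: "x \<epsilon> R \<Longrightarrow> y \<epsilon> R \<Longrightarrow> app2 plusR x y = add x y"
  unfolding app2_def add_def by (rule app_eq_ap[OF plus_func]) simp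
lemma app2_times: "x \<epsilon> R \<Longrightarrow> y \<epsilon> R \<Longrightarrow> app2 timesR x y = mul x y"
  unfolding app2_def mul_def by (rule app_eq_ap[OF times_func]) simp

interpretation OF: ordered_field
  "\<lparr>carrier = {x. x \<epsilon> R}, monoid.mult = app2 timesR, one = on, zero = zer, add = app2 plusR\<rparr>"
  "\<lambda>x y. pair x y \<epsilon> ltR"
  by (rule field)

lemma add_mem [simp]: "x \<epsilon> R \<Longrightarrow> y \<epsilon> R \<Longrightarrow> add x y \<epsilon> R"
  unfolding add_def by (rule ap_mem[OF plus_func]) simp
lemma mul_mem [simp]: "x \<epsilon> R \<Longrightarrow> y \<epsilon> R \<Longrightarrow> mul x y \<epsilon> R"
  unfolding mul_def by (rule ap_mem[OF times_func]) simp
lemma zer_mem [simp]: "zer \<epsilon> R" using OF.zero_closed by simp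
lemma on_mem [simp]: "on \<epsilon> R" using OF.one_closed by simp
lemma add_comm: "x \<epsilon> R \<Longrightarrow> y \<epsilon> R \<Longrightarrow> add x y = add y x"
  using OF.a_comm[of x y] by (simp add: app2_plus)
lemma add_assoc: "x \<epsilon> R \<Longrightarrow> y \<epsilon> R \<Longrightarrow> z \<epsilon> R \<Longrightarrow> add (add x y) z = add x (add y z)"
  using OF.a_assoc[of x y z] by (simp add: app2_plus)
lemma add_zer [simp]: "x \<epsilon> R \<Longrightarrow> add zer x = x" "x \<epsilon> R \<Longrightarrow> add x zer = x"
  using OF.l_zero[of x] OF.r_zero[of x] by (simp_all add: app2_plus)
lemma distrib: "x \<epsilon> R \<Longrightarrow> y \<epsilon> R \<Longrightarrow> z \<epsilon> R \<Longrightarrow> mul (add x y) z = add (mul x z) (mul y z)"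
  using OF.l_distr[of x y z] by (simp add: app2_plus app2_times)
lemma mul_comm: "x \<epsilon> R \<Longrightarrow> y \<epsilon> R \<Longrightarrow> mul x y = mul y x"
  using OF.m_comm[of x y] by (simp add: app2_times)
lemma one_mul [simp]: "x \<epsilon> R \<Longrightarrow> mul on x = x"
  using OF.l_one[of x] by (simp add: app2_times)
lemma zero_mul [simp]: "x \<epsilon> R \<Longrightarrow> mul zer x = zer"
  using OF.l_null[of x] by (simp add: app2_times)

lemma lt_irrefl [simp]: "x \<epsilon> R \<Longrightarrow> \<not> lt x x"
  using OF.less_irrefl[of x] by (simp add: lt_def)
lemma lt_trans: "lt x y \<Longrightarrow> lt y z \<Longrightarrow> x \<epsilon> R \<Longrightarrow> y \<epsilon> R \<Longrightarrow> z \<epsilon> R \<Longrightarrow> lt x z"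
  using OF.less_trans[of x y z] by (simp add: lt_def)
lemma lt_total: "x \<epsilon> R \<Longrightarrow> y \<epsilon> R \<Longrightarrow> lt x y \<or> x = y \<or> lt y x"
  using OF.less_total[of x y] by (simp add: lt_def)
lemma not_lt: "x \<epsilon> R \<Longrightarrow> y \<epsilon> R \<Longrightarrow> \<not> lt x y \<longleftrightarrow> le y x"
  unfolding le_def using lt_total lt_trans lt_irrefl by blast
lemma lt_le_trans: "lt x y \<Longrightarrow> le y z \<Longrightarrow> x \<epsilon> R \<Longrightarrow> y \<epsilon> R \<Longrightarrow> z \<epsilon> R \<Longrightarrow> lt x z"
  unfolding le_def using lt_trans by blast
lemma le_lt_trans: "le x y \<Longrightarrow> lt y z \<Longrightarrow> x \<epsilon> R \<Longrightarrow> y \<epsilon> R \<Longrightarrow> z \<epsilon> R \<Longrightarrow> lt x z"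
  unfolding le_def using lt_trans by blast
lemma le_trans: "le x y \<Longrightarrow> le y z \<Longrightarrow> x \<epsilon> R \<Longrightarrow> y \<epsilon> R \<Longrightarrow> z \<epsilon> R \<Longrightarrow> le x z"
  unfolding le_def using lt_trans by blast
lemma le_refl [simp]: "le x x" by (simp add: le_def)
lemma lt_imp_le: "lt x y \<Longrightarrow> le x y" by (simp add: le_def)
lemma lt_add_iff [simp]: "x \<epsilon> R \<Longrightarrow> y \<epsilon> R \<Longrightarrow> z \<epsilon> R \<Longrightarrow> lt (add x z) (add y z) \<longleftrightarrow> lt x y"
  using OF.less_add_iff[of x y z] by (simp add: lt_def app2_plus)
lemma add_cancel: "x \<epsilon> R \<Longrightarrow> y \<epsilon> R \<Longrightarrow> z \<epsilon> R \<Longrightarrow> add x z = add y z \<longleftrightarrow> x = y"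
  using lt_total[of x y] lt_add_iff[of x y z] lt_add_iff[of y x z] by (metis add_mem lt_irrefl)
lemma le_add_iff [simp]: "x \<epsilon> R \<Longrightarrow> y \<epsilon> R \<Longrightarrow> z \<epsilon> R \<Longrightarrow> le (add x z) (add y z) \<longleftrightarrow> le x y"
  unfolding le_def by (simp add: add_cancel)
lemma lt_mul_iff: "x \<epsilon> R \<Longrightarrow> y \<epsilon> R \<Longrightarrow> z \<epsilon> R \<Longrightarrow> lt zer z \<Longrightarrow> lt (mul x z) (mul y z) \<longleftrightarrow> lt x y"
  using OF.less_mult_iff[of x y z] by (simp add: lt_def app2_times)
lemma one_pos [simp]: "lt zer on"
  using OF.one_pos by (simp add: lt_def)
lemma difference: "x \<epsilon> R \<Longrightarrow> y \<epsilon> R \<Longrightarrow> \<exists>d. d \<epsilon> R \<and> add d x = y"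
  using OF.difference[of x y] app2_plus add_comm by (metis mem_Collect_eq partial_object.select_convs(1) ring.simps(2))
lemma quotient: "y \<epsilon> R \<Longrightarrow> z \<epsilon> R \<Longrightarrow> lt zer z \<Longrightarrow> \<exists>w. w \<epsilon> R \<and> mul w z = y"
  using OF.quotient[of y z] by (auto simp add: lt_def app2_times)
lemma halving: "y \<epsilon> R \<Longrightarrow> \<exists>h. h \<epsilon> R \<and> add h h = y"
  using OF.halving[of y] by (auto simp add: app2_plus)
lemma between: "x \<epsilon> R \<Longrightarrow> y \<epsilon> R \<Longrightarrow> lt x y \<Longrightarrow> \<exists>z. z \<epsilon> R \<and> lt x z \<and> lt z y"
  using OF.between[of x y] by (auto simp add: lt_def)
lemma margin: "x \<epsilon> R \<Longrightarrow> y \<epsilon> R \<Longrightarrow> lt x y \<Longrightarrow>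
    \<exists>b e. b \<epsilon> R \<and> e \<epsilon> R \<and> lt x b \<and> lt zer e \<and> add b (add e e) = y"
  using OF.margin[of x y] app2_plus by (simp add: lt_def) (metis add_mem)

lemma add_strict_mono: "lt x y \<Longrightarrow> lt z w \<Longrightarrow> x \<epsilon> R \<Longrightarrow> y \<epsilon> R \<Longrightarrow> z \<epsilon> R \<Longrightarrow> w \<epsilon> R \<Longrightarrow>
    lt (add x z) (add y w)"
  using lt_trans[of "add x z" "add y z" "add y w"] lt_add_iff[of z w y]
  by (simp add: add_comm)

lemma supremum:
  assumes "subset S R" "x \<epsilon> S" "b \<epsilon> R" "\<And>x. x \<epsilon> S \<Longrightarrow> le x b"
  obtains s where "s \<epsilon> R" "\<And>x. x \<epsilon> S \<Longrightarrow> le x s"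
    "\<And>b. b \<epsilon> R \<Longrightarrow> (\<And>x. x \<epsilon> S \<Longrightarrow> le x b) \<Longrightarrow> le s b"
  using complete[OF assms(1-3)] assms(4) unfolding le_def lt_def by blast

lemma naturals:
  "\<exists>\<nu>. func \<nu> omega R \<and> ap \<nu> empty = zer \<and> (\<forall>n. n \<epsilon> omega \<longrightarrow> ap \<nu> (succ n) = add (ap \<nu> n) on)"
proof (rule dependent_choice_from[where P = "\<lambda>n x y. y = add x on"])
  show "dfn (\<lambda>e. e (Suc (Suc 0)) = add (e (Suc 0)) on)" by (rule dfn_rules)+
qed auto

text \<open>
  Codes \<open>n\<close> of intervals \<open>(lo n, hi n)\<close> inside the unit interval, among which there is one inside any
  given open subinterval.
\<close>

definition base :: "'a \<Rightarrow> 'a \<Rightarrow> bool" where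
  "base lo hi \<longleftrightarrow> func lo omega R \<and> func hi omega R
    \<and> (\<forall>n. n \<epsilon> omega \<longrightarrow> le zer (ap lo n) \<and> lt (ap lo n) (ap hi n) \<and> le (ap hi n) on)
    \<and> (\<forall>x y. x \<epsilon> R \<and> y \<epsilon> R \<and> le zer x \<and> lt x y \<and> le y on
          \<longrightarrow> (\<exists>n. n \<epsilon> omega \<and> lt x (ap lo n) \<and> lt (ap hi n) y))"

text \<open>
  The intervals \<open>(y/(s+1), (y+1)/(s+1))\<close> with \<open>y \<le> s\<close> form a base: if \<open>(s+1)(v-u) > 2\<close>, which the
  Archimedean property provides, then the second integer above \<open>(s+1)u\<close> is still less than \<open>(s+1)v\<close>.
\<close>

lemma base_exists: "\<exists>lo hi. base lo hi"
proof -
  obtain \<nu> where \<nu>f: "func \<nu> omega R" and \<nu>0: "ap \<nu> empty = zer"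
    and \<nu>S: "\<And>n. n \<epsilon> omega \<Longrightarrow> ap \<nu> (succ n) = add (ap \<nu> n) on"
    using naturals by blast
  obtain g where gf: "func g omega (cart omega omega)"
    and gle: "\<And>n. n \<epsilon> omega \<Longrightarrow> psnd (ap g n) \<epsilon> succ (pfst (ap g n))"
    and gall: "\<And>s y. s \<epsilon> omega \<Longrightarrow> y \<epsilon> succ s \<Longrightarrow> \<exists>n. n \<epsilon> omega \<and> ap g n = pair s y"
    using pair_enumeration by blast
  have \<nu>R [simp]: "ap \<nu> n \<epsilon> R" if "n \<epsilon> omega" for n using ap_mem[OF \<nu>f that] .
  have gp [simp]: "pfst (ap g n) \<epsilon> omega" "psnd (ap g n) \<epsilon> omega" if "n \<epsilon> omega" for n
    using ap_mem[OF gf that] by (auto simp: mem_cart)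
  have lt_succ: "lt x (add x on)" if "x \<epsilon> R" for x
    using lt_add_iff[of zer on x] that by (simp add: add_comm)
  have mono: "lt (ap \<nu> m) (ap \<nu> n)" if "n \<epsilon> omega" "m \<epsilon> n" for m n
  proof -
    have "\<forall>m. m \<epsilon> n \<longrightarrow> lt (ap \<nu> m) (ap \<nu> n)" using that(1)
    proof (induction rule: omega_induct)
      case dfn show ?case by (rule dfn_rules)+
    next
      case (succ n)
      have *: "lt (ap \<nu> n) (ap \<nu> (succ n))" using lt_succ succ by (simp add: \<nu>S)
      show ?case
      proof (intro allI impI)
        fix m assume "m \<epsilon> succ n"
        then show "lt (ap \<nu> m) (ap \<nu> (succ n))"
          using * succ omega_trans[of m n] lt_trans[of "ap \<nu> m" "ap \<nu> n" "ap \<nu> (succ n)"] by auto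
      qed
    qed simp
    with that show ?thesis by blast
  qed
  have pos: "lt zer (ap \<nu> (succ n))" if "n \<epsilon> omega" for n
    using mono[of "succ n" empty] that \<nu>0 empty_less_succ by simp
  have reflect: "m \<epsilon> n" if "lt (ap \<nu> m) (ap \<nu> n)" "m \<epsilon> omega" "n \<epsilon> omega" for m n
    using omega_linear[OF that(3,2)] mono[OF that(2)] that lt_trans[of "ap \<nu> m" "ap \<nu> n" "ap \<nu> m"] by auto
  have arch: "\<exists>n. n \<epsilon> omega \<and> lt b (mul (ap \<nu> n) d)" if b: "b \<epsilon> R" and d: "d \<epsilon> R" "lt zer d" for b d
  proof (rule ccontr)
    assume "\<not> ?thesis"
    then have ub: "le (mul (ap \<nu> n) d) b" if "n \<epsilon> omega" for n using that b d not_lt by auto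
    define S where "S = Sep R (\<lambda>z. \<exists>n. n \<epsilon> omega \<and> z = mul (ap \<nu> n) d)"
    have S: "z \<epsilon> S \<longleftrightarrow> z \<epsilon> R \<and> (\<exists>n. n \<epsilon> omega \<and> z = mul (ap \<nu> n) d)" for z
      unfolding S_def by (rule mem_Sep) (rule dfn_rules)+
    have SI: "mul (ap \<nu> n) d \<epsilon> S" if "n \<epsilon> omega" for n using that d S by auto
    obtain m where m: "m \<epsilon> R" "\<And>x. x \<epsilon> S \<Longrightarrow> le x m"
      "\<And>b. b \<epsilon> R \<Longrightarrow> (\<And>x. x \<epsilon> S \<Longrightarrow> le x b) \<Longrightarrow> le m b"
    proof (rule supremum[of S "mul (ap \<nu> empty) d" b])
      show "subset S R" by (simp add: subset_def S)
      show "mul (ap \<nu> empty) d \<epsilon> S" using SI by simp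
    qed (use b ub S in auto)
    \<comment> \<open>If the multiples of \<open>d\<close> are bounded and \<open>m\<close> is their supremum, then already \<open>m - d\<close> is an
        upper bound, as each multiple is followed by another one.\<close>
    obtain c where c: "c \<epsilon> R" "add c d = m" using difference d m by blast
    have "le (mul (ap \<nu> n) d) c" if n: "n \<epsilon> omega" for n
    proof -
      have "le (mul (ap \<nu> (succ n)) d) m" using m(2) SI n by simp
      moreover have "mul (ap \<nu> (succ n)) d = add (mul (ap \<nu> n) d) d"
        using n d by (simp add: \<nu>S distrib)
      ultimately show ?thesis using c n d by (metis le_add_iff mul_mem \<nu>R)
    qed
    then have "le m c" by (intro m(3)[OF c(1)]) (auto simp: S)
    moreover have "lt c m" using c d lt_add_iff[of zer d c] by (simp add: add_comm)
    ultimately show False using c m not_lt by blast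
  qed
  have floor: "\<exists>k. k \<epsilon> omega \<and> le (ap \<nu> k) v \<and> lt v (ap \<nu> (succ k))"
    if v: "v \<epsilon> R" "le zer v" for v
  proof -
    obtain n where n: "n \<epsilon> omega" "lt v (mul (ap \<nu> n) on)" using arch[of v on] v by auto
    then have "lt v (ap \<nu> n)" by (simp add: mul_comm)
    have "lt v (ap \<nu> n) \<longrightarrow> (\<exists>k. k \<epsilon> omega \<and> le (ap \<nu> k) v \<and> lt v (ap \<nu> (succ k)))"
      using n(1)
    proof (induction rule: omega_induct)
      case dfn show ?case by (rule dfn_rules)+
    next
      case zero show ?case using v not_lt[of v zer] by (simp add: \<nu>0)
    next
      case (succ n)
      then show ?case using v not_lt[of v "ap \<nu> n"] by auto
    qed
    with \<open>lt v (ap \<nu> n)\<close> show ?thesis by blast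
  qed
  define den where "den n = ap \<nu> (succ (pfst (ap g n)))" for n
  have den: "den n \<epsilon> R" "lt zer (den n)" if "n \<epsilon> omega" for n
    using that pos unfolding den_def by auto
  have mul_inj: "x = y" if "mul x z = mul y z" "x \<epsilon> R" "y \<epsilon> R" "z \<epsilon> R" "lt zer z" for x y z
    using that lt_mul_iff[of x y z] lt_mul_iff[of y x z] lt_total[of x y] by (metis lt_irrefl mul_mem)
  have ex: "\<exists>f. func f omega R \<and> (\<forall>n. n \<epsilon> omega \<longrightarrow> mul (ap f n) (den n) = num n)"
    if num: "dfnt (\<lambda>e. num (e 0))" "\<And>n. n \<epsilon> omega \<Longrightarrow> num n \<epsilon> R" for num
  proof (rule func_exists)
    show "dfn (\<lambda>e. mul (e (Suc 0)) (den (e 0)) = num (e 0))"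
      unfolding den_def by (rule dfn_rules num)+
    show "\<exists>y. y \<epsilon> R \<and> mul y (den n) = num n" if "n \<epsilon> omega" for n
      using quotient den[OF that] num(2)[OF that] by blast
  qed (use den mul_inj in metis)
  have "\<exists>f. func f omega R \<and> (\<forall>n. n \<epsilon> omega \<longrightarrow> mul (ap f n) (den n) = ap \<nu> (psnd (ap g n)))"
    by (rule ex) ((rule dfn_rules)+, simp)
  then obtain lo where lo: "func lo omega R"
      "\<And>n. n \<epsilon> omega \<Longrightarrow> mul (ap lo n) (den n) = ap \<nu> (psnd (ap g n))"
    by (elim exE conjE) simp
  have "\<exists>f. func f omega R \<and> (\<forall>n. n \<epsilon> omega \<longrightarrow> mul (ap f n) (den n) = ap \<nu> (succ (psnd (ap g n))))"
    by (rule ex) ((rule dfn_rules)+, simp)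
  then obtain hi where hi: "func hi omega R"
      "\<And>n. n \<epsilon> omega \<Longrightarrow> mul (ap hi n) (den n) = ap \<nu> (succ (psnd (ap g n)))"
    by (elim exE conjE) simp
  have R: "ap lo n \<epsilon> R" "ap hi n \<epsilon> R" if "n \<epsilon> omega" for n
    using ap_mem lo(1) hi(1) that by blast+
  have le_mul: "le x y" if "le (mul x (den n)) (mul y (den n))" "x \<epsilon> R" "y \<epsilon> R" "n \<epsilon> omega" for x y n
    using that den[of n] mul_inj[of x "den n" y] lt_mul_iff[of x y "den n"] unfolding le_def by blast
  have mono_le: "le (ap \<nu> m) (ap \<nu> n)" if "n \<epsilon> omega" "m \<epsilon> succ n" for m n
    using that mono[of n m] unfolding le_def by auto
  have 1: "le zer (ap lo n) \<and> lt (ap lo n) (ap hi n) \<and> le (ap hi n) on" if n: "n \<epsilon> omega" for n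
  proof (intro conjI)
    have "le zer (ap \<nu> (psnd (ap g n)))"
      using mono_le[of "psnd (ap g n)" empty] gp n empty_less_succ \<nu>0 by metis
    then show "le zer (ap lo n)" using le_mul[of zer n "ap lo n"] n lo(2) R den by simp
    have "lt (ap \<nu> (psnd (ap g n))) (ap \<nu> (succ (psnd (ap g n))))" using mono n by simp
    then show "lt (ap lo n) (ap hi n)"
      using lt_mul_iff[OF R[OF n] den[OF n]] by (simp add: lo(2) hi(2) n)
    have "le (ap \<nu> (succ (psnd (ap g n)))) (den n)"
      unfolding den_def using mono_le[OF _ succ_mem_succ[OF _ gle[OF n]]] n by simp
    then show "le (ap hi n) on" using le_mul[of "ap hi n" n on] hi(2) R den n by simp
  qed
  have 2: "\<exists>n. n \<epsilon> omega \<and> lt x (ap lo n) \<and> lt (ap hi n) y"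
    if x: "x \<epsilon> R" "le zer x" and y: "y \<epsilon> R" "le y on" and xy: "lt x y" for x y
  proof -
    obtain d where d: "d \<epsilon> R" "add d x = y" using difference x y by blast
    have d0: "lt zer d" using lt_add_iff[of zer d x] d x xy by simp
    obtain s where s: "s \<epsilon> omega" "lt (add on on) (mul (ap \<nu> s) d)" using arch d d0 by (metis add_mem on_mem)
    define \<sigma> where "\<sigma> = ap \<nu> (succ s)"
    have \<sigma>: "\<sigma> \<epsilon> R" "lt zer \<sigma>" using s pos unfolding \<sigma>_def by auto
    have "lt (mul (ap \<nu> s) d) (mul \<sigma> d)"
      unfolding \<sigma>_def using lt_mul_iff[of "ap \<nu> s" "ap \<nu> (succ s)" d] mono[of "succ s" s] s d d0 by simp
    then have sd: "lt (add on on) (mul \<sigma> d)" using s \<sigma> d lt_trans by (metis add_mem mul_mem on_mem \<nu>R)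
    let ?v = "mul x \<sigma>"
    have v: "?v \<epsilon> R" using x \<sigma> by simp
    have "le zer ?v" using x \<sigma> lt_mul_iff[of zer x \<sigma>] zero_mul zer_mem unfolding le_def by metis
    then obtain k where k: "k \<epsilon> omega" "le (ap \<nu> k) ?v" "lt ?v (ap \<nu> (succ k))" using floor v by blast
    have "mul y \<sigma> = add (mul \<sigma> d) ?v" using d x \<sigma> by (metis distrib mul_comm)
    then have "lt (add (add on on) ?v) (mul y \<sigma>)" using sd v \<sigma> d by simp
    moreover have "le (ap \<nu> (succ (succ k))) (add (add on on) ?v)"
      using k v le_add_iff[of "ap \<nu> k" ?v "add on on"]
      by (simp add: \<nu>S add_assoc add_comm[of ?v "add on on"])
    ultimately have top: "lt (ap \<nu> (succ (succ k))) (mul y \<sigma>)"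
      using k v y \<sigma> le_lt_trans by (metis add_mem mul_mem on_mem succ_omega \<nu>R)
    have "le (mul y \<sigma>) \<sigma>"
      using y \<sigma> lt_mul_iff[of y on \<sigma>] one_mul on_mem unfolding le_def by metis
    then have "lt (ap \<nu> (succ (succ k))) \<sigma>" using top lt_le_trans k y \<sigma> by (metis mul_mem succ_omega \<nu>R)
    then have "succ (succ k) \<epsilon> succ s" unfolding \<sigma>_def by (rule reflect) (use k s in simp_all)
    then have ks: "succ k \<epsilon> succ s" using less_trans_omega[of "succ k" "succ (succ k)" "succ s"] s by simp
    obtain n where n: "n \<epsilon> omega" "ap g n = pair s (succ k)" using gall[OF s(1) ks] by blast
    then have dn: "den n = \<sigma>" by (simp add: den_def \<sigma>_def)
    have "lt x (ap lo n)" 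
      using lt_mul_iff[OF x(1) R(1)[OF n(1)] \<sigma>] lo(2)[OF n(1)] n(2) k(3) by (simp add: dn)
    moreover have "lt (ap hi n) y" 
      using lt_mul_iff[OF R(2)[OF n(1)] y(1) \<sigma>] hi(2)[OF n(1)] n(2) top by (simp add: dn)
    ultimately show ?thesis using n by blast
  qed
  have "base lo hi" unfolding base_def using lo(1) hi(1) 1 2 by blast
  then show ?thesis by blast
qed

end

section \<open>The rules of the interval game\<close>

locale interval_game = zf_reals +
  fixes lo hi :: 'a
  assumes base: "base lo hi"
begin

text \<open>
  In a run \<open>x\<close>, entry \<open>0\<close> is a colour declared by player I, and entry \<open>1\<close> has no effect, so that player I
  also chooses the first interval.  The entries from \<open>2\<close> on are codes of intervals, each required to lie
  strictly inside all earlier ones.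
\<close>

definition late :: "'a \<Rightarrow> bool" where "late k \<longleftrightarrow> k \<noteq> empty \<and> k \<noteq> succ empty"

definition nested :: "'a \<Rightarrow> 'a \<Rightarrow> bool" where
  "nested i j \<longleftrightarrow> lt (ap lo i) (ap lo j) \<and> lt (ap hi j) (ap hi i)"

definition violation :: "'a \<Rightarrow> 'a \<Rightarrow> bool" where
  "violation n x \<longleftrightarrow> (\<exists>k. k \<epsilon> n \<and> late k \<and> \<not> nested (ap x k) (ap x n))"

definition legal :: "'a \<Rightarrow> 'a \<Rightarrow> bool" where
  "legal x N \<longleftrightarrow> (\<forall>n. n \<epsilon> N \<longrightarrow> \<not> violation n x)"

definition captures :: "'a \<Rightarrow> 'a \<Rightarrow> bool" where
  "captures x z \<longleftrightarrow> (\<forall>k. k \<epsilon> omega \<and> late k \<longrightarrow> lt (ap lo (ap x k)) z \<and> lt z (ap hi (ap x k)))"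

lemma dfn_late [dfn_rules]: "dfnt s \<Longrightarrow> dfn (\<lambda>e. late (s e))"
  by (rule dfn_lift1[where Q = late], unfold late_def) ((rule dfn_rules)+ | assumption)+
lemma dfn_nested [dfn_rules]: "dfnt s \<Longrightarrow> dfnt t \<Longrightarrow> dfn (\<lambda>e. nested (s e) (t e))"
  by (rule dfn_lift2[where Q = nested], unfold nested_def) ((rule dfn_rules)+ | assumption)+
lemma dfn_violation [dfn_rules]: "dfnt s \<Longrightarrow> dfnt t \<Longrightarrow> dfn (\<lambda>e. violation (s e) (t e))"
  by (rule dfn_lift2[where Q = violation], unfold violation_def) ((rule dfn_rules)+ | assumption)+
lemma dfn_legal [dfn_rules]: "dfnt s \<Longrightarrow> dfnt t \<Longrightarrow> dfn (\<lambda>e. legal (s e) (t e))"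
  by (rule dfn_lift2[where Q = legal], unfold legal_def) ((rule dfn_rules)+ | assumption)+

lemma dfn_captures [dfn_rules]: "dfnt s \<Longrightarrow> dfnt t \<Longrightarrow> dfn (\<lambda>e. captures (s e) (t e))"
  by (rule dfn_lift2[where Q = captures], unfold captures_def) ((rule dfn_rules)+ | assumption)+

lemma lo_mem [simp]: "n \<epsilon> omega \<Longrightarrow> ap lo n \<epsilon> R" and hi_mem [simp]: "n \<epsilon> omega \<Longrightarrow> ap hi n \<epsilon> R"
  using base ap_mem unfolding base_def by blast+

lemma base_bounds: "n \<epsilon> omega \<Longrightarrow> le zer (ap lo n)" "n \<epsilon> omega \<Longrightarrow> lt (ap lo n) (ap hi n)"
    "n \<epsilon> omega \<Longrightarrow> le (ap hi n) on"
  using base unfolding base_def by blast+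

lemma base_dense:
  assumes "x \<epsilon> R" "y \<epsilon> R" "le zer x" "lt x y" "le y on"
  obtains n where "n \<epsilon> omega" "lt x (ap lo n)" "lt (ap hi n) y"
  using base assms unfolding base_def by blast

lemma violation_cong:
  assumes "\<And>k. k \<epsilon> n \<or> k = n \<Longrightarrow> ap x k = ap s k" shows "violation n x \<longleftrightarrow> violation n s"
  unfolding violation_def using assms by metis

definition follows :: "'a \<Rightarrow> 'a \<Rightarrow> 'a \<Rightarrow> 'a \<Rightarrow> bool" where
  "follows S P x N \<longleftrightarrow> (\<forall>n. n \<epsilon> N \<and> n \<epsilon> P \<longrightarrow> ap x n = ap S (restrict x n))"

end

section \<open>Playing against a strategy\<close>

text \<open>
  The two players are treated alike: \<open>S\<close> is a strategy for the player who moves at the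
  stages in \<open>P\<close>, and \<open>never_violates_first\<close> is the one consequence of its being a winning strategy
  which the construction of a generic point uses.
\<close>

locale strategist = interval_game +
  fixes S P :: 'a
  assumes strat: "func S (seqs omega) omega"
    and alternate: "\<And>n. n \<epsilon> omega \<Longrightarrow> succ n \<epsilon> P \<longleftrightarrow> \<not> n \<epsilon> P"
    and never_violates_first: "\<And>x n. \<lbrakk>func x omega omega; follows S P x omega; n \<epsilon> omega; n \<epsilon> P; violation n x\<rbrakk>
        \<Longrightarrow> \<exists>m. m \<epsilon> n \<and> violation m x"
begin

abbreviation obeys :: "'a \<Rightarrow> 'a \<Rightarrow> bool" where "obeys \<equiv> follows S P"

lemma dfn_obeys [dfn_rules]: "dfnt s \<Longrightarrow> dfnt t \<Longrightarrow> dfn (\<lambda>e. obeys (s e) (t e))"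
  by (rule dfn_lift2[where Q = obeys], unfold follows_def) ((rule dfn_rules)+ | assumption)+

lemma prefix:
  assumes s: "s \<epsilon> seqs omega" and x: "func x N omega" and sx: "subset s x" and n: "n \<epsilon> dom s"
  shows prefix_ap: "ap x n = ap s n"
    and prefix_restrict: "restrict x n = restrict s n"
    and prefix_violation: "violation n x \<longleftrightarrow> violation n s"
proof -
  have d: "dom s \<epsilon> omega" and f: "func s (dom s) omega" using s unfolding mem_seqs by auto
  have 1: "ap x k = ap s k" if "k \<epsilon> dom s" for k using subset_funcD(2)[OF sx f x that] .
  then show "ap x n = ap s n" using n .
  have le: "k \<epsilon> dom s" if "k \<epsilon> n" for k using less_trans_omega[OF that n d] .
  then show "restrict x n = restrict s n"
    by (intro restrict_subset[OF sx f x]) (simp add: subset_def)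
  show "violation n x \<longleftrightarrow> violation n s" by (rule violation_cong) (use 1 le n in auto)
qed

lemma obeys_union:
  assumes x: "func x N omega"
    and T: "\<And>n. n \<epsilon> N \<Longrightarrow> \<exists>s. s \<epsilon> seqs omega \<and> obeys s (dom s) \<and> subset s x \<and> n \<epsilon> dom s"
  shows "obeys x N"
  unfolding follows_def
proof (intro allI impI)
  fix n assume n: "n \<epsilon> N \<and> n \<epsilon> P"
  then obtain s where s: "s \<epsilon> seqs omega" "obeys s (dom s)" "subset s x" "n \<epsilon> dom s" using T by blast
  then show "ap x n = ap S (restrict x n)"
    unfolding prefix_ap[OF s(1) x s(3,4)] prefix_restrict[OF s(1) x s(3,4)]
    using n s(2) unfolding follows_def by blast
qed

lemma legal_union:
  assumes x: "func x N omega"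
    and T: "\<And>n. n \<epsilon> N \<Longrightarrow> \<exists>s. s \<epsilon> seqs omega \<and> legal s (dom s) \<and> subset s x \<and> n \<epsilon> dom s"
  shows "legal x N"
  unfolding legal_def using T prefix_violation[OF _ x] unfolding legal_def by blast

lemma extend:
  assumes s: "s \<epsilon> seqs omega" and m: "m \<epsilon> omega"
  shows extend_seq: "snoc s m \<epsilon> seqs omega"
    and dom_extend: "dom (snoc s m) = succ (dom s)"
    and extend_obeys: "obeys s (dom s) \<Longrightarrow> (dom s \<epsilon> P \<Longrightarrow> m = ap S s) \<Longrightarrow> obeys (snoc s m) (succ (dom s))"
    and extend_legal: "legal s (dom s) \<Longrightarrow> \<not> violation (dom s) (snoc s m) \<Longrightarrow> legal (snoc s m) (succ (dom s))"
    and extend_violation: "n \<epsilon> dom s \<Longrightarrow> violation n (snoc s m) \<longleftrightarrow> violation n s"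
    and extend_subset: "subset s (snoc s m)"
    and extend_neq: "s \<noteq> snoc s m"
proof -
  have d: "dom s \<epsilon> omega" and f: "func s (dom s) omega" using s unfolding mem_seqs by auto
  note sn = snoc[OF d f m]
  show "snoc s m \<epsilon> seqs omega" using seqsI[OF _ sn(1)] d by simp
  show dm: "dom (snoc s m) = succ (dom s)" using dom_func[OF sn(1)] .
  show "subset s (snoc s m)" by (rule sn(4))
  show "s \<noteq> snoc s m" using dm by (metis mem_succ mem_irrefl)
  note pre = prefix[OF s sn(1) sn(4)]
  show "n \<epsilon> dom s \<Longrightarrow> violation n (snoc s m) \<longleftrightarrow> violation n s" by (rule pre(3))
  then show "legal s (dom s) \<Longrightarrow> \<not> violation (dom s) (snoc s m) \<Longrightarrow> legal (snoc s m) (succ (dom s))"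
    using pre(3) unfolding legal_def by auto
  have r: "restrict (snoc s m) (dom s) = s"
    using restrict_subset[OF sn(4) f sn(1), of "dom s"] restrict_self[OF f] by (simp add: subset_def)
  show "obeys (snoc s m) (succ (dom s))"
    if o: "obeys s (dom s)" and P: "dom s \<epsilon> P \<Longrightarrow> m = ap S s"
    unfolding follows_def
  proof (intro allI impI)
    fix n assume n: "n \<epsilon> succ (dom s) \<and> n \<epsilon> P"
    show "ap (snoc s m) n = ap S (restrict (snoc s m) n)"
    proof (cases "n = dom s")
      case True then show ?thesis using sn(2) r P n by simp
    next
      case False
      then have n': "n \<epsilon> dom s" using n by simp
      show ?thesis unfolding pre(1)[OF n'] pre(2)[OF n'] using o n n' unfolding follows_def by blast
    qed
  qed
qed

lemma answer_mem: "s \<epsilon> seqs omega \<Longrightarrow> ap S s \<epsilon> omega"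
  using ap_mem[OF strat] .

lemma complete_to_run:
  assumes "s \<epsilon> seqs omega" "obeys s (dom s)"
  shows "\<exists>x. func x omega omega \<and> subset s x \<and> obeys x omega"
proof -
  define T where "T = Sep (seqs omega) (\<lambda>t. subset s t \<and> obeys t (dom t))"
  have T: "t \<epsilon> T \<longleftrightarrow> t \<epsilon> seqs omega \<and> subset s t \<and> obeys t (dom t)" for t
    unfolding T_def by (rule mem_Sep) (rule dfn_rules)+
  have 1: "s \<epsilon> T" using assms by (simp add: T subset_def)
  have 2: "\<exists>t'. t' \<epsilon> T \<and> subset t t' \<and> t \<noteq> t'" if "t \<epsilon> T" for t
  proof -
    have t: "t \<epsilon> seqs omega" "subset s t" "obeys t (dom t)" using that T by auto
    note e = extend[OF t(1) answer_mem[OF t(1)]]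
    have "snoc t (ap S t) \<epsilon> T"
      unfolding T using e(1,2) e(3)[OF t(3)] e(6) t(2) by (auto simp: subset_def)
    with e(6,7) show ?thesis by blast
  qed
  obtain x where x: "func x omega omega" "\<And>n. n \<epsilon> omega \<Longrightarrow> \<exists>s. s \<epsilon> T \<and> subset s x \<and> n \<epsilon> dom s"
    using run_through_tree[OF _ 1 2, of omega] T by blast
  have "obeys x omega" by (rule obeys_union[OF x(1)]) (use x(2) T in blast)
  moreover have "subset s x" using x(2)[of empty] T unfolding subset_def by (metis empty_omega)
  ultimately show ?thesis using x(1) by blast
qed

text \<open>
  An illegal answer to a legal position would be the first violation in any run that continues the
  position in accordance with the strategy, and by \<open>complete_to_run\<close> there is such a run.
\<close>

lemma answer_legal:
  assumes s: "s \<epsilon> seqs omega" "obeys s (dom s)" "legal s (dom s)" "dom s \<epsilon> P"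
  shows "\<not> violation (dom s) (snoc s (ap S s))"
proof
  assume b: "violation (dom s) (snoc s (ap S s))"
  note e = extend[OF s(1) answer_mem[OF s(1)]]
  have d: "dom s \<epsilon> omega" using s(1) unfolding mem_seqs by blast
  obtain x where x: "func x omega omega" "subset (snoc s (ap S s)) x" "obeys x omega"
    using complete_to_run[OF e(1)] e(3)[OF s(2)] e(2) by auto
  have pb: "violation n x \<longleftrightarrow> violation n (snoc s (ap S s))" if "n \<epsilon> succ (dom s)" for n
    using prefix_violation[OF e(1) x(1,2)] that e(2) by simp
  have "violation (dom s) x" using b pb by simp
  then obtain m where m: "m \<epsilon> dom s" "violation m x"
    using never_violates_first[OF x(1,3) d s(4)] by blast
  then have "violation m s" using pb e(5) by simp
  with m(1) s(3) show False unfolding legal_def by blast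
qed

text \<open>
  By the last two conditions the opponent is to move, and his move is the choice of an interval.
\<close>

definition node :: "'a \<Rightarrow> bool" where
  "node t \<longleftrightarrow> obeys t (dom t) \<and> legal t (dom t) \<and> \<not> dom t \<epsilon> P \<and> late (dom t)"

definition nodes :: 'a where "nodes = Sep (seqs omega) node"

lemma dfn_node [dfn_rules]: "dfnt s \<Longrightarrow> dfn (\<lambda>e. node (s e))"
  by (rule dfn_lift1[where Q = node], unfold node_def) ((rule dfn_rules)+ | assumption)+

lemma mem_nodes: "t \<epsilon> nodes \<longleftrightarrow> t \<epsilon> seqs omega \<and> node t"
  unfolding nodes_def by (rule mem_Sep) (rule dfn_rules)+

text \<open>
  The opponent may move inside the interval \<open>(a,b)\<close> without breaking the rules.
\<close>

definition room :: "'a \<Rightarrow> 'a \<Rightarrow> 'a \<Rightarrow> bool" where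
  "room t a b \<longleftrightarrow> (\<forall>k. k \<epsilon> dom t \<and> late k \<longrightarrow> le (ap lo (ap t k)) a \<and> le b (ap hi (ap t k)))"

lemma dfn_room [dfn_rules]: "dfnt s \<Longrightarrow> dfnt t \<Longrightarrow> dfnt u \<Longrightarrow> dfn (\<lambda>e. room (s e) (t e) (u e))"
  by (rule dfn_lift3[where Q = room], unfold room_def) ((rule dfn_rules)+ | assumption)+

lemma node_ap: "t \<epsilon> nodes \<Longrightarrow> k \<epsilon> dom t \<Longrightarrow> ap t k \<epsilon> omega"
  unfolding mem_nodes mem_seqs using ap_mem by blast

text \<open>
  The opponent can force the play into any interval \<open>(a,b)\<close> that leaves room: he chooses a base interval
  inside it, and the strategy must answer with an interval \<open>(lo m, hi m)\<close> inside his choice.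
\<close>

lemma node_step:
  assumes t: "t \<epsilon> nodes" and room: "room t a b"
    and ab: "a \<epsilon> R" "b \<epsilon> R" "lt a b" "le zer a" "le b on"
  obtains t' m where "t' \<epsilon> nodes" "subset t t'" "t \<noteq> t'" "m \<epsilon> omega"
    "lt a (ap lo m)" "lt (ap hi m) b" "room t' (ap lo m) (ap hi m)"
    "\<exists>k. k \<epsilon> dom t' \<and> late k \<and> lt a (ap lo (ap t' k)) \<and> lt (ap hi (ap t' k)) b"
proof -
  define n where "n = dom t"
  have ts: "t \<epsilon> seqs omega" "obeys t n" "legal t n" "\<not> n \<epsilon> P" "late n" and n: "n \<epsilon> omega"
    using t unfolding mem_nodes node_def n_def mem_seqs by auto
  have tf: "func t n omega" using ts(1) unfolding mem_seqs n_def by blast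
  \<comment> \<open>The opponent chooses \<open>i\<close>, and \<open>m\<close> below is the answer.\<close>
  obtain i where i: "i \<epsilon> omega" "lt a (ap lo i)" "lt (ap hi i) b"
    using base_dense[OF ab(1,2,4,3,5)] .
  define s where "s = snoc t i"
  note e = extend[OF ts(1) i(1), folded s_def n_def]
  have sn: "func s (succ n) omega" "ap s n = i" "\<And>k. k \<epsilon> n \<Longrightarrow> ap s k = ap t k"
    using snoc[OF n tf i(1)] unfolding s_def by auto
  have "\<not> violation n s"
    unfolding violation_def
  proof (intro notI, elim exE conjE)
    fix k assume k: "k \<epsilon> n" "late k" "\<not> nested (ap s k) (ap s n)"
    have tk: "ap t k \<epsilon> omega" using node_ap[OF t] k(1) n_def by simp
    have "le (ap lo (ap t k)) a" "le b (ap hi (ap t k))" using room k unfolding room_def n_def by auto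
    then have "nested (ap t k) i" unfolding nested_def
      using i tk ab le_lt_trans[of "ap lo (ap t k)" a "ap lo i"] lt_le_trans[of "ap hi i" b] by simp
    with k(3) show False using sn k(1) by simp
  qed
  then have sl: "legal s (succ n)" using e(4) ts(3) by simp
  have so: "obeys s (succ n)" using e(3) ts(2,4) by simp
  have sP: "succ n \<epsilon> P" using alternate n ts(4) by blast
  define m where "m = ap S s"
  have m: "m \<epsilon> omega" using answer_mem[OF e(1)] unfolding m_def .
  define t' where "t' = snoc s m"
  note e' = extend[OF e(1) m, unfolded e(2), folded t'_def]
  have sn': "ap t' (succ n) = m" "\<And>k. k \<epsilon> succ n \<Longrightarrow> ap t' k = ap s k"
    using snoc[OF _ sn(1) m] n unfolding t'_def by auto
  have nb: "\<not> violation (succ n) t'"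
    using answer_legal[OF e(1)] so sl sP unfolding e(2) t'_def m_def by simp
  then have ne: "nested (ap t' k) m" if "k \<epsilon> succ n" "late k" for k
    using that unfolding violation_def sn'(1) by blast
  have "nested i m" using ne[of n] ts(5) sn'(2)[of n] sn(2) by simp
  then have im: "lt (ap lo i) (ap lo m)" "lt (ap hi m) (ap hi i)" unfolding nested_def by auto
  have tn: "t' \<epsilon> nodes"
    unfolding mem_nodes node_def e'(2)
  proof (intro conjI)
    show "obeys t' (succ (succ n))" using e'(3) so m_def by simp
    show "legal t' (succ (succ n))" using e'(4) sl nb by simp
    show "\<not> succ (succ n) \<epsilon> P" using alternate[of "succ n"] n sP by simp
    show "late (succ (succ n))" unfolding late_def using succ_inj n
      by (metis mem_empty mem_succ empty_omega succ_omega)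
  qed (rule e'(1))
  have r: "room t' (ap lo m) (ap hi m)"
    unfolding room_def e'(2)
  proof (intro allI impI)
    fix k assume k: "k \<epsilon> succ (succ n) \<and> late k"
    show "le (ap lo (ap t' k)) (ap lo m) \<and> le (ap hi m) (ap hi (ap t' k))"
    proof (cases "k = succ n")
      case True then show ?thesis by (simp add: sn'(1))
    next
      case False
      then show ?thesis using ne[of k] k unfolding nested_def by (simp add: lt_imp_le)
    qed
  qed
  show thesis
  proof (rule that[OF tn _ _ m _ _ r])
    show "subset t t'" using e(6) e'(6) unfolding subset_def by blast
    show "t \<noteq> t'" using e'(2) n_def by (metis mem_succ mem_irrefl e(2))
    show "lt a (ap lo m)" using lt_trans[OF i(2) im(1)] ab i m by simp
    show "lt (ap hi m) b" using lt_trans[OF im(2) i(3)] ab i m by simp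
    show "\<exists>k. k \<epsilon> dom t' \<and> late k \<and> lt a (ap lo (ap t' k)) \<and> lt (ap hi (ap t' k)) b"
      using i ts(5) sn'(2)[of n] sn(2) unfolding e'(2) by (intro exI[of _ n]) simp
  qed
qed

lemma room_mono:
  assumes t: "t \<epsilon> nodes" and room: "room t a b" and "le a a'" "le b' b"
    and R: "a \<epsilon> R" "b \<epsilon> R" "a' \<epsilon> R" "b' \<epsilon> R"
  shows "room t a' b'"
  unfolding room_def
proof (intro allI impI)
  fix k assume k: "k \<epsilon> dom t \<and> late k"
  then have "ap t k \<epsilon> omega" using node_ap[OF t] by blast
  moreover have "le (ap lo (ap t k)) a" "le b (ap hi (ap t k))" using room k unfolding room_def by auto
  ultimately show "le (ap lo (ap t k)) a' \<and> le b' (ap hi (ap t k))"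
    using le_trans[of "ap lo (ap t k)" a a'] le_trans[of b' b "ap hi (ap t k)"] assms by simp
qed

text \<open>
  Countably many games, numbered by \<open>w\<close>, are played against the strategy simultaneously, all steered by
  the same shrinking interval \<open>(a,b)\<close>: game \<open>w\<close> is played inside its translate by \<open>\<delta> w\<close>.  One stage of the
  construction serves one game.  The opponent moves inside the translated interval, the strategy
  answers with a smaller interval, and the answer, translated back, becomes the new \<open>(a,b)\<close>.  The other
  games keep their positions, since the interval only shrinks.  Each game is served infinitely often
  and so grows into an infinite run, and the point \<open>y\<close> common to all intervals \<open>(a,b)\<close> has its translates
  captured by these runs.
  
  The runs capture no other real if the intervals \<open>(a,b)\<close> have no other point in common.  For this, a
  stage that serves game \<open>w\<close> first shrinks \<open>(a,b)\<close> so that it does not contain the base interval with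
  code \<open>w\<close>; two common points would have a base interval between them.
\<close>

theorem generic_point:
  assumes \<delta>: "func \<delta> omega R" and \<rho>: "func \<rho> omega nodes"
    and ab0: "a0 \<epsilon> R" "b0 \<epsilon> R" "lt a0 b0" "le zer a0" "le b0 on"
    and \<delta>0: "\<And>w. w \<epsilon> omega \<Longrightarrow> le zer (add a0 (ap \<delta> w))"
    and \<delta>1: "\<And>w. w \<epsilon> omega \<Longrightarrow> le (add b0 (ap \<delta> w)) on"
    and room0: "\<And>w. w \<epsilon> omega \<Longrightarrow> room (ap \<rho> w) (add a0 (ap \<delta> w)) (add b0 (ap \<delta> w))"
  shows "\<exists>y. y \<epsilon> R \<and> (\<forall>w. w \<epsilon> omega \<longrightarrow> (\<exists>x. func x omega omega \<and> obeys x omega \<and>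
      legal x omega \<and> subset (ap \<rho> w) x \<and>
      (\<forall>z. z \<epsilon> R \<longrightarrow> captures x z \<longleftrightarrow> z = add y (ap \<delta> w))))"
proof -
  obtain g where gf: "func g omega (cart omega omega)"
    and gio: "\<And>m y. m \<epsilon> omega \<Longrightarrow> y \<epsilon> omega \<Longrightarrow> \<exists>n. n \<epsilon> omega \<and> m \<epsilon> n \<and> psnd (ap g n) = y"
    using pair_enumeration by (elim exE conjE) blast
  \<comment> \<open>A state consists of the endpoints \<open>L\<close>, \<open>U\<close> of the current interval and the function \<open>H\<close> that
      assigns to each game its position.  The number of the game served at stage \<open>n\<close>, also used as
      code of the base interval to be excluded, is \<open>psnd (ap g n)\<close>.\<close>
  define L where "L s = pfst (pfst s)" for s
  define U where "U s = psnd (pfst s)" for s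
  define H where "H s = psnd s" for s
  have [simp]: "L (pair (pair a b) h) = a" "U (pair (pair a b) h) = b" "H (pair (pair a b) h) = h" for a b h
    by (simp_all add: L_def U_def H_def)
  define ok where "ok s \<longleftrightarrow> lt (L s) (U s) \<and> le a0 (L s) \<and> le (U s) b0 \<and>
    (\<forall>w. w \<epsilon> omega \<longrightarrow> room (ap (H s) w) (add (L s) (ap \<delta> w)) (add (U s) (ap \<delta> w)))" for s
  define A where "A = Sep (cart (cart R R) (funs omega nodes)) ok"
  have "s \<epsilon> A \<longleftrightarrow> s \<epsilon> cart (cart R R) (funs omega nodes) \<and> ok s" for s
    unfolding A_def by (rule mem_Sep, unfold ok_def L_def U_def H_def) (rule dfn_rules)+
  then have A: "s \<epsilon> A \<longleftrightarrow> (\<exists>a b h. s = pair (pair a b) h \<and> a \<epsilon> R \<and> b \<epsilon> R \<and> func h omega nodes \<and> ok s)" for s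
    by (auto simp: mem_cart)
  define adv where "adv n s s' \<longleftrightarrow>
    lt (L s) (L s') \<and> lt (U s') (U s) \<and>
    \<not> (lt (L s') (ap lo (psnd (ap g n))) \<and> lt (ap hi (psnd (ap g n))) (U s')) \<and>
    (\<forall>v. v \<epsilon> omega \<longrightarrow> subset (ap (H s) v) (ap (H s') v)) \<and>
    ap (H s) (psnd (ap g n)) \<noteq> ap (H s') (psnd (ap g n)) \<and>
    (\<exists>k. k \<epsilon> dom (ap (H s') (psnd (ap g n))) \<and> late k \<and>
      lt (add (L s) (ap \<delta> (psnd (ap g n)))) (ap lo (ap (ap (H s') (psnd (ap g n))) k)) \<and>
      lt (ap hi (ap (ap (H s') (psnd (ap g n))) k)) (add (U s) (ap \<delta> (psnd (ap g n)))))" for n s s'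
  have \<delta>R [simp]: "ap \<delta> w \<epsilon> R" if "w \<epsilon> omega" for w using ap_mem[OF \<delta> that] .
  define s0 where "s0 = pair (pair a0 b0) \<rho>"
  have s0: "s0 \<epsilon> A" unfolding A s0_def ok_def using ab0 room0 \<rho> by (simp add: le_def)
  have step: "\<exists>s'. s' \<epsilon> A \<and> adv n s s'" if n: "n \<epsilon> omega" and s: "s \<epsilon> A" for n s
  proof -
    obtain a b h where s_eq: "s = pair (pair a b) h" and ab: "a \<epsilon> R" "b \<epsilon> R" and h: "func h omega nodes"
      and ok: "ok s" using s A by blast
    have ok': "lt a b" "le a0 a" "le b b0"
      "\<And>w. w \<epsilon> omega \<Longrightarrow> room (ap h w) (add a (ap \<delta> w)) (add b (ap \<delta> w))"
      using ok unfolding ok_def s_eq by auto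
    define w where "w = psnd (ap g n)"
    have w: "w \<epsilon> omega" using ap_mem[OF gf n] unfolding w_def by (auto simp: mem_cart)
    \<comment> \<open>Cutting off everything to the right of \<open>lo w\<close>, if that leaves an interval, excludes base interval \<open>w\<close>.\<close>
    obtain b1 where b1: "b1 \<epsilon> R" "lt a b1" "le b1 b" "\<not> (lt a (ap lo w) \<and> lt (ap hi w) b1)"
    proof (cases "lt a (ap lo w) \<and> lt (ap lo w) b")
      case True
      then show thesis
        using that[of "ap lo w"] w base_bounds(2)[OF w] lt_trans[of "ap lo w" "ap hi w" "ap lo w"]
        by (auto simp: lt_imp_le)
    next
      case False
      then show thesis
        using that[of b] ab ok'(1) w base_bounds(2)[OF w] lt_trans[of "ap lo w" "ap hi w" b] by auto
    qed
    let ?d = "ap \<delta> w"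
    have d: "?d \<epsilon> R" using w by simp
    have t: "ap h w \<epsilon> nodes" using ap_mem[OF h w] .
    have b1b: "le (add b1 ?d) (add b ?d)" using b1 ab d by simp
    have "room (ap h w) (add a ?d) (add b1 ?d)"
      using room_mono[OF t ok'(4)[OF w] _ b1b] ab b1(1) d by simp
    moreover have "lt (add a ?d) (add b1 ?d)" using b1 ab d by simp
    moreover have "le zer (add a ?d)"
      using \<delta>0[OF w] ok'(2) ab ab0 d le_trans[of zer "add a0 ?d" "add a ?d"] by simp
    moreover have "le (add b1 ?d) on"
      using \<delta>1[OF w] ok'(3) b1 ab ab0 d le_trans[of "add b1 ?d" "add b ?d" on]
        le_trans[of "add b ?d" "add b0 ?d" on] by simp
    ultimately obtain t' m where t': "t' \<epsilon> nodes" "subset (ap h w) t'" "ap h w \<noteq> t'" and m: "m \<epsilon> omega"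
      "lt (add a ?d) (ap lo m)" "lt (ap hi m) (add b1 ?d)" and room': "room t' (ap lo m) (ap hi m)"
      and k: "\<exists>k. k \<epsilon> dom t' \<and> late k \<and> lt (add a ?d) (ap lo (ap t' k)) \<and> lt (ap hi (ap t' k)) (add b1 ?d)"
      using node_step[OF t, of "add a ?d" "add b1 ?d"] ab b1(1) d add_mem by metis
    obtain a' where a': "a' \<epsilon> R" "add a' ?d = ap lo m" using difference[OF d lo_mem[OF m(1)]] add_comm d by metis
    obtain b' where b': "b' \<epsilon> R" "add b' ?d = ap hi m" using difference[OF d hi_mem[OF m(1)]] add_comm d by metis
    have aa: "lt a a'" using m(2) a' ab d lt_add_iff by metis
    have bb1: "lt b' b1" using m(3) b' b1(1) d lt_add_iff by metis
    have bb: "lt b' b" using lt_le_trans[OF bb1 b1(3)] b' b1 ab by blast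
    have a'b': "lt a' b'" using base_bounds(2)[OF m(1)] a' b' d lt_add_iff by metis
    define h' where "h' = lam omega nodes (\<lambda>v. if v = w then t' else ap h v)"
    have h'1: "dfnt (\<lambda>e. if e 0 = w then t' else ap h (e 0))" by (rule dfn_rules)+
    have h'2: "(if v = w then t' else ap h v) \<epsilon> nodes" if "v \<epsilon> omega" for v
      using ap_mem[OF h that] t'(1) by simp
    have h'3: "func h' omega nodes"
      unfolding h'_def by (rule func_lam[OF h'1]) (rule h'2)
    have h'4: "ap h' v = (if v = w then t' else ap h v)" if "v \<epsilon> omega" for v
      unfolding h'_def by (rule ap_lam[OF h'1 _ that]) (rule h'2)
    note h' = h'3 h'4
    define s' where "s' = pair (pair a' b') h'"
    have rooms: "room (ap h' v) (add a' (ap \<delta> v)) (add b' (ap \<delta> v))" if v: "v \<epsilon> omega" for v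
    proof (cases "v = w")
      case True then show ?thesis using room' a' b' h' w by simp
    next
      case False
      have "le (add a (ap \<delta> v)) (add a' (ap \<delta> v))" "le (add b' (ap \<delta> v)) (add b (ap \<delta> v))"
        using aa bb a' b' ab v by (simp_all add: lt_imp_le)
      then have "room (ap h v) (add a' (ap \<delta> v)) (add b' (ap \<delta> v))"
        using room_mono[OF ap_mem[OF h v] ok'(4)[OF v]] a' b' ab v by simp
      with False show ?thesis using h'(2)[OF v] by simp
    qed
    have "le a0 a'" "le b' b0"
      using le_trans[OF ok'(2) lt_imp_le[OF aa]] le_trans[OF lt_imp_le[OF bb] ok'(3)] ab a' b' ab0 by blast+
    then have "s' \<epsilon> A" unfolding A s'_def ok_def using a' b' a'b' h'(1) rooms by simp
    moreover have "adv n s s'"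
    proof -
      have S: "L s = a" "U s = b" "H s = h" "L s' = a'" "U s' = b'" "H s' = h'"
        by (simp_all add: s_eq s'_def)
      have hw: "ap h' w = t'" using h'(2)[OF w] by simp
      obtain k where k: "k \<epsilon> dom t'" "late k" "lt (add a ?d) (ap lo (ap t' k))"
          "lt (ap hi (ap t' k)) (add b1 ?d)"
        using k by blast
      have kb: "lt (ap hi (ap t' k)) (add b ?d)"
        using lt_le_trans[OF k(4) b1b] node_ap[OF t'(1) k(1)] b1(1) ab d by simp
      have gap: "\<not> (lt a' (ap lo w) \<and> lt (ap hi w) b')"
        using b1(4) lt_trans[OF aa, of "ap lo w"] lt_trans[OF _ bb1, of "ap hi w"] a'(1) b'(1) ab b1(1) w
        by auto
      have sub: "subset (ap h v) (ap h' v)" if "v \<epsilon> omega" for v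
        using h'(2)[OF that] t'(2) by (simp add: subset_def)
      show ?thesis
        unfolding adv_def S w_def[symmetric] hw using aa bb gap sub t'(3) k(1-3) kb by blast
    qed
    ultimately show ?thesis by blast
  qed
  have "\<exists>f. func f omega A \<and> ap f empty = s0 \<and> (\<forall>n. n \<epsilon> omega \<longrightarrow> adv n (ap f n) (ap f (succ n)))"
  proof (rule dependent_choice_from[OF _ s0 step])
    show "dfn (\<lambda>e. adv (e 0) (e (Suc 0)) (e (Suc (Suc 0))))"
      unfolding adv_def L_def U_def H_def by (rule dfn_rules)+
  qed
  then obtain f where f: "func f omega A" "ap f empty = s0"
    "\<And>n. n \<epsilon> omega \<Longrightarrow> adv n (ap f n) (ap f (succ n))" by blast
  define a where "a n = L (ap f n)" for n
  define b where "b n = U (ap f n)" for n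
  define h where "h n = ap (H (ap f n))" for n
  have dfn_a [dfn_rules]: "dfnt s \<Longrightarrow> dfnt (\<lambda>e. a (s e))" for s
    unfolding a_def L_def by ((rule dfn_rules)+ | assumption)+
  have dfn_b [dfn_rules]: "dfnt s \<Longrightarrow> dfnt (\<lambda>e. b (s e))" for s
    unfolding b_def U_def by ((rule dfn_rules)+ | assumption)+
  have dfn_h [dfn_rules]: "dfnt s \<Longrightarrow> dfnt t \<Longrightarrow> dfnt (\<lambda>e. h (s e) (t e))" for s t
    unfolding h_def H_def by ((rule dfn_rules)+ | assumption)+
  have st: "a n \<epsilon> R" "b n \<epsilon> R" "lt (a n) (b n)" "le a0 (a n)" "le (b n) b0"
    "\<And>w. w \<epsilon> omega \<Longrightarrow> h n w \<epsilon> nodes"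
    "\<And>w. w \<epsilon> omega \<Longrightarrow> room (h n w) (add (a n) (ap \<delta> w)) (add (b n) (ap \<delta> w))" if "n \<epsilon> omega" for n
  proof -
    have "ap f n \<epsilon> A" using ap_mem[OF f(1) that] .
    then obtain a' b' h' where *: "ap f n = pair (pair a' b') h'" "a' \<epsilon> R" "b' \<epsilon> R" "func h' omega nodes" "ok (ap f n)"
      using A by blast
    show "a n \<epsilon> R" "b n \<epsilon> R" "lt (a n) (b n)" "le a0 (a n)" "le (b n) b0"
      "\<And>w. w \<epsilon> omega \<Longrightarrow> h n w \<epsilon> nodes"
      "\<And>w. w \<epsilon> omega \<Longrightarrow> room (h n w) (add (a n) (ap \<delta> w)) (add (b n) (ap \<delta> w))"
      using * ap_mem[OF *(4)] unfolding a_def b_def h_def ok_def by auto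
  qed
  have h0: "h empty w = ap \<rho> w" for w unfolding h_def f(2) s0_def by simp
  have mono: "lt (a m) (a n)" "lt (b n) (b m)" "\<And>v. v \<epsilon> omega \<Longrightarrow> subset (h m v) (h n v)"
    if "n \<epsilon> omega" "m \<epsilon> n" for m n
  proof -
    have "\<forall>m. m \<epsilon> n \<longrightarrow> lt (a m) (a n) \<and> lt (b n) (b m) \<and> (\<forall>v. v \<epsilon> omega \<longrightarrow> subset (h m v) (h n v))"
      using that(1)
    proof (induction rule: omega_induct)
      case dfn show ?case by (rule dfn_rules)+
    next
      case (succ n)
      have 1: "lt (a n) (a (succ n))" "lt (b (succ n)) (b n)" "\<And>v. v \<epsilon> omega \<Longrightarrow> subset (h n v) (h (succ n) v)"
        using f(3)[OF succ.hyps] unfolding adv_def a_def b_def h_def by auto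
      show ?case
      proof (intro allI impI)
        fix m assume m: "m \<epsilon> succ n"
        show "lt (a m) (a (succ n)) \<and> lt (b (succ n)) (b m) \<and> (\<forall>v. v \<epsilon> omega \<longrightarrow> subset (h m v) (h (succ n) v))"
        proof (cases "m = n")
          case True with 1 show ?thesis by blast
        next
          case False
          then have mn: "m \<epsilon> n" using m by simp
          have mo: "m \<epsilon> omega" using omega_trans[OF mn succ.hyps] .
          have "lt (a m) (a (succ n))" using lt_trans[of "a m" "a n" "a (succ n)"] succ mn 1 st(1) mo by simp
          moreover have "lt (b (succ n)) (b m)" using lt_trans[of "b (succ n)" "b n" "b m"] succ mn 1 st(2) mo by simp
          moreover have "subset (h m v) (h (succ n) v)" if "v \<epsilon> omega" for v
            using 1(3)[OF that] succ.IH mn that unfolding subset_def by blast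
          ultimately show ?thesis by blast
        qed
      qed
    qed simp
    with that show "lt (a m) (a n)" "lt (b n) (b m)" "\<And>v. v \<epsilon> omega \<Longrightarrow> subset (h m v) (h n v)" by blast+
  qed
  have cross: "lt (a m) (b n)" if mn: "m \<epsilon> omega" "n \<epsilon> omega" for m n
    using omega_linear[OF mn] mono[OF mn(1), of n] mono[OF mn(2), of m] st(1-3)[OF mn(1)] st(1-3)[OF mn(2)]
      lt_trans[of "a m" "b m" "b n"] lt_trans[of "a m" "a n" "b n"] by auto
  define D where "D = Sep R (\<lambda>z. \<exists>n. n \<epsilon> omega \<and> z = a n)"
  have D: "z \<epsilon> D \<longleftrightarrow> z \<epsilon> R \<and> (\<exists>n. n \<epsilon> omega \<and> z = a n)" for z
    unfolding D_def by (rule mem_Sep) (rule dfn_rules)+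
  have "subset D R" by (simp add: subset_def D)
  moreover have "a empty \<epsilon> D" using st(1)[OF empty_omega] empty_omega D by blast
  moreover have "b empty \<epsilon> R" using st(2) by simp
  moreover have "le x (b empty)" if "x \<epsilon> D" for x using that cross by (auto simp: D lt_imp_le)
  ultimately have "\<exists>y. y \<epsilon> R \<and> (\<forall>x. x \<epsilon> D \<longrightarrow> le x y) \<and>
      (\<forall>b. b \<epsilon> R \<and> (\<forall>x. x \<epsilon> D \<longrightarrow> le x b) \<longrightarrow> le y b)"
    using supremum[of D "a empty" "b empty"] by metis
  then obtain y where y: "y \<epsilon> R" "\<And>x. x \<epsilon> D \<Longrightarrow> le x y"
      "\<And>b. b \<epsilon> R \<Longrightarrow> (\<And>x. x \<epsilon> D \<Longrightarrow> le x b) \<Longrightarrow> le y b"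
    by (elim exE conjE) simp
  have ay: "lt (a n) y" if n: "n \<epsilon> omega" for n
  proof -
    have "a (succ n) \<epsilon> D" using D st(1)[of "succ n"] n succ_omega by blast
    then have "le (a (succ n)) y" by (rule y(2))
    then show ?thesis using lt_le_trans[of "a n" "a (succ n)" y] mono(1)[of "succ n" n] n st(1) y by simp
  qed
  have yb: "lt y (b n)" if n: "n \<epsilon> omega" for n
  proof -
    have "le y (b (succ n))" by (rule y(3)) (use n st(2) cross in \<open>auto simp: D lt_imp_le\<close>)
    then show ?thesis using le_lt_trans[of y "b (succ n)" "b n"] mono(2)[of "succ n" n] n st(2) y by simp
  qed
  \<comment> \<open>Two points \<open>c\<close>, \<open>d\<close> common to all intervals have a base interval \<open>w\<close> between them, which was
      excluded when game \<open>w\<close> was served.\<close>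
  have no_gap: False if cd: "lt c d" "c \<epsilon> R" "d \<epsilon> R"
    and c: "\<And>n. n \<epsilon> omega \<Longrightarrow> lt (a n) c" and d: "\<And>n. n \<epsilon> omega \<Longrightarrow> lt d (b n)" for c d
  proof -
    have "le zer c"
      using le_trans[OF ab0(4) st(4)[of empty]] c[of empty]
       le_trans[of zer "a empty" c] st(1)[of empty] ab0 cd by (simp add: lt_imp_le)
    moreover have "le d on"
      using le_trans[OF st(5)[of empty] ab0(5)] d[of empty]
       le_trans[of d "b empty" on] st(2)[of empty] ab0 cd by (simp add: lt_imp_le)
    ultimately obtain w where w: "w \<epsilon> omega" "lt c (ap lo w)" "lt (ap hi w) d"
      using base_dense[OF cd(2,3) _ cd(1)] by blast
    obtain n where n: "n \<epsilon> omega" "psnd (ap g n) = w" using gio[OF empty_omega w(1)] by blast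
    have "\<not> (lt (a (succ n)) (ap lo w) \<and> lt (ap hi w) (b (succ n)))"
      using f(3)[OF n(1)] n(2) unfolding adv_def a_def b_def by auto
    moreover have "lt (a (succ n)) (ap lo w)"
      using lt_trans[OF c[of "succ n"] w(2)] st(1)[of "succ n"] n cd w by simp
    moreover have "lt (ap hi w) (b (succ n))"
      using lt_trans[OF w(3) d[of "succ n"]] st(2)[of "succ n"] n cd w by simp
    ultimately show False by blast
  qed
  have "\<exists>x. func x omega omega \<and> obeys x omega \<and> legal x omega \<and> subset (ap \<rho> w) x \<and>
      (\<forall>z. z \<epsilon> R \<longrightarrow> captures x z \<longleftrightarrow> z = add y (ap \<delta> w))" if w: "w \<epsilon> omega" for w
  proof -
    let ?d = "ap \<delta> w"
    have d: "?d \<epsilon> R" using w by simp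
    define T where "T = Sep nodes (\<lambda>t. \<exists>n. n \<epsilon> omega \<and> t = h n w)"
    have "t \<epsilon> T \<longleftrightarrow> t \<epsilon> nodes \<and> (\<exists>n. n \<epsilon> omega \<and> t = h n w)" for t
      unfolding T_def by (rule mem_Sep) (rule dfn_rules)+
    then have T: "t \<epsilon> T \<longleftrightarrow> (\<exists>n. n \<epsilon> omega \<and> t = h n w)" for t using st(6) w by blast
    have hm: "subset (h m w) (h n w)" if "n \<epsilon> omega" "m \<epsilon> n \<or> m = n" for m n
      using mono(3)[OF that(1) _ w] that(2) by (auto simp: subset_def)
    have 1: "h empty w \<epsilon> T" using T empty_omega by blast
    have 2: "\<exists>t'. t' \<epsilon> T \<and> subset t t' \<and> t \<noteq> t'" if t: "t \<epsilon> T" for t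
    proof -
      obtain n where n: "n \<epsilon> omega" "t = h n w" using t T by blast
      obtain m where m: "m \<epsilon> omega" "n \<epsilon> m" "psnd (ap g m) = w" using gio[OF n(1) w] by blast
      have s1: "subset t (h m w)" using hm m n by blast
      have s2: "subset (h m w) (h (succ m) w)" "h m w \<noteq> h (succ m) w"
        using hm[of "succ m" m] m f(3)[OF m(1)] unfolding adv_def h_def by auto
      have "t \<noteq> h (succ m) w" 
        using s1 s2 ext[of "h m w" "h (succ m) w"] unfolding subset_def by blast
      moreover have "subset t (h (succ m) w)" using s1 s2 unfolding subset_def by blast
      ultimately show ?thesis using T m succ_omega by blast
    qed
    have Tn: "t \<epsilon> seqs omega" "obeys t (dom t)" "legal t (dom t)" if "t \<epsilon> T" for t
      using that T st(6)[OF _ w] unfolding mem_nodes node_def by auto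
    obtain x where x: "func x omega omega" "\<And>n. n \<epsilon> omega \<Longrightarrow> \<exists>s. s \<epsilon> T \<and> subset s x \<and> n \<epsilon> dom s"
      using run_through_tree[OF Tn(1) 1 2] by blast
    have xo: "obeys x omega" by (rule obeys_union[OF x(1)]) (use x(2) Tn in blast)
    have xl: "legal x omega" by (rule legal_union[OF x(1)]) (use x(2) Tn in blast)
    \<comment> \<open>The branch \<open>x\<close> passes through all positions \<open>h n w\<close>: it passes through arbitrarily long ones,
        and any two of them are comparable.\<close>
    have xh: "subset (h n w) x" if n: "n \<epsilon> omega" for n
    proof -
      have "h n w \<epsilon> T" using T n by blast
      then have hd: "dom (h n w) \<epsilon> omega" using Tn(1) mem_seqs by blast
      obtain s where s: "s \<epsilon> T" "subset s x" "dom (h n w) \<epsilon> dom s"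
        using x(2)[OF hd] by (elim exE conjE)
      obtain m where m: "m \<epsilon> omega" "s = h m w" using s(1) unfolding T by (elim exE conjE)
      have "n \<epsilon> m"
      proof (rule ccontr)
        assume "\<not> n \<epsilon> m"
        then have "subset s (h n w)" using hm[OF n] omega_linear[OF m(1) n] m(2) by blast
        then have "dom (h n w) \<epsilon> dom (h n w)" using s(3) unfolding mem_dom subset_def by blast
        then show False by simp
      qed
      then show ?thesis using hm[OF m(1), of n] s(2) m(2) unfolding subset_def by blast
    qed
    have xap: "ap x k = ap (h n w) k" if "n \<epsilon> omega" "k \<epsilon> dom (h n w)" for n k
    proof -
      have "h n w \<epsilon> T" using T that(1) by blast
      from prefix_ap[OF Tn(1)[OF this] x(1) xh[OF that(1)] that(2)] show ?thesis .
    qed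
    have xk: "ap x k \<epsilon> omega" if "k \<epsilon> omega" for k using ap_mem[OF x(1) that] .
    have inside: "lt (ap lo (ap x k)) (add y ?d) \<and> lt (add y ?d) (ap hi (ap x k))"
      if k: "k \<epsilon> omega" "late k" for k
    proof -
      obtain s where s: "s \<epsilon> T" "k \<epsilon> dom s" using x(2)[OF k(1)] by (elim exE conjE)
      then obtain n where n: "n \<epsilon> omega" "k \<epsilon> dom (h n w)" by (auto simp only: T)
      have "le (ap lo (ap x k)) (add (a n) ?d)" "le (add (b n) ?d) (ap hi (ap x k))"
        using st(7)[OF n(1) w] n(2) k(2) unfolding room_def xap[OF n] by blast+
      moreover have "lt (add (a n) ?d) (add y ?d)" "lt (add y ?d) (add (b n) ?d)"
        using ay yb n y(1) d st(1,2) by auto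
      ultimately show ?thesis
        using le_lt_trans[of "ap lo (ap x k)" "add (a n) ?d" "add y ?d"]
          lt_le_trans[of "add y ?d" "add (b n) ?d" "ap hi (ap x k)"] xk[OF k(1)] y(1) d st(1,2)[OF n(1)]
        by simp
    qed
    have unique: "z = add y ?d" if z: "z \<epsilon> R"
      and zin: "\<And>k. k \<epsilon> omega \<Longrightarrow> late k \<Longrightarrow> lt (ap lo (ap x k)) z \<and> lt z (ap hi (ap x k))" for z
    proof -
      obtain c where c: "c \<epsilon> R" "add c ?d = z" using difference[OF d z] add_comm d by metis
      \<comment> \<open>When game \<open>w\<close> is served after stage \<open>n\<close>, its run enters the translate of the current interval
          and cannot capture a real outside that translate.\<close>
      have ca: "lt (a n) c \<and> lt c (b n)" if n: "n \<epsilon> omega" for n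
      proof -
        obtain m where m: "m \<epsilon> omega" "n \<epsilon> m" "psnd (ap g m) = w" using gio[OF n w] by blast
        obtain k where k: "k \<epsilon> dom (h (succ m) w)" "late k"
          "lt (add (a m) ?d) (ap lo (ap (h (succ m) w) k))"
          "lt (ap hi (ap (h (succ m) w) k)) (add (b m) ?d)"
          using f(3)[OF m(1)] m(3) unfolding adv_def h_def a_def b_def by auto
        have sm: "succ m \<epsilon> omega" using m by simp
        have "h (succ m) w \<epsilon> T" using T sm by blast
        then have ko: "k \<epsilon> omega" using k(1) Tn(1) omega_trans mem_seqs by blast
        have e: "ap (h (succ m) w) k = ap x k" using xap[OF sm k(1)] by simp
        have "lt (add (a m) ?d) z" "lt z (add (b m) ?d)"
          using k(3,4) zin[OF ko k(2)] lt_trans[of "add (a m) ?d" "ap lo (ap x k)" z]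
            lt_trans[of z "ap hi (ap x k)" "add (b m) ?d"] st(1,2)[OF m(1)] d z xk[OF ko] unfolding e by auto
        then have "lt (a m) c" "lt c (b m)" using c d st(1,2)[OF m(1)] lt_add_iff by metis+
        then show ?thesis
          using mono(1,2)[OF m(1,2)] lt_trans[of "a n" "a m" c] lt_trans[of c "b m" "b n"]
            st(1,2)[OF m(1)] st(1,2)[OF n] c by auto
      qed
      have "c = y" using lt_total[OF c(1) y(1)] no_gap[of c y] no_gap[of y c] ca ay yb c y(1) by blast
      with c show ?thesis by simp
    qed
    have "subset (ap \<rho> w) x" using xh[of empty] h0 by simp
    moreover have "add y ?d \<epsilon> R" using y d by simp
    ultimately show ?thesis using x(1) xo xl inside unique unfolding captures_def by blast
  qed
  with y(1) show ?thesis by blast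
qed

end

section \<open>The game of a colouring\<close>

lemma (in zf_dc) even_set_exists:
  "\<exists>E. empty \<epsilon> E \<and> (\<forall>m. m \<epsilon> omega \<longrightarrow> (succ m \<epsilon> E \<longleftrightarrow> \<not> m \<epsilon> E))"
proof -
  define B where "B = upair empty (succ empty)"
  have "\<exists>f. func f omega B \<and> ap f empty = empty \<and> (\<forall>n. n \<epsilon> omega \<longrightarrow> ap f (succ n) \<noteq> ap f n)"
  proof (rule dependent_choice_from[where P = "\<lambda>n x y. y \<noteq> x"])
    show "dfn (\<lambda>e. e (Suc (Suc 0)) \<noteq> e (Suc 0))" by (rule dfn_rules)+
    show "empty \<epsilon> B" by (simp add: B_def)
    show "\<exists>y. y \<epsilon> B \<and> y \<noteq> x" if "x \<epsilon> B" for x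
      using mem_succ[of empty empty] mem_empty unfolding B_def mem_upair by metis
  qed
  then obtain f where f: "func f omega B" "ap f empty = empty"
    "\<And>n. n \<epsilon> omega \<Longrightarrow> ap f (succ n) \<noteq> ap f n" by blast
  define E where "E = Sep omega (\<lambda>n. ap f n = empty)"
  have E: "n \<epsilon> E \<longleftrightarrow> n \<epsilon> omega \<and> ap f n = empty" for n
    unfolding E_def by (rule mem_Sep) (rule dfn_rules)+
  have "succ m \<epsilon> E \<longleftrightarrow> \<not> m \<epsilon> E" if "m \<epsilon> omega" for m
    using f(3)[OF that] ap_mem[OF f(1) that] ap_mem[OF f(1) succ_omega[OF that]] that
    unfolding E B_def by auto
  moreover have "empty \<epsilon> E" using f(2) by (simp add: E)
  ultimately show ?thesis by blast
qed

lemma (in zf_dc) even_stage_iff: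
  assumes E: "empty \<epsilon> E" "\<And>m. m \<epsilon> omega \<Longrightarrow> succ m \<epsilon> E \<longleftrightarrow> \<not> m \<epsilon> E" and n: "n \<epsilon> omega"
  shows "even_stage n \<longleftrightarrow> n \<epsilon> E"
proof
  assume "even_stage n"
  then obtain e where e: "empty \<epsilon> e" "\<And>m. m \<epsilon> omega \<Longrightarrow> succ m \<epsilon> e \<longleftrightarrow> \<not> m \<epsilon> e" "n \<epsilon> e"
    unfolding even_stage_def by blast
  have "n \<epsilon> e \<longleftrightarrow> n \<epsilon> E" using n
  proof (induction rule: omega_induct)
    case dfn show ?case by (rule dfn_rules)+
  qed (use e E in auto)
  with e show "n \<epsilon> E" by simp
next
  assume "n \<epsilon> E" with E n show "even_stage n" unfolding even_stage_def by blast
qed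

lemma (in zf_model) restrict_run:
  assumes x: "func x omega B" and n: "n \<epsilon> omega" shows "restrict x n \<epsilon> seqs B"
proof (rule seqsI[OF n], rule funcI)
  show "\<exists>k y. p = pair k y \<and> k \<epsilon> n \<and> y \<epsilon> B" if "p \<epsilon> restrict x n" for p
    using that func_mem[OF x, of p] ap_mem[OF x] unfolding mem_restrict by auto
  show "\<exists>y. pair k y \<epsilon> restrict x n" if "k \<epsilon> n" for k
    using that func_pair_iff[OF x, of k] omega_trans[OF that n] unfolding mem_restrict by auto
  show "y = z" if "pair k y \<epsilon> restrict x n" "pair k z \<epsilon> restrict x n" for k y z
    using that func_pair_iff[OF x, of k] unfolding mem_restrict by auto
qed

lemma (in interval_game) early_no_violation: "n \<epsilon> succ (succ (succ empty)) \<Longrightarrow> \<not> violation n x"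
  unfolding violation_def late_def by auto

lemma (in interval_game) late_two: "late (succ (succ empty))"
  and late_three: "late (succ (succ (succ empty)))"
  unfolding late_def by (metis mem_empty mem_succ empty_omega succ_omega succ_inj)+

lemma (in zf_model) empty_seq: "empty \<epsilon> seqs B" "dom empty = empty"
proof -
  have "func empty empty B" by (rule funcI) auto
  then show "empty \<epsilon> seqs B" "dom empty = empty" using seqsI[OF empty_omega] dom_func by blast+
qed

text \<open>
  \<open>E\<close> is the set of even numbers, the stages at which player I moves.
\<close>

locale colouring_game = interval_game +
  fixes c E :: 'a
  assumes colouring: "func c R omega"
    and E0: "empty \<epsilon> E" and E_succ: "\<And>m. m \<epsilon> omega \<Longrightarrow> succ m \<epsilon> E \<longleftrightarrow> \<not> m \<epsilon> E"
begin

definition fault_of_II :: "'a \<Rightarrow> bool" where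
  "fault_of_II x \<longleftrightarrow> (\<exists>n. n \<epsilon> omega \<and> \<not> n \<epsilon> E \<and> violation n x \<and> (\<forall>m. m \<epsilon> n \<longrightarrow> \<not> violation m x))"

text \<open>
  Player I wins if player II is the first to break the rules, or if nobody breaks them and the reals
  captured by the run have the colour that player I declared in move \<open>0\<close>.
\<close>

definition payoff :: 'a where
  "payoff = Sep (funs omega omega) (\<lambda>x. fault_of_II x \<or>
     legal x omega \<and> (\<forall>z. z \<epsilon> R \<and> captures x z \<longrightarrow> ap c z = ap x empty))"

lemma mem_payoff: "x \<epsilon> payoff \<longleftrightarrow> func x omega omega \<and> (fault_of_II x \<or>
     legal x omega \<and> (\<forall>z. z \<epsilon> R \<and> captures x z \<longrightarrow> ap c z = ap x empty))"
proof -
  have "x \<epsilon> payoff \<longleftrightarrow> x \<epsilon> funs omega omega \<and> (fault_of_II x \<or>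
     legal x omega \<and> (\<forall>z. z \<epsilon> R \<and> captures x z \<longrightarrow> ap c z = ap x empty))"
    unfolding payoff_def
    by (rule mem_Sep, unfold fault_of_II_def) (rule dfn_rules)+
  then show ?thesis by simp
qed

lemma follows_I:
  assumes s: "strategy \<sigma>" and x: "func x omega omega" and f: "follows \<sigma> E x omega"
    and n: "even_stage n"
  shows "app x n = app \<sigma> (restrict x n)"
proof -
  have no: "n \<epsilon> omega" using n unfolding even_stage_def by blast
  have "n \<epsilon> E" using n even_stage_iff[OF E0 E_succ no] by blast
  then have "ap x n = ap \<sigma> (restrict x n)" using f no unfolding follows_def by blast
  then show ?thesis
    using app_eq_ap[OF x no] app_eq_ap[OF s[unfolded strategy_def positions_eq] restrict_run[OF x no]] by simp
qed

lemma follows_II: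
  assumes s: "strategy \<sigma>" and x: "func x omega omega"
    and odds: "\<And>n. n \<epsilon> odds \<longleftrightarrow> n \<epsilon> omega \<and> \<not> n \<epsilon> E" and f: "follows \<sigma> odds x omega"
    and n: "odd_stage n"
  shows "app x n = app \<sigma> (restrict x n)"
proof -
  have no: "n \<epsilon> omega" using n unfolding odd_stage_def by blast
  have "n \<epsilon> odds" using n even_stage_iff[OF E0 E_succ no] unfolding odds odd_stage_def by blast
  then have "ap x n = ap \<sigma> (restrict x n)" using f no unfolding follows_def by blast
  then show ?thesis
    using app_eq_ap[OF x no] app_eq_ap[OF s[unfolded strategy_def positions_eq] restrict_run[OF x no]] by simp
qed

text \<open>
  Against a strategy of player II, game \<open>w\<close> is the one in which player I declares colour \<open>w\<close>.  A point \<open>y\<close>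
  generic for all these games, without translation, is the only real captured by the run of game
  \<open>w = c y\<close>.  Player I has declared the right colour there and wins, although player II has followed the
  strategy.  This is the step in which the countability of the set of colours enters: it is the Baire
  category argument that the colour classes cannot all be meagre.
\<close>

lemma II_has_no_winning_strategy:
  assumes s: "strategy \<tau>" and w: "wins_II \<tau> payoff"
  shows False
proof -
  define odds where "odds = Sep omega (\<lambda>n. \<not> n \<epsilon> E)"
  have odds: "n \<epsilon> odds \<longleftrightarrow> n \<epsilon> omega \<and> \<not> n \<epsilon> E" for n
    unfolding odds_def by (rule mem_Sep) (rule dfn_rules)+
  have loses: "\<not> x \<epsilon> payoff" if "func x omega omega" "follows \<tau> odds x omega" for x
    using w follows_II[OF s that(1) odds that(2)] that(1) unfolding wins_II_def by blast
  interpret strategist mem R plusR timesR ltR zer on lo hi \<tau> odds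
  proof
    show "func \<tau> (seqs omega) omega" using s unfolding strategy_def positions_eq .
    show "succ n \<epsilon> odds \<longleftrightarrow> \<not> n \<epsilon> odds" if "n \<epsilon> omega" for n
      using that E_succ[OF that] by (simp add: odds del: mem_succ)
    show "\<exists>m. m \<epsilon> n \<and> violation m x"
      if "func x omega omega" "follows \<tau> odds x omega" "n \<epsilon> omega" "n \<epsilon> odds" "violation n x" for x n
      using loses[OF that(1,2)] that unfolding mem_payoff fault_of_II_def odds by blast
  qed
  \<comment> \<open>The root of game \<open>k\<close>: the declared colour and the ineffective answer of player II.\<close>
  define F where "F k = snoc (snoc empty k) (ap \<tau> (snoc empty k))" for k
  have F: "F k \<epsilon> nodes" "ap (F k) empty = k" "dom (F k) = succ (succ empty)" if k: "k \<epsilon> omega" for k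
  proof -
    note e1 = extend[OF empty_seq(1) k, unfolded empty_seq(2)]
    note e2 = extend[OF e1(1) answer_mem[OF e1(1)], unfolded e1(2), folded F_def]
    have p: "\<not> empty \<epsilon> odds" "succ empty \<epsilon> odds" "\<not> succ (succ empty) \<epsilon> odds"
      using E0 E_succ[of empty] E_succ[of "succ empty"] by (simp_all add: odds del: mem_succ)
    show d: "dom (F k) = succ (succ empty)" by (rule e2(2))
    have "obeys empty empty" unfolding follows_def by simp
    then have "obeys (F k) (succ (succ empty))" using e1(3) e2(3) p by simp
    moreover have "legal (F k) (succ (succ empty))"
      unfolding legal_def using early_no_violation mem_succ by blast
    ultimately show "F k \<epsilon> nodes" unfolding mem_nodes node_def d using e2(1) p late_two by blast
    have f1: "func (snoc empty k) (succ empty) omega" using e1(1,2) unfolding mem_seqs by simp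
    have f0: "func empty empty omega" using empty_seq(1)[of omega] empty_seq(2) unfolding mem_seqs by simp
    show "ap (F k) empty = k"
      using ap_snoc[OF _ f1 answer_mem[OF e1(1)], of empty] ap_snoc_last[OF _ f0 k] unfolding F_def by simp
  qed
  define \<rho> where "\<rho> = lam omega nodes F"
  have Fd: "dfnt (\<lambda>e. F (e 0))" unfolding F_def by (rule dfn_rules)+
  have \<rho>: "func \<rho> omega nodes" "\<And>k. k \<epsilon> omega \<Longrightarrow> ap \<rho> k = F k"
    unfolding \<rho>_def using func_lam[OF Fd, of omega nodes] ap_lam[OF Fd, of omega nodes] F by blast+
  define \<delta> where "\<delta> = lam omega R (\<lambda>n. zer)"
  have Zd: "dfnt (\<lambda>e. zer)" by (rule dfn_rules)
  have \<delta>: "func \<delta> omega R" "\<And>k. k \<epsilon> omega \<Longrightarrow> ap \<delta> k = zer"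
    unfolding \<delta>_def using func_lam[OF Zd, of omega R] ap_lam[OF Zd, of omega R] zer_mem by blast+
  have room: "room (ap \<rho> w) a b" if "w \<epsilon> omega" for w a b
    using that unfolding room_def by (auto simp: \<rho> F late_def)
  have h1: "le zer (add zer (ap \<delta> w))" and h2: "le (add on (ap \<delta> w)) on" if "w \<epsilon> omega" for w
    using that by (simp_all add: \<delta>(2))
  obtain y where y: "y \<epsilon> R" "\<forall>w. w \<epsilon> omega \<longrightarrow> (\<exists>x. func x omega omega \<and> obeys x omega \<and>
      legal x omega \<and> subset (ap \<rho> w) x \<and> (\<forall>z. z \<epsilon> R \<longrightarrow> captures x z \<longleftrightarrow> z = add y (ap \<delta> w)))"
    by (rule exE[OF generic_point[OF \<delta>(1) \<rho>(1) zer_mem on_mem one_pos le_refl le_refl h1 h2 room]],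
        assumption+, elim conjE, rule that)
  define w where "w = ap c y"
  have wo: "w \<epsilon> omega" unfolding w_def by (rule ap_mem[OF colouring y(1)])
  obtain x where x: "func x omega omega" "obeys x omega" "legal x omega" "subset (ap \<rho> w) x"
    "\<forall>z. z \<epsilon> R \<longrightarrow> captures x z = (z = add y (ap \<delta> w))" using mp[OF spec[OF y(2)] wo] by (elim exE conjE)
  have xw: "ap x empty = w"
    using prefix_ap[OF _ x(1,4), of empty] F[OF wo] empty_less_succ[of "succ empty"]
    unfolding \<rho>(2)[OF wo] mem_nodes by simp
  have "ap c z = ap x empty" if "z \<epsilon> R" "captures x z" for z
  proof -
    have "z = y" using x(5) that \<delta>(2)[OF wo] y(1) by simp
    then show ?thesis by (simp add: xw w_def)
  qed
  then have "x \<epsilon> payoff" unfolding mem_payoff using x(1,3) by blast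
  with loses x(1,2) show False by blast
qed

text \<open>
  A winning strategy of player I declares a colour \<open>k0\<close> and chooses an interval \<open>(p,q)\<close>; that it wins says
  in effect that almost all points of \<open>(p,q)\<close> have colour \<open>k0\<close>.  For a sequence of distinct small reals
  \<open>f i\<close>, the sums \<open>f i + f j\<close> form a countable set of translations, so for a generic \<open>y\<close> all
  \<open>y + f i + f j\<close> have colour \<open>k0\<close>.  These are exactly the elements of \<open>X + X\<close> for
  \<open>X = {y/2 + f i | i \<epsilon> \<omega>}\<close>; halving \<open>y\<close> is what allows sums \<open>a + a\<close> and sums \<open>a + b\<close> to be treated alike.
\<close>

lemma I_winning_strategy:
  assumes s: "strategy \<sigma>" and w: "wins_I \<sigma> payoff"
  shows "\<exists>X. subset X R \<and> equipotent omega X \<and> monochromatic c (sumset plusR X)"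
proof -
  have wins: "x \<epsilon> payoff" if "func x omega omega" "follows \<sigma> E x omega" for x
    using w follows_I[OF s that] that(1) unfolding wins_I_def by blast
  interpret strategist mem R plusR timesR ltR zer on lo hi \<sigma> E
  proof
    show "func \<sigma> (seqs omega) omega" using s unfolding strategy_def positions_eq .
    show "succ n \<epsilon> E \<longleftrightarrow> \<not> n \<epsilon> E" if "n \<epsilon> omega" for n by (rule E_succ[OF that])
    show "\<exists>m. m \<epsilon> n \<and> violation m x"
      if r: "func x omega omega" "follows \<sigma> E x omega" "n \<epsilon> omega" "n \<epsilon> E" "violation n x" for x n
    proof (rule ccontr)
      assume no: "\<not> (\<exists>m. m \<epsilon> n \<and> violation m x)"
      have "\<not> legal x omega" using r unfolding legal_def by blast
      then obtain m where m: "m \<epsilon> omega" "\<not> m \<epsilon> E" "violation m x" "\<And>k. k \<epsilon> m \<Longrightarrow> \<not> violation k x"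
        using wins[OF r(1,2)] unfolding mem_payoff fault_of_II_def by blast
      have "\<not> n \<epsilon> m" using m(4) r(5) by blast
      moreover have "\<not> m \<epsilon> n" using no m(3) by blast
      ultimately have "m = n" using omega_linear[OF m(1) r(3)] by blast
      with m(2) r(4) show False by blast
    qed
  qed
  define k0 where "k0 = ap \<sigma> empty"
  define s1 where "s1 = snoc empty k0"
  define s2 where "s2 = snoc s1 empty"
  define m0 where "m0 = ap \<sigma> s2"
  define t0 where "t0 = snoc s2 m0"
  have k0: "k0 \<epsilon> omega" unfolding k0_def by (rule answer_mem[OF empty_seq(1)])
  note e1 = extend[OF empty_seq(1) k0, unfolded empty_seq(2), folded s1_def]
  note e2 = extend[OF e1(1) empty_omega, unfolded e1(2), folded s2_def]
  have m0: "m0 \<epsilon> omega" unfolding m0_def by (rule answer_mem[OF e2(1)])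
  note e3 = extend[OF e2(1) m0, unfolded e2(2), folded t0_def]
  have p: "empty \<epsilon> E" "\<not> succ empty \<epsilon> E" "succ (succ empty) \<epsilon> E" "\<not> succ (succ (succ empty)) \<epsilon> E"
    using E0 E_succ[of empty] E_succ[of "succ empty"] E_succ[of "succ (succ empty)"]
    by (simp_all del: mem_succ)
  have "obeys empty empty" unfolding follows_def by simp
  then have "obeys s1 (succ empty)" using e1(3) k0_def by simp
  then have "obeys s2 (succ (succ empty))" using e2(3) p by simp
  then have "obeys t0 (succ (succ (succ empty)))" using e3(3) m0_def by simp
  moreover have "legal t0 (succ (succ (succ empty)))" unfolding legal_def using early_no_violation by blast
  ultimately have t0: "t0 \<epsilon> nodes" unfolding mem_nodes node_def e3(2) using e3(1) p late_three by blast
  have f0: "func empty empty omega" using empty_seq(1)[of omega] empty_seq(2) unfolding mem_seqs by simp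
  have f1: "func s1 (succ empty) omega" using e1(1,2) unfolding mem_seqs by simp
  have f2: "func s2 (succ (succ empty)) omega" using e2(1,2) unfolding mem_seqs by simp
  have t0_0: "ap t0 empty = k0"
    using ap_snoc[OF _ f2 m0, of empty] ap_snoc[OF _ f1 empty_omega, of empty] ap_snoc_last[OF _ f0 k0]
    unfolding t0_def s2_def s1_def by simp
  have t0_2: "ap t0 (succ (succ empty)) = m0"
    using ap_snoc_last[OF _ f2 m0] unfolding t0_def by simp
  define p where "p = ap lo m0"
  define q where "q = ap hi m0"
  have pq: "p \<epsilon> R" "q \<epsilon> R" "le zer p" "lt p q" "le q on"
    using base_bounds[OF m0] m0 unfolding p_def q_def by auto
  have room: "room t0 p q"
    unfolding room_def p_def q_def e3(2) using t0_2 by (auto simp: late_def)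
  \<comment> \<open>The translations \<open>f i + f j\<close> will be below \<open>2d\<close> and hence map \<open>(p,b)\<close> into \<open>(p,q)\<close>.\<close>
  obtain b d where bd: "b \<epsilon> R" "d \<epsilon> R" "lt p b" "lt zer d" "add b (add d d) = q"
    using margin[OF pq(1,2,4)] by blast
  define D where "D = Sep R (\<lambda>z. lt zer z \<and> lt z d)"
  have D: "z \<epsilon> D \<longleftrightarrow> z \<epsilon> R \<and> lt zer z \<and> lt z d" for z
    unfolding D_def by (rule mem_Sep) (rule dfn_rules)+
  obtain d0 where d0: "d0 \<epsilon> D" using between[of zer d] bd D by auto
  have "\<exists>f. func f omega D \<and> ap f empty = d0 \<and> (\<forall>n. n \<epsilon> omega \<longrightarrow> lt (ap f n) (ap f (succ n)))"
  proof (rule dependent_choice_from[OF _ d0])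
    show "dfn (\<lambda>e. lt (e (Suc 0)) (e (Suc (Suc 0))))" by (rule dfn_rules)+
    show "\<exists>y. y \<epsilon> D \<and> lt x y" if x: "x \<epsilon> D" for x
    proof -
      have x': "x \<epsilon> R" "lt zer x" "lt x d" using x D by blast+
      then obtain y where y: "y \<epsilon> R" "lt x y" "lt y d" using between[OF x'(1) bd(2)] by blast
      then have "lt zer y" using lt_trans[OF x'(2) y(2)] x'(1) by simp
      with y D show ?thesis by blast
    qed
  qed
  then obtain f where f: "func f omega D" "\<And>n. n \<epsilon> omega \<Longrightarrow> lt (ap f n) (ap f (succ n))"
    by (elim exE conjE) simp
  have fD: "ap f n \<epsilon> R" "lt zer (ap f n)" "lt (ap f n) d" if "n \<epsilon> omega" for n
    using ap_mem[OF f(1) that] D by auto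
  have f_mono: "lt (ap f m) (ap f n)" if "n \<epsilon> omega" "m \<epsilon> n" for m n
  proof -
    have "\<forall>m. m \<epsilon> n \<longrightarrow> lt (ap f m) (ap f n)" using that(1)
    proof (induction rule: omega_induct)
      case dfn show ?case by (rule dfn_rules)+
    next
      case (succ n)
      show ?case
      proof (intro allI impI)
        fix m assume "m \<epsilon> succ n"
        then show "lt (ap f m) (ap f (succ n))"
          using f(2)[OF succ.hyps] succ omega_trans[of m n] fD(1)
            lt_trans[of "ap f m" "ap f n" "ap f (succ n)"] by auto
      qed
    qed simp
    with that show ?thesis by blast
  qed
  have f_inj: "i = j" if "ap f i = ap f j" "i \<epsilon> omega" "j \<epsilon> omega" for i j
    using omega_linear[OF that(2,3)] f_mono[of i j] f_mono[of j i] that fD(1) lt_irrefl by metis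
  obtain g where gf: "func g omega (cart omega omega)"
    and gall: "\<And>s y. s \<epsilon> omega \<Longrightarrow> y \<epsilon> succ s \<Longrightarrow> \<exists>n. n \<epsilon> omega \<and> ap g n = pair s y"
    using pair_enumeration by (elim exE conjE) blast
  define G where "G n = add (ap f (pfst (ap g n))) (ap f (psnd (ap g n)))" for n
  have gp: "pfst (ap g n) \<epsilon> omega" "psnd (ap g n) \<epsilon> omega" if "n \<epsilon> omega" for n
    using ap_mem[OF gf that] by (auto simp: mem_cart)
  have G: "G n \<epsilon> R" "lt zer (G n)" "lt (G n) (add d d)" if n: "n \<epsilon> omega" for n
  proof -
    note u = fD[OF gp(1)[OF n]] and v = fD[OF gp(2)[OF n]]
    show "G n \<epsilon> R" unfolding G_def using u v by simp
    show "lt zer (G n)" unfolding G_def using add_strict_mono[OF u(2) v(2)] u v by simp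
    show "lt (G n) (add d d)" unfolding G_def using add_strict_mono[OF u(3) v(3)] u v bd by simp
  qed
  define \<delta> where "\<delta> = lam omega R G"
  have Gd: "dfnt (\<lambda>e. G (e 0))" unfolding G_def by (rule dfn_rules)+
  have \<delta>: "func \<delta> omega R" "\<And>k. k \<epsilon> omega \<Longrightarrow> ap \<delta> k = G k"
    unfolding \<delta>_def using func_lam[OF Gd, of omega R] ap_lam[OF Gd, of omega R] G by blast+
  define \<rho> where "\<rho> = lam omega nodes (\<lambda>n. t0)"
  have Td: "dfnt (\<lambda>e. t0)" by (rule dfn_rules)
  have \<rho>: "func \<rho> omega nodes" "\<And>k. k \<epsilon> omega \<Longrightarrow> ap \<rho> k = t0"
    unfolding \<rho>_def using func_lam[OF Td, of omega nodes] ap_lam[OF Td, of omega nodes] t0 by blast+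
  have above: "lt x (add x (G w))" if "w \<epsilon> omega" "x \<epsilon> R" for w x
    using lt_add_iff[of zer "G w" x] G[OF that(1)] that(2) by (simp add: add_comm)
  have below: "lt (add b (G w)) q" if "w \<epsilon> omega" for w
    using lt_add_iff[of "G w" "add d d" b] G[OF that] bd by (simp add: add_comm)
  have "lt b q" using lt_trans[OF above[of empty b] below[of empty]] bd pq G by simp
  then have b1: "le b on" using lt_le_trans[of b q on] pq bd by (simp add: lt_imp_le)
  have h1: "le zer (add p (ap \<delta> w))" if "w \<epsilon> omega" for w
    using le_lt_trans[OF pq(3) above[OF that pq(1)]] pq G[OF that] that by (simp add: \<delta> lt_imp_le)
  have h2: "le (add b (ap \<delta> w)) on" if "w \<epsilon> omega" for w
    using lt_le_trans[OF below[OF that] pq(5)] pq bd G[OF that] that by (simp add: \<delta> lt_imp_le)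
  have h3: "room (ap \<rho> w) (add p (ap \<delta> w)) (add b (ap \<delta> w))" if w: "w \<epsilon> omega" for w
    unfolding \<rho>(2)[OF w] \<delta>(2)[OF w]
    by (rule room_mono[OF t0 room lt_imp_le[OF above[OF w pq(1)]] lt_imp_le[OF below[OF w]]])
       (use pq bd G[OF w] in auto)
  obtain y where y: "y \<epsilon> R" "\<forall>w. w \<epsilon> omega \<longrightarrow> (\<exists>x. func x omega omega \<and> obeys x omega \<and>
      legal x omega \<and> subset (ap \<rho> w) x \<and> (\<forall>z. z \<epsilon> R \<longrightarrow> captures x z \<longleftrightarrow> z = add y (ap \<delta> w)))"
    by (rule exE[OF generic_point[OF \<delta>(1) \<rho>(1) pq(1) bd(1,3) pq(3) b1 h1 h2 h3]],
        assumption+, elim conjE, rule that)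
  have colour: "ap c (add y (G w)) = k0" if w: "w \<epsilon> omega" for w
  proof -
    have yG: "add y (G w) \<epsilon> R" using y(1) G(1)[OF w] by simp
    obtain x where x: "func x omega omega" "obeys x omega" "legal x omega" "subset t0 x"
      "\<forall>z. z \<epsilon> R \<longrightarrow> captures x z = (z = add y (G w))"
      using mp[OF spec[OF y(2)] w] unfolding \<rho>(2)[OF w] \<delta>(2)[OF w] by (elim exE conjE)
    then have xc: "captures x (add y (G w))" using yG by blast
    have "ap x empty = k0"
      using prefix_ap[OF e3(1) x(1,4), of empty] t0_0 e3(2) empty_less_succ[of "succ (succ empty)"]
      by simp
    moreover have "\<not> fault_of_II x" using x(3) unfolding fault_of_II_def legal_def by blast
    ultimately show ?thesis using wins[OF x(1,2)] xc yG unfolding mem_payoff by auto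
  qed
  obtain h where h: "h \<epsilon> R" "add h h = y" using halving[OF y(1)] by blast
  define X where "X = Sep R (\<lambda>z. \<exists>i. i \<epsilon> omega \<and> z = add h (ap f i))"
  have "z \<epsilon> X \<longleftrightarrow> z \<epsilon> R \<and> (\<exists>i. i \<epsilon> omega \<and> z = add h (ap f i))" for z
    unfolding X_def by (rule mem_Sep) (rule dfn_rules)+
  then have X: "z \<epsilon> X \<longleftrightarrow> (\<exists>i. i \<epsilon> omega \<and> z = add h (ap f i))" for z using h fD(1) add_mem by metis
  have XR: "z \<epsilon> R" if "z \<epsilon> X" for z using that X h(1) fD(1) by auto
  have "equipotent omega X"
  proof -
    have hd: "dfnt (\<lambda>e. add h (ap f (e 0)))" by (rule dfn_rules)+
    have hX: "add h (ap f i) \<epsilon> X" if "i \<epsilon> omega" for i using X that by blast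
    let ?e = "lam omega X (\<lambda>i. add h (ap f i))"
    have e: "func ?e omega X" by (rule func_lam[OF hd]) (rule hX)
    have ea: "ap ?e i = add h (ap f i)" if "i \<epsilon> omega" for i by (rule ap_lam[OF hd _ that]) (rule hX)
    have "\<exists>!i. i \<epsilon> omega \<and> app ?e i = z" if z: "z \<epsilon> X" for z
    proof -
      obtain i where i: "i \<epsilon> omega" "z = add h (ap f i)" using z X by blast
      show ?thesis
      proof (rule ex1I[of _ i])
        show "i \<epsilon> omega \<and> app ?e i = z" using i ea app_eq_ap[OF e] by simp
        fix j assume j: "j \<epsilon> omega \<and> app ?e j = z"
        then have "add h (ap f j) = add h (ap f i)" using i(2) ea[of j] app_eq_ap[OF e, of j] by metis
        then have "ap f j = ap f i" using add_cancel[of "ap f j" "ap f i" h] add_comm h fD(1) i(1) j by metis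
        then show "j = i" using f_inj i(1) j by blast
      qed
    qed
    then show ?thesis unfolding equipotent_def using e by blast
  qed
  moreover have "app c z = k0" if z: "z \<epsilon> sumset plusR X" for z
  proof -
    have "is_set (\<lambda>z. \<exists>a b. a \<epsilon> X \<and> b \<epsilon> X \<and> z = add a b)"
    proof (rule is_set_sep[where a = R])
      show "dfn (\<lambda>e. \<exists>a b. a \<epsilon> X \<and> b \<epsilon> X \<and> e 0 = add a b)" by (rule dfn_rules)+
    qed (use XR in auto)
    moreover have "(\<lambda>z. \<exists>a b. a \<epsilon> X \<and> b \<epsilon> X \<and> z = app2 plusR a b) = (\<lambda>z. \<exists>a b. a \<epsilon> X \<and> b \<epsilon> X \<and> z = add a b)"
      using XR app2_plus by (intro HOL.ext) metis
    ultimately have "\<exists>a b. a \<epsilon> X \<and> b \<epsilon> X \<and> z = add a b"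
      using z mem_coll unfolding sumset_def by simp
    then obtain i j where ij: "i \<epsilon> omega" "j \<epsilon> omega" "z = add (add h (ap f i)) (add h (ap f j))"
      unfolding X by blast
    note u = fD(1)[OF ij(1)] and v = fD(1)[OF ij(2)]
    have z': "z = add y (add (ap f i) (ap f j))"
    proof -
      have "z = add h (add (ap f i) (add h (ap f j)))" unfolding ij(3) using add_assoc h u v by simp
      also have "\<dots> = add h (add (add (ap f i) h) (ap f j))" using add_assoc h u v by simp
      also have "\<dots> = add h (add h (add (ap f i) (ap f j)))" using add_assoc add_comm[OF u h(1)] h u v by simp
      also have "\<dots> = add y (add (ap f i) (ap f j))" using add_assoc[of h h] h u v by simp
      finally show ?thesis .
    qed
    have "\<exists>n. n \<epsilon> omega \<and> G n = add (ap f i) (ap f j)"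
    \<comment> \<open>Only pairs with second component at most the first are enumerated; commutativity covers the rest.\<close>
    proof (cases "j \<epsilon> succ i")
      case True
      then obtain n where "n \<epsilon> omega" "ap g n = pair i j" using gall ij by blast
      then show ?thesis unfolding G_def by auto
    next
      case False
      then have "i \<epsilon> succ j" using omega_linear[OF ij(1,2)] by auto
      then obtain n where "n \<epsilon> omega" "ap g n = pair j i" using gall ij by blast
      then show ?thesis unfolding G_def using add_comm[OF u v] by auto
    qed
    then have "ap c z = k0" unfolding z' using colour by metis
    moreover have "z \<epsilon> R" unfolding z' using y(1) u v by simp
    ultimately show ?thesis using app_eq_ap[OF colouring] by simp
  qed
  ultimately show ?thesis unfolding monochromatic_def subset_def using XR by metis
qed

end

lemma (in zf_reals) sum_arrow_reals:
  assumes "AD" shows "sum_arrow R plusR omega omega"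
  unfolding sum_arrow_def
proof (intro allI impI)
  fix c assume c: "func c R omega"
  obtain lo hi where base: "base lo hi" using base_exists by blast
  obtain E where E: "empty \<epsilon> E" "\<And>m. m \<epsilon> omega \<Longrightarrow> succ m \<epsilon> E \<longleftrightarrow> \<not> m \<epsilon> E" using even_set_exists by blast
  interpret colouring_game mem R plusR timesR ltR zer on lo hi c E
    by unfold_locales (fact base c E)+
  have "\<forall>x. x \<epsilon> payoff \<longrightarrow> func x omega omega" using mem_payoff by blast
  then have "(\<exists>\<sigma>. strategy \<sigma> \<and> wins_I \<sigma> payoff) \<or> (\<exists>\<tau>. strategy \<tau> \<and> wins_II \<tau> payoff)"
    using assms unfolding AD_def by blast
  then show "\<exists>X. subset X R \<and> equipotent omega X \<and> monochromatic c (sumset plusR X)"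
    using I_winning_strategy II_has_no_winning_strategy by blast
qed

theorem theorem3p3:
  fixes mem :: "'a \<Rightarrow> 'a \<Rightarrow> bool" and R plusR timesR ltR :: 'a
  assumes "set_structure.ZF mem"
    and "set_structure.AD mem"
    and "set_structure.DC mem"
    and "set_structure.complete_ordered_field mem R plusR timesR ltR"
  shows "set_structure.sum_arrow mem R plusR (set_structure.omega mem) (set_structure.omega mem)"
proof -
  interpret zf_dc mem by unfold_locales (fact assms)+
  note C = assms(4)[unfolded complete_ordered_field_def Let_def]
  have "\<exists>zer on. ordered_field
        \<lparr>carrier = {x. mem x R}, monoid.mult = app2 timesR, one = on, zero = zer, add = app2 plusR\<rparr>
        (\<lambda>x y. mem (pair x y) ltR)"
    using C by (elim conjE)
  then obtain zer on where F: "ordered_field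
        \<lparr>carrier = {x. mem x R}, monoid.mult = app2 timesR, one = on, zero = zer, add = app2 plusR\<rparr>
        (\<lambda>x y. mem (pair x y) ltR)"
    by (elim exE)
  interpret zf_reals mem R plusR timesR ltR zer on
  proof (intro zf_reals.intro zf_reals_axioms.intro)
    show "zf_dc mem" by (rule zf_dc_axioms)
    show "func plusR (cart R R) R" using C by (elim conjE)
    show "func timesR (cart R R) R" using C by (elim conjE)
    fix S x b
    assume S: "subset S R" "mem x S" "mem b R" and "\<And>x. mem x S \<Longrightarrow> mem (pair x b) ltR \<or> x = b"
    then have "\<forall>x. mem x S \<longrightarrow> mem (pair x b) ltR \<or> x = b" by simp
    have S': "subset S R \<and> (\<exists>x. mem x S) \<and>
        (\<exists>b. mem b R \<and> (\<forall>x. mem x S \<longrightarrow> mem (pair x b) ltR \<or> x = b))"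
      using S \<open>\<forall>x. mem x S \<longrightarrow> mem (pair x b) ltR \<or> x = b\<close> by blast
    have "\<forall>S. subset S R \<and> (\<exists>x. mem x S) \<and>
        (\<exists>b. mem b R \<and> (\<forall>x. mem x S \<longrightarrow> mem (pair x b) ltR \<or> x = b)) \<longrightarrow>
      (\<exists>s. (mem s R \<and> (\<forall>x. mem x S \<longrightarrow> mem (pair x s) ltR \<or> x = s)) \<and>
        (\<forall>b. mem b R \<and> (\<forall>x. mem x S \<longrightarrow> mem (pair x b) ltR \<or> x = b) \<longrightarrow>
          mem (pair s b) ltR \<or> s = b))"
      using C by (elim conjE)
    from mp[OF spec[OF this, of S] S'] show "\<exists>s. mem s R \<and> (\<forall>x. mem x S \<longrightarrow> mem (pair x s) ltR \<or> x = s) \<and>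
        (\<forall>b. mem b R \<and> (\<forall>x. mem x S \<longrightarrow> mem (pair x b) ltR \<or> x = b) \<longrightarrow>
          mem (pair s b) ltR \<or> s = b)" unfolding conj_assoc .
  qed (rule F)
  show ?thesis by (rule sum_arrow_reals[OF assms(2)])
qed

end
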